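(* Let $p$ be a prime and let $G$ be a finitely generated pro-$p$ group with positive rank gradient, i.e. $RG(G)>0$. Then $G$ contains a dense non-abelian free subgroup.
   Context: For a profinite group $H$, $d(H)$ denotes the minimal number of topological generators of $H$. The rank gradient of a finitely generated profinite group $G$ is $$RG(G)=\inf\left\{\frac{d(H)-1}{|G:H|}\ \middle|\ H \text{ an open subgroup of } G\right\}.$$ Here "free subgroup" means free as an abstract group, and "dense" refers to the profinite topology of $G$. *)

theory Defs
  imports
    "HOL-Analysis.Analysis"
    "HOL-Algebra.Generated_Groups"
    "HOL-Computational_Algebra.Primes"
begin

section \<open>Profinite and pro-p groups\<close>

locale topological_group = group G for G (structure) +
  fixes T :: "'a topology"
  assumes topspace_eq: "topspace T = carrier G"
    and continuous_mult: "continuous_map (prod_topology T T) T (\<lambda>(x, y). x \<otimes> y)"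
    and continuous_inv: "continuous_map T T (\<lambda>x. inv x)"

definition totally_disconnected_space :: "'a topology \<Rightarrow> bool" where
  "totally_disconnected_space T \<longleftrightarrow>
     (\<forall>x \<in> topspace T. connected_component_of_set T x = {x})"

locale profinite_group = topological_group +
  assumes compact: "compact_space T"
    and Hausdorff: "Hausdorff_space T"
    and totally_disconnected: "totally_disconnected_space T"

locale pro_p_group = profinite_group +
  fixes p :: nat
  assumes prime_p: "prime p"
    and index_p_power: "\<And>N. N \<lhd> G \<Longrightarrow> openin T N \<Longrightarrow> \<exists>k. order (G Mod N) = p ^ k"


section \<open>Topological generation and rank gradient\<close>

definition topologically_generates ::
  "('a, 'b) monoid_scheme \<Rightarrow> 'a topology \<Rightarrow> 'a set \<Rightarrow> bool" where
  "topologically_generates G T X \<longleftrightarrow>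
     X \<subseteq> carrier G \<and> T closure_of (generate G X) = carrier G"

definition topologically_finitely_generated ::
  "('a, 'b) monoid_scheme \<Rightarrow> 'a topology \<Rightarrow> bool" where
  "topologically_finitely_generated G T \<longleftrightarrow>
     (\<exists>X. finite X \<and> topologically_generates G T X)"

text \<open>The minimal number of topological generators, with value \<open>\<infinity>\<close> if there is no finite
  topologically generating set.\<close>

definition top_rank :: "('a, 'b) monoid_scheme \<Rightarrow> 'a topology \<Rightarrow> enat" where
  "top_rank G T = (INF X \<in> {X. finite X \<and> topologically_generates G T X}. enat (card X))"

text \<open>An open subgroup is given the induced group structure and the subspace topology.  In a
  profinite group its index is finite by compactness, so \<open>card\<close> is the actual index.\<close>

definition rank_gradient :: "('a, 'b) monoid_scheme \<Rightarrow> 'a topology \<Rightarrow> ereal" where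
  "rank_gradient G T =
     (INF H \<in> {H. subgroup H G \<and> openin T H}.
        (ereal_of_enat (top_rank (G\<lparr>carrier := H\<rparr>) (subtopology T H)) - 1)
          / ereal (real (card (rcosets\<^bsub>G\<^esub> H))))"


section \<open>Abstract free groups\<close>

text \<open>A word over \<open>S\<close> is a list of pairs, where \<open>(x, True)\<close> stands for the letter \<open>x\<close> and
  \<open>(x, False)\<close> for its formal inverse.\<close>

definition letter_val :: "('a, 'b) monoid_scheme \<Rightarrow> 'a \<times> bool \<Rightarrow> 'a" where
  "letter_val G l = (if snd l then fst l else inv\<^bsub>G\<^esub> (fst l))"

definition word_val :: "('a, 'b) monoid_scheme \<Rightarrow> ('a \<times> bool) list \<Rightarrow> 'a" where
  "word_val G w = foldr (\<lambda>l g. letter_val G l \<otimes>\<^bsub>G\<^esub> g) w \<one>\<^bsub>G\<^esub>"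

definition reduced_word :: "('a \<times> bool) list \<Rightarrow> bool" where
  "reduced_word w \<longleftrightarrow> successively (\<lambda>l m. \<not> (fst l = fst m \<and> snd l \<noteq> snd m)) w"

definition free_basis :: "('a, 'b) monoid_scheme \<Rightarrow> 'a set \<Rightarrow> bool" where
  "free_basis G S \<longleftrightarrow>
     S \<subseteq> carrier G \<and> generate G S = carrier G \<and>
     (\<forall>w. fst ` set w \<subseteq> S \<and> reduced_word w \<and> w \<noteq> [] \<longrightarrow> word_val G w \<noteq> \<one>\<^bsub>G\<^esub>)"

definition free_group :: "('a, 'b) monoid_scheme \<Rightarrow> bool" where
  "free_group G \<longleftrightarrow> group G \<and> (\<exists>S. free_basis G S)"

end

theory Submission
  imports Defs "HOL-Algebra.Multiplicative_Group" "HOL-Number_Theory.Residues" "HOL-Real_Asymp.Real_Asymp"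
begin

text \<open>
  Write \<open>K^\<close> for the finite group of continuous characters of an open subgroup \<open>K\<close> with values in the
  complex \<open>p\<close>-th roots of unity.  In a pro-\<open>p\<close> group the rank of \<open>K\<close> is \<open>log p (card K^)\<close>
  (lemmas \<open>burnside_basis\<close> and \<open>schreier_bound\<close>), so a positive rank gradient says that
  \<open>log p (card K^)\<close> grows at least linearly in the index of \<open>K\<close>.  All arguments count characters.

  Let \<open>\<rho>\<close> be the infimum of \<open>log p (card K^) / |G:K|\<close>.  Below a suitable open normal subgroup \<open>H0\<close>
  this quotient stays under \<open>3/2 \<rho>\<close> (\<open>exists_tight\<close>).  For \<open>t\<close> in \<open>H0\<close> outside an open normal
  \<open>H \<le> H0\<close>, the group generated by \<open>t\<close> and \<open>H\<close> has at most half the index of \<open>H\<close>, hence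
  substantially fewer characters than \<open>H\<close>; as characters of \<open>H\<close> fixed by \<open>t\<close> almost extend to this group,
  \<open>t\<close> moves most characters of \<open>H\<close>.  It follows that the centralizer \<open>C\<close> of \<open>H0\<close> in \<open>G\<close> meets \<open>H0\<close>
  trivially, and that every element outside \<open>C\<close> moves most characters of every small \<open>H\<close>
  (\<open>card_fixed_characters_noncentral\<close>).

  A dense free subgroup is found by a Baire category argument: inside a product of cosets, one word after
  the other is made nontrivial by passing to smaller cosets, and compactness gives a tuple on which no reduced word
  vanishes.  The tuple is started at generators of \<open>G\<close> modulo the Frattini subgroup, so it generates a
  dense subgroup (\<open>generates_perturb\<close>).  What has to be excluded is a nonempty reduced word \<open>w\<close> that is trivial on a
  whole product of cosets.  Take \<open>w\<close> of minimal length among the words with values in \<open>C\<close> on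
  some product of small cosets.  Multiplying one variable by a small element \<open>y\<close> changes the value of \<open>w\<close> by a product
  of conjugates of \<open>y\<close> and its inverse by values \<open>g\<close> of prefixes of \<open>w\<close>; since \<open>C\<close> meets \<open>H0\<close> trivially, this
  product is \<open>\<one>\<close>.  By minimality the quotients of the different \<open>g\<close> are outside \<open>C\<close>.
  So there are finitely many \<open>h\<close> outside \<open>C\<close> such that each small \<open>y\<close> lies in every
  subgroup that contains all conjugates of \<open>y\<close> by these \<open>h\<close> (\<open>not_central_on_coset\<close>).

  This is impossible (\<open>noncentral_conjugates_not_controlling\<close>).  Since the \<open>h\<close> move most
  characters of a small \<open>H\<close>, one can choose \<open>s\<close> characters of \<open>H\<close> whose common kernel \<open>L\<close> has index \<open>p^s\<close>
  in \<open>H\<close> and satisfies \<open>H = L (h^-1 L h)\<close> for every \<open>h\<close>.  Commutators of elements of \<open>h^-1 L h\<close> lie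
  in the Frattini subgroup of \<open>h^-1 L h\<close>; an iterated commutator involving all \<open>h\<close> therefore has all its
  conjugates in the Frattini subgroup of \<open>L\<close>, and by the property above lies there
  itself.  Hence \<open>H\<close> acts unipotently on \<open>L^\<close>, of class bounded by the number of the \<open>h\<close>, and
  \<open>log p (card L^)\<close> is at most a polynomial in \<open>s\<close> times \<open>|G:H|\<close>.  But it is at least
  \<open>\<rho> p^s |G:H|\<close>, a contradiction for large \<open>s\<close>.
\<close>

section \<open>Open subgroups of a profinite group\<close>

context group begin

lemma inv_mult_cancel_left [simp]:
  "x \<in> carrier G \<Longrightarrow> y \<in> carrier G \<Longrightarrow> inv x \<otimes> (x \<otimes> y) = y"
  "x \<in> carrier G \<Longrightarrow> y \<in> carrier G \<Longrightarrow> x \<otimes> (inv x \<otimes> y) = y"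
  by (simp_all add: m_assoc[symmetric])

lemmas word_simps = m_assoc inv_mult_group

lemma normal_conj_closed:
  "N \<lhd> G \<Longrightarrow> x \<in> carrier G \<Longrightarrow> n \<in> N \<Longrightarrow> x \<otimes> n \<otimes> inv x \<in> N"
  by (rule normal.inv_op_closed2)

lemma subgroup_in_carrier: "subgroup H G \<Longrightarrow> x \<in> H \<Longrightarrow> x \<in> carrier G"
  by (rule subgroup.mem_carrier)

lemma r_coset_eq_iff:
  assumes "subgroup H G" "x \<in> carrier G" "y \<in> carrier G"
  shows "H #> x = H #> y \<longleftrightarrow> y \<otimes> inv x \<in> H"
proof
  assume "H #> x = H #> y"
  then have "y \<in> H #> x" using assms by (simp add: rcos_self)
  then obtain h where "h \<in> H" "y = h \<otimes> x" by (auto simp: r_coset_def)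
  then show "y \<otimes> inv x \<in> H" using assms by (simp add: m_assoc subgroup_in_carrier)
next
  assume a: "y \<otimes> inv x \<in> H"
  have "y = (y \<otimes> inv x) \<otimes> x" using assms by (simp add: m_assoc)
  then have "y \<in> H #> x" using a unfolding r_coset_def by blast
  then show "H #> x = H #> y" using repr_independence assms by blast
qed

end

context topological_group begin

definition open_subgroup :: "'a set \<Rightarrow> bool" where
  "open_subgroup H \<longleftrightarrow> subgroup H G \<and> openin T H"

definition open_normal :: "'a set \<Rightarrow> bool" where
  "open_normal N \<longleftrightarrow> N \<lhd> G \<and> openin T N"

lemma open_subgroupD:
  assumes "open_subgroup H"
  shows "subgroup H G" "openin T H" "H \<subseteq> carrier G" "\<one> \<in> H"
    "x \<in> H \<Longrightarrow> x \<in> carrier G" "x \<in> H \<Longrightarrow> inv x \<in> H" "x \<in> H \<Longrightarrow> y \<in> H \<Longrightarrow> x \<otimes> y \<in> H"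
proof -
  show H: "subgroup H G" and "openin T H" using assms by (simp_all add: open_subgroup_def)
  show "H \<subseteq> carrier G" "\<one> \<in> H" using H by (simp_all add: subgroup.subset subgroup.one_closed)
  show "x \<in> H \<Longrightarrow> x \<in> carrier G" "x \<in> H \<Longrightarrow> inv x \<in> H" "x \<in> H \<Longrightarrow> y \<in> H \<Longrightarrow> x \<otimes> y \<in> H"
    using H by (simp_all add: subgroup.mem_carrier subgroup.m_inv_closed subgroup.m_closed)
qed

lemma open_normal_imp_open_subgroup: "open_normal N \<Longrightarrow> open_subgroup N"
  by (simp add: open_normal_def open_subgroup_def normal_imp_subgroup)

lemma open_normal_conj:
  "open_normal N \<Longrightarrow> x \<in> carrier G \<Longrightarrow> n \<in> N \<Longrightarrow> x \<otimes> n \<otimes> inv x \<in> N"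
  by (simp add: open_normal_def normal_conj_closed)

lemma open_normal_conj':
  "open_normal N \<Longrightarrow> x \<in> carrier G \<Longrightarrow> n \<in> N \<Longrightarrow> inv x \<otimes> n \<otimes> x \<in> N"
  using open_normal_conj[of N "inv x" n] by simp

lemma continuous_map_mult:
  assumes "continuous_map X T f" "continuous_map X T g"
  shows "continuous_map X T (\<lambda>x. f x \<otimes> g x)"
proof -
  have "continuous_map X (prod_topology T T) (\<lambda>x. (f x, g x))"
    using assms by (simp add: continuous_map_pairwise o_def)
  from continuous_map_compose[OF this continuous_mult] show ?thesis
    by (simp add: o_def)
qed

lemma continuous_map_inverse:
  assumes "continuous_map X T f"
  shows "continuous_map X T (\<lambda>x. inv (f x))"
  using continuous_map_compose[OF assms continuous_inv] by (simp add: o_def)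

lemma continuous_map_const_carrier: "c \<in> carrier G \<Longrightarrow> continuous_map X T (\<lambda>x. c)"
  by (simp add: topspace_eq)

lemmas continuous_group_intros =
  continuous_map_mult continuous_map_inverse continuous_map_const_carrier continuous_map_id[unfolded id_def]

lemma openin_left_translate:
  assumes "openin T U" "x \<in> carrier G"
  shows "openin T {y \<in> carrier G. x \<otimes> y \<in> U}"
proof -
  have "continuous_map T T (\<lambda>y. x \<otimes> y)"
    using assms by (intro continuous_group_intros)
  from openin_continuous_map_preimage[OF this assms(1)] show ?thesis
    by (simp add: topspace_eq)
qed

text \<open>A subgroup is the union of the translates of any neighbourhood of \<open>\<one>\<close> inside it.\<close>

lemma subgroup_openI:
  assumes H: "subgroup H G" and U: "openin T U" "\<one> \<in> U" "U \<subseteq> H"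
  shows "open_subgroup H"
proof -
  have "openin T H"
  proof (subst openin_subopen, intro ballI)
    fix h assume h: "h \<in> H"
    then have hc: "h \<in> carrier G" using H by (rule subgroup_in_carrier[rotated])
    let ?V = "{y \<in> carrier G. inv h \<otimes> y \<in> U}"
    have "openin T ?V" using U hc by (intro openin_left_translate) auto
    moreover have "h \<in> ?V" using hc U by simp
    moreover have "?V \<subseteq> H"
    proof
      fix y assume y: "y \<in> ?V"
      then have "h \<otimes> (inv h \<otimes> y) \<in> H"
        using U h y by (auto intro!: subgroup.m_closed[OF H h])
      then show "y \<in> H" using y hc by simp
    qed
    ultimately show "\<exists>V. openin T V \<and> h \<in> V \<and> V \<subseteq> H" by blast
  qed
  then show ?thesis using H by (simp add: open_subgroup_def)
qed

lemma open_subgroup_superset: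
  assumes "open_subgroup U" "subgroup H G" "U \<subseteq> H"
  shows "open_subgroup H"
  using subgroup_openI[of H U] assms open_subgroupD[OF assms(1)] by blast

lemma open_subgroup_Int:
  "open_subgroup H \<Longrightarrow> open_subgroup K \<Longrightarrow> open_subgroup (H \<inter> K)"
  unfolding open_subgroup_def by (auto intro: subgroups_Inter_pair)

lemma open_normal_Int:
  "open_normal M \<Longrightarrow> open_normal N \<Longrightarrow> open_normal (M \<inter> N)"
  unfolding open_normal_def by (auto intro: normal_subgroup_intersect)

lemma open_subgroup_carrier: "open_subgroup (carrier G)"
  unfolding open_subgroup_def using subgroup_self topspace_eq openin_topspace[of T] by simp

lemma openin_left_coset:
  assumes "open_subgroup H" "x \<in> carrier G"
  shows "openin T {y \<in> carrier G. inv x \<otimes> y \<in> H}"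
  using assms by (intro openin_left_translate) (auto simp: open_subgroupD)

lemma closedin_left_coset:
  assumes H: "open_subgroup H" and x: "x \<in> carrier G"
  shows "closedin T {y \<in> carrier G. inv x \<otimes> y \<in> H}"
proof -
  note Hs = open_subgroupD[OF H]
  have "openin T {y \<in> carrier G. inv x \<otimes> y \<notin> H}"
  proof (subst openin_subopen, intro ballI)
    fix k assume "k \<in> {y \<in> carrier G. inv x \<otimes> y \<notin> H}"
    then have k: "k \<in> carrier G" "inv x \<otimes> k \<notin> H" by auto
    let ?V = "{y \<in> carrier G. inv k \<otimes> y \<in> H}"
    have "openin T ?V" using H k by (intro openin_left_coset) auto
    moreover have "k \<in> ?V" using k Hs by simp
    moreover have "inv x \<otimes> y \<notin> H" if "y \<in> ?V" for y
    proof
      assume a: "inv x \<otimes> y \<in> H"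
      have "(inv x \<otimes> y) \<otimes> inv (inv k \<otimes> y) \<in> H" using a that Hs by auto
      moreover have "(inv x \<otimes> y) \<otimes> inv (inv k \<otimes> y) = inv x \<otimes> k"
        using k that x by (simp add: word_simps)
      ultimately show False using k by simp
    qed
    ultimately show "\<exists>V. openin T V \<and> k \<in> V \<and> V \<subseteq> {y \<in> carrier G. inv x \<otimes> y \<notin> H}" by blast
  qed
  moreover have "{y \<in> carrier G. inv x \<otimes> y \<notin> H} = topspace T - {y \<in> carrier G. inv x \<otimes> y \<in> H}"
    by (auto simp: topspace_eq)
  ultimately show ?thesis by (simp add: closedin_def topspace_eq)
qed

lemma closedin_open_subgroup: "open_subgroup H \<Longrightarrow> closedin T H"
proof -
  assume H: "open_subgroup H"
  have "{y \<in> carrier G. inv \<one> \<otimes> y \<in> H} = H" using open_subgroupD[OF H] by auto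
  then show ?thesis using closedin_left_coset[OF H one_closed] by simp
qed

end

context profinite_group begin

text \<open>In a compact Hausdorff space components and quasi-components agree, so total disconnectedness separates
  \<open>\<one>\<close> from the compact complement of a neighbourhood by a clopen set.\<close>

lemma clopen_nhd_one:
  assumes W: "openin T W" "\<one> \<in> W"
  shows "\<exists>A. openin T A \<and> closedin T A \<and> \<one> \<in> A \<and> A \<subseteq> W"
proof -
  have one: "\<one> \<in> topspace T" by (simp add: topspace_eq)
  have "connected_component_of_set T \<one> = {\<one>}"
    using totally_disconnected one by (simp add: totally_disconnected_space_def)
  moreover have "quasi_components_of T = connected_components_of T"
    using compact Hausdorff by (intro quasi_eq_connected_components_of) auto
  ultimately have "{\<one>} \<in> quasi_components_of T"
    using one by (auto simp: connected_components_of_def)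
  moreover have "compactin T (topspace T - W)"
    using W by (intro closedin_compact_space compact) auto
  ultimately have "separated_between T {\<one>} (topspace T - W)"
    using W by (simp add: separated_between_quasi_component_compact)
  then obtain U V where UV: "openin T U" "openin T V" "U \<union> V = topspace T" "disjnt U V"
    "\<one> \<in> U" "topspace T - W \<subseteq> V"
    unfolding separated_between_def by auto
  have "U = topspace T - V" using UV by (auto simp: disjnt_def)
  then have "closedin T U" using UV by (metis closedin_diff closedin_topspace)
  moreover have "U \<subseteq> W" using UV openin_subset[OF UV(1)] by (auto simp: disjnt_def)
  ultimately show ?thesis using UV by blast
qed

text \<open>By the tube lemma, a condition that is open in a parameter ranging over a compact set and
  that holds at \<open>\<one>\<close> for all parameters holds uniformly on a neighbourhood of \<open>\<one>\<close>.\<close>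

lemma uniform_nhd_one:
  assumes A: "compactin T A" and B: "openin T B"
    and f: "continuous_map (prod_topology T T) T (\<lambda>z. f (fst z) (snd z))"
    and fA: "\<And>a. a \<in> A \<Longrightarrow> f a \<one> \<in> B"
  shows "\<exists>V. openin T V \<and> \<one> \<in> V \<and> (\<forall>a\<in>A. \<forall>v\<in>V. f a v \<in> B)"
proof -
  let ?W = "{z \<in> topspace (prod_topology T T). f (fst z) (snd z) \<in> B}"
  have 1: "openin (prod_topology T T) ?W" using openin_continuous_map_preimage[OF f B] .
  have 2: "\<one> \<in> topspace T" by (simp add: topspace_eq)
  have 3: "A \<times> {\<one>} \<subseteq> ?W"
    using fA subsetD[OF compactin_subset_topspace[OF A]] 2 by auto
  obtain U V where UV: "openin T V" "A \<subseteq> U" "\<one> \<in> V" "U \<times> V \<subseteq> ?W"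
    using tube_lemma_left[OF 1 A 2 3] by blast
  have "f a v \<in> B" if "a \<in> A" "v \<in> V" for a v
  proof -
    have "(a, v) \<in> ?W" using UV that by blast
    then show ?thesis by simp
  qed
  then show ?thesis using UV by blast
qed

text \<open>The right stabilizer of a clopen neighbourhood \<open>A\<close> of \<open>\<one>\<close> is a subgroup contained in \<open>A\<close>, and
  it is open because, uniformly in \<open>a \<in> A\<close>, right multiplication by elements near \<open>\<one>\<close> keeps \<open>a\<close> in \<open>A\<close>.\<close>

lemma open_subgroup_basis:
  assumes W: "openin T W" "\<one> \<in> W"
  shows "\<exists>H. open_subgroup H \<and> H \<subseteq> W"
proof -
  obtain A where A: "openin T A" "closedin T A" "\<one> \<in> A" "A \<subseteq> W"
    using clopen_nhd_one[OF W] by blast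
  have Ac: "A \<subseteq> carrier G" using openin_subset[OF A(1)] by (simp add: topspace_eq)
  have cA: "compactin T A" using A compact by (simp add: closedin_compact_space)
  have f1: "continuous_map (prod_topology T T) T (\<lambda>z. fst z \<otimes> snd z)"
    by (intro continuous_group_intros continuous_map_fst continuous_map_snd)
  have f2: "continuous_map (prod_topology T T) T (\<lambda>z. fst z \<otimes> inv (snd z))"
    by (intro continuous_group_intros continuous_map_fst continuous_map_snd)
  have A1: "a \<otimes> \<one> \<in> A" "a \<otimes> inv \<one> \<in> A" if "a \<in> A" for a
    using that subsetD[OF Ac that] by simp_all
  obtain V1 where V1: "openin T V1" "\<one> \<in> V1" "\<forall>a\<in>A. \<forall>v\<in>V1. a \<otimes> v \<in> A"
    using uniform_nhd_one[OF cA A(1) f1 A1(1)] by blast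
  obtain V2 where V2: "openin T V2" "\<one> \<in> V2" "\<forall>a\<in>A. \<forall>v\<in>V2. a \<otimes> inv v \<in> A"
    using uniform_nhd_one[OF cA A(1) f2 A1(2)] by blast
  define H where "H = {g \<in> carrier G. (\<forall>a\<in>A. a \<otimes> g \<in> A) \<and> (\<forall>a\<in>A. a \<otimes> inv g \<in> A)}"
  have "subgroup H G"
  proof (rule subgroupI)
    show "H \<noteq> {}" using Ac by (auto simp: H_def intro!: exI[of _ \<one>])
    show "H \<subseteq> carrier G" by (auto simp: H_def)
    show "inv a \<in> H" if "a \<in> H" for a using that by (auto simp: H_def)
    fix a b assume ab: "a \<in> H" "b \<in> H"
    have "x \<otimes> (a \<otimes> b) \<in> A" if "x \<in> A" for x
      using ab that Ac by (auto simp: H_def subset_iff m_assoc[symmetric])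
    moreover have "x \<otimes> inv (a \<otimes> b) \<in> A" if "x \<in> A" for x
      using ab that Ac by (auto simp: H_def subset_iff inv_mult_group m_assoc[symmetric])
    ultimately show "a \<otimes> b \<in> H" using ab by (auto simp: H_def)
  qed
  moreover have "V1 \<inter> V2 \<subseteq> H"
    using V1 V2 openin_subset[OF V1(1)] by (auto simp: H_def topspace_eq)
  ultimately have "open_subgroup H"
    using V1 V2 by (intro subgroup_openI[of H "V1 \<inter> V2"]) auto
  moreover have "H \<subseteq> A"
  proof
    fix h assume "h \<in> H"
    then have "\<one> \<otimes> h \<in> A" "h \<in> carrier G" using A by (auto simp: H_def)
    then show "h \<in> A" by simp
  qed
  ultimately show ?thesis using A by blast
qed

text \<open>The intersection of all conjugates of \<open>H\<close> is open because \<open>G\<close> is compact.\<close>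

lemma open_normal_core:
  assumes H: "open_subgroup H"
  shows "\<exists>N. open_normal N \<and> N \<subseteq> H"
proof -
  note Hs = open_subgroupD[OF H]
  have f: "continuous_map (prod_topology T T) T (\<lambda>z. fst z \<otimes> snd z \<otimes> inv (fst z))"
    by (intro continuous_group_intros continuous_map_fst continuous_map_snd)
  have "compactin T (carrier G)" using compact by (simp add: compact_space_def topspace_eq)
  from uniform_nhd_one[OF this Hs(2) f] Hs
  obtain V where V: "openin T V" "\<one> \<in> V" "\<forall>a\<in>carrier G. \<forall>v\<in>V. a \<otimes> v \<otimes> inv a \<in> H"
    by auto
  define N where "N = {g \<in> carrier G. \<forall>a\<in>carrier G. a \<otimes> g \<otimes> inv a \<in> H}"
  have sub: "subgroup N G"
  proof (rule subgroupI)
    show "N \<noteq> {}" using Hs by (auto simp: N_def intro!: exI[of _ \<one>])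
    show "N \<subseteq> carrier G" by (auto simp: N_def)
    show "inv g \<in> N" if "g \<in> N" for g
    proof -
      have "a \<otimes> inv g \<otimes> inv a \<in> H" if a: "a \<in> carrier G" for a
      proof -
        have "inv (a \<otimes> g \<otimes> inv a) \<in> H" using \<open>g \<in> N\<close> a Hs by (auto simp: N_def)
        then show ?thesis using \<open>g \<in> N\<close> a by (simp add: N_def word_simps)
      qed
      then show ?thesis using that by (auto simp: N_def)
    qed
    fix g h assume gh: "g \<in> N" "h \<in> N"
    have "a \<otimes> (g \<otimes> h) \<otimes> inv a \<in> H" if a: "a \<in> carrier G" for a
    proof -
      have "(a \<otimes> g \<otimes> inv a) \<otimes> (a \<otimes> h \<otimes> inv a) \<in> H" using gh a Hs by (auto simp: N_def)
      then show ?thesis using gh a by (simp add: N_def word_simps)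
    qed
    then show "g \<otimes> h \<in> N" using gh by (auto simp: N_def)
  qed
  have "V \<subseteq> N" using V openin_subset[OF V(1)] by (auto simp: N_def topspace_eq)
  then have "openin T N" using subgroup_openI[OF sub V(1,2)] open_subgroupD by blast
  moreover have "N \<lhd> G"
  proof (subst normal_inv_iff, intro conjI ballI sub)
    fix x h assume x: "x \<in> carrier G" and h: "h \<in> N"
    have "a \<otimes> (x \<otimes> h \<otimes> inv x) \<otimes> inv a \<in> H" if a: "a \<in> carrier G" for a
    proof -
      have "(a \<otimes> x) \<otimes> h \<otimes> inv (a \<otimes> x) \<in> H" using h x a by (auto simp: N_def)
      then show ?thesis using h x a by (simp add: N_def word_simps)
    qed
    then show "x \<otimes> h \<otimes> inv x \<in> N" using h x by (auto simp: N_def)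
  qed
  moreover have "N \<subseteq> H"
  proof
    fix g assume "g \<in> N"
    then have "\<one> \<otimes> g \<otimes> inv \<one> \<in> H" "g \<in> carrier G" unfolding N_def by blast+
    then show "g \<in> H" by simp
  qed
  ultimately show ?thesis by (auto simp: open_normal_def)
qed

lemma open_normal_basis:
  assumes "openin T W" "\<one> \<in> W"
  shows "\<exists>N. open_normal N \<and> N \<subseteq> W"
  using open_subgroup_basis[OF assms] open_normal_core by blast

lemma open_normal_avoids:
  assumes "x \<in> carrier G" "x \<noteq> \<one>"
  shows "\<exists>N. open_normal N \<and> x \<notin> N"
proof -
  have "\<exists>U V. openin T U \<and> openin T V \<and> \<one> \<in> U \<and> x \<in> V \<and> disjnt U V"
    using Hausdorff assms unfolding Hausdorff_space_def by (auto simp: topspace_eq)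
  then obtain U V where "openin T U" "\<one> \<in> U" "x \<in> V" "disjnt U V" by blast
  then show ?thesis using open_normal_basis[of U] by (auto simp: disjnt_iff)
qed

end

section \<open>Indices of open subgroups\<close>

context group begin

text \<open>The index is counted for an arbitrary set \<open>K\<close> inside one ambient group, so that chains of subgroups
  can be compared without passing to the groups with smaller carriers.\<close>

definition index_in :: "'a set \<Rightarrow> 'a set \<Rightarrow> nat" where
  "index_in K H = card ((\<lambda>k. H #> k) ` K)"

lemma index_in_carrier: "index_in (carrier G) H = card (rcosets H)"
  unfolding index_in_def RCOSETS_def by (rule arg_cong[of _ _ card]) auto

text \<open>The map from cosets of \<open>H\<close> to cosets of \<open>K\<close> has all its fibres of size \<open>index_in K H\<close>, as right translation
  identifies them with the fibre over \<open>K\<close> itself.\<close>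

lemma index_in_trans:
  assumes HK: "H \<subseteq> K" "K \<subseteq> W" and H: "subgroup H G" and K: "subgroup K G" and W: "subgroup W G"
    and fin: "finite ((\<lambda>k. H #> k) ` W)"
  shows "index_in W H = index_in W K * index_in K H"
proof -
  let ?A = "(\<lambda>w. H #> w) ` W" and ?B = "(\<lambda>w. K #> w) ` W"
  have carr: "x \<in> carrier G" if "x \<in> W" for x using W that by (rule subgroup_in_carrier)
  define q where "q = (\<lambda>A. K <#> A)"
  have q: "q (H #> w) = K #> w" if "w \<in> W" for w
  proof -
    have "K <#> H = K" using H K HK by (simp add: set_mult_subgroup_idem subgroup_incl)
    then show ?thesis unfolding q_def
      using setmult_rcos_assoc[of K H w] carr[OF that] subgroup.subset[OF H] subgroup.subset[OF K]
      by simp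
  qed
  have B: "?B = q ` ?A" by (auto simp: q image_iff)
  have fib: "card {A \<in> ?A. q A = K #> w} = index_in K H" if w: "w \<in> W" for w
  proof -
    have "{A \<in> ?A. q A = K #> w} = (\<lambda>A. A #> w) ` ((\<lambda>k. H #> k) ` K)" (is "?L = ?R")
    proof
      show "?L \<subseteq> ?R"
      proof
        fix A assume "A \<in> ?L"
        then obtain v where v: "v \<in> W" "A = H #> v" "K #> v = K #> w" by (auto simp: q)
        then have "v \<otimes> inv w \<in> K" using r_coset_eq_iff[OF K, of w v] carr w by simp
        moreover have "A = (H #> (v \<otimes> inv w)) #> w"
          using v carr w subgroup.subset[OF H] by (simp add: coset_mult_assoc m_assoc)
        ultimately show "A \<in> ?R" by blast
      qed
      show "?R \<subseteq> ?L"
      proof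
        fix A assume "A \<in> ?R"
        then obtain k where k: "k \<in> K" "A = (H #> k) #> w" by blast
        have kW: "k \<in> W" using k HK by blast
        have A: "A = H #> (k \<otimes> w)"
          using k carr kW w subgroup.subset[OF H] by (simp add: coset_mult_assoc)
        have kw: "k \<otimes> w \<in> W" using kW w by (simp add: subgroup.m_closed[OF W])
        have "K #> (k \<otimes> w) = K #> w"
          using r_coset_eq_iff[OF K, of w "k \<otimes> w"] carr w kW k kw by (simp add: m_assoc)
        then show "A \<in> ?L" using A kw q[OF kw] by auto
      qed
    qed
    moreover have "inj_on (\<lambda>A. A #> w) ((\<lambda>k. H #> k) ` K)"
    proof (rule inj_onI)
      fix A B assume "A \<in> (\<lambda>k. H #> k) ` K" "B \<in> (\<lambda>k. H #> k) ` K" and eq: "A #> w = B #> w"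
      then obtain a b where ab: "a \<in> K" "b \<in> K" "A = H #> a" "B = H #> b" by blast
      have c: "A \<subseteq> carrier G" "B \<subseteq> carrier G"
        using ab HK carr subgroup.subset[OF H] r_coset_subset_G[of H a] r_coset_subset_G[of H b]
        by blast+
      have "(A #> w) #> inv w = (B #> w) #> inv w" using eq by simp
      then show "A = B" using c carr[OF w] by (simp add: coset_mult_assoc)
    qed
    ultimately show ?thesis by (simp add: card_image index_in_def)
  qed
  have "index_in W H = card ?A" by (simp add: index_in_def)
  also have "\<dots> = (\<Sum>b\<in>q ` ?A. card {A \<in> ?A. q A = b})"
    unfolding card_eq_sum by (rule sum.image_gen[OF fin])
  also have "\<dots> = (\<Sum>b\<in>?B. index_in K H)"
    unfolding B[symmetric] by (intro sum.cong) (auto simp: fib)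
  also have "\<dots> = index_in W K * index_in K H" by (simp add: index_in_def)
  finally show ?thesis .
qed

end

context pro_p_group begin

lemma finite_open_normal_cosets:
  assumes "open_normal N"
  shows "\<exists>e. index_in (carrier G) N = p ^ e" "finite ((\<lambda>k. N #> k) ` carrier G)"
proof -
  obtain e where e: "order (G Mod N) = p ^ e"
    using index_p_power assms by (auto simp: open_normal_def)
  have "order (G Mod N) = index_in (carrier G) N"
    by (simp add: order_def FactGroup_def index_in_carrier)
  then show "\<exists>e. index_in (carrier G) N = p ^ e" using e by metis
  have "card ((\<lambda>k. N #> k) ` carrier G) > 0"
    using e \<open>order (G Mod N) = index_in (carrier G) N\<close> prime_gt_0_nat[OF prime_p]
    by (simp add: index_in_def)
  then show "finite ((\<lambda>k. N #> k) ` carrier G)" by (rule card_ge_0_finite)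
qed

lemma finite_cosets:
  assumes "open_subgroup V" "W \<subseteq> carrier G"
  shows "finite ((\<lambda>k. V #> k) ` W)"
proof -
  obtain N where N: "open_normal N" "N \<subseteq> V" using open_normal_core assms by blast
  have Ns: "subgroup N G" using N open_normal_imp_open_subgroup open_subgroupD by blast
  note Vs = open_subgroupD[OF assms(1)]
  have "V #> k = V <#> (N #> k)" if "k \<in> carrier G" for k
  proof -
    have "V <#> N = V" using Ns Vs N by (simp add: set_mult_subgroup_idem subgroup_incl)
    then show ?thesis
      using setmult_rcos_assoc[of V N k] that Vs(3) subgroup.subset[OF Ns] by simp
  qed
  then have "(\<lambda>k. V #> k) ` W \<subseteq> (\<lambda>A. V <#> A) ` ((\<lambda>k. N #> k) ` carrier G)"
    using assms by auto
  then show ?thesis using finite_open_normal_cosets(2)[OF N(1)] by (meson finite_imageI finite_subset)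
qed

lemma index_in_open_trans:
  assumes "open_subgroup H" "open_subgroup K" "open_subgroup W" "H \<subseteq> K" "K \<subseteq> W"
  shows "index_in W H = index_in W K * index_in K H"
  using assms by (intro index_in_trans finite_cosets) (auto simp: open_subgroupD)

lemma index_in_power:
  assumes "open_subgroup H" "open_subgroup K" "H \<subseteq> K"
  shows "\<exists>e. index_in K H = p ^ e"
proof -
  obtain N where N: "open_normal N" "N \<subseteq> H" using open_normal_core assms by blast
  obtain e where e: "index_in (carrier G) N = p ^ e" using finite_open_normal_cosets[OF N(1)] by auto
  have "index_in (carrier G) N = index_in (carrier G) K * (index_in K H * index_in H N)"
    using index_in_open_trans[of N K "carrier G"] index_in_open_trans[of N H K] N assms
      open_normal_imp_open_subgroup[OF N(1)] open_subgroup_carrier open_subgroupD(3)[OF assms(2)]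
    by simp
  then have "index_in K H dvd p ^ e" unfolding e[symmetric] by simp
  then show ?thesis using divides_primepow_nat[OF prime_p] by blast
qed

lemma index_in_pos: "open_subgroup H \<Longrightarrow> open_subgroup K \<Longrightarrow> H \<subseteq> K \<Longrightarrow> index_in K H > 0"
  using index_in_power prime_gt_0_nat[OF prime_p] by fastforce

lemma index_in_eq_1D:
  assumes "open_subgroup H" "open_subgroup K" "H \<subseteq> K" "index_in K H = 1"
  shows "H = K"
proof -
  obtain c where c: "(\<lambda>k. H #> k) ` K = {c}"
    using assms(4) card_1_singletonE unfolding index_in_def by blast
  have "k \<in> H" if k: "k \<in> K" for k
  proof -
    have "H #> k = H #> \<one>" using c k open_subgroupD(4)[OF assms(2)] by blast
    then have "inv k \<in> H"
      using r_coset_eq_iff[of H k \<one>] open_subgroupD[OF assms(1)] open_subgroupD(5)[OF assms(2) k]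
      by auto
    then show "k \<in> H"
      using open_subgroupD(6)[OF assms(1), of "inv k"] open_subgroupD(5)[OF assms(2) k] by simp
  qed
  then show ?thesis using assms(3) by blast
qed

lemma index_in_ge_prime:
  assumes "open_subgroup H" "open_subgroup K" "H \<subseteq> K" "H \<noteq> K"
  shows "p dvd index_in K H" "p \<le> index_in K H"
proof -
  obtain e where e: "index_in K H = p ^ e" using index_in_power assms by blast
  have "e \<noteq> 0" using e index_in_eq_1D assms by (metis power_0)
  then show "p dvd index_in K H" using e by (simp add: dvd_power)
  then show "p \<le> index_in K H" using index_in_pos assms by (simp add: dvd_imp_le)
qed

section \<open>Continuous characters with values in the \<open>p\<close>-th roots of unity\<close>

text \<open>Roots of unity are used instead of the field with \<open>p\<close> elements, so that the group structure is pointwise multiplication.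
  A character is set to \<open>1\<close> outside its domain, which makes it determined by its values on the domain.\<close>

definition characters :: "'a set \<Rightarrow> ('a \<Rightarrow> complex) set" where
  "characters U = {\<phi>. (\<forall>x\<in>U. \<forall>y\<in>U. \<phi> (x \<otimes> y) = \<phi> x * \<phi> y) \<and> (\<forall>x\<in>U. \<phi> x ^ p = 1)
     \<and> openin T {x \<in> U. \<phi> x = 1} \<and> (\<forall>x. x \<notin> U \<longrightarrow> \<phi> x = 1)}"

lemma charactersD:
  assumes "\<phi> \<in> characters U"
  shows "x \<in> U \<Longrightarrow> y \<in> U \<Longrightarrow> \<phi> (x \<otimes> y) = \<phi> x * \<phi> y"
    and "\<phi> x ^ p = 1" and "x \<notin> U \<Longrightarrow> \<phi> x = 1" and "\<phi> x \<noteq> 0"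
    and "openin T {x \<in> U. \<phi> x = 1}"
proof -
  show *: "\<phi> x ^ p = 1" for x using assms unfolding characters_def by (cases "x \<in> U") auto
  show "\<phi> x \<noteq> 0" using *[of x] prime_gt_0_nat[OF prime_p] by (auto simp: power_0_left)
qed (use assms in \<open>auto simp: characters_def\<close>)

lemma character_one:
  assumes "\<phi> \<in> characters U" "open_subgroup U"
  shows "\<phi> \<one> = 1"
proof -
  have "\<phi> \<one> = \<phi> \<one> * \<phi> \<one>"
    using charactersD(1)[OF assms(1), of \<one> \<one>] open_subgroupD(4)[OF assms(2)] by simp
  then show ?thesis using charactersD(4)[OF assms(1)] by simp
qed

lemma character_inv:
  assumes "\<phi> \<in> characters U" "open_subgroup U" "x \<in> U"
  shows "\<phi> (inv x) = inverse (\<phi> x)"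
proof -
  have "\<phi> x * \<phi> (inv x) = 1"
    using charactersD(1)[OF assms(1), of x "inv x"] open_subgroupD[OF assms(2)] assms(3)
      character_one[OF assms(1,2)] by simp
  then show ?thesis by (simp add: inverse_unique)
qed

lemma character_conj_inside:
  assumes "\<phi> \<in> characters U" "open_subgroup U" "x \<in> U" "y \<in> U"
  shows "\<phi> (x \<otimes> y \<otimes> inv x) = \<phi> y"
  using assms charactersD(4)[OF assms(1), of x] open_subgroupD[OF assms(2)]
  by (simp add: charactersD(1)[OF assms(1)] character_inv)

text \<open>Continuity amounts to triviality on some open subgroup.\<close>

lemma charactersI:
  assumes U: "open_subgroup U" and V: "open_subgroup V" "V \<subseteq> U" "\<And>x. x \<in> V \<Longrightarrow> \<phi> x = 1"
    and hom: "\<And>x y. x \<in> U \<Longrightarrow> y \<in> U \<Longrightarrow> \<phi> (x \<otimes> y) = \<phi> x * \<phi> y"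
    and p: "\<And>x. x \<in> U \<Longrightarrow> \<phi> x ^ p = 1" and out: "\<And>x. x \<notin> U \<Longrightarrow> \<phi> x = 1"
  shows "\<phi> \<in> characters U"
proof -
  have "subgroup {x \<in> U. \<phi> x = 1} G"
  proof (rule subgroupI)
    show "{x \<in> U. \<phi> x = 1} \<noteq> {}" using V open_subgroupD(4)[OF V(1)] by blast
    fix a assume a: "a \<in> {x \<in> U. \<phi> x = 1}"
    have "\<phi> (a \<otimes> inv a) = \<phi> a * \<phi> (inv a)" using a open_subgroupD[OF U] by (intro hom) auto
    moreover have "\<phi> \<one> = 1" using V open_subgroupD(4)[OF V(1)] by blast
    ultimately show "inv a \<in> {x \<in> U. \<phi> x = 1}" using a open_subgroupD[OF U] by auto
  qed (use open_subgroupD[OF U] hom in auto)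
  then have "openin T {x \<in> U. \<phi> x = 1}"
    using open_subgroup_superset[OF V(1)] V by (auto intro: open_subgroupD(2))
  then show ?thesis using hom p out by (simp add: characters_def)
qed

lemma open_subgroup_kernel:
  assumes "\<phi> \<in> characters U" "open_subgroup U"
  shows "open_subgroup {x \<in> U. \<phi> x = 1}"
proof -
  have "subgroup {x \<in> U. \<phi> x = 1} G"
    using character_one[OF assms] open_subgroupD[OF assms(2)]
    by (intro subgroupI) (auto simp: charactersD(1)[OF assms(1)] character_inv[OF assms])
  then show ?thesis using charactersD(5)[OF assms(1)] by (simp add: open_subgroup_def)
qed

lemma character_trivial: "open_subgroup U \<Longrightarrow> (\<lambda>_. 1) \<in> characters U"
  by (rule charactersI[of U U]) auto

lemma character_mult:
  assumes "\<phi> \<in> characters U" "\<psi> \<in> characters U" "open_subgroup U"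
  shows "(\<lambda>x. \<phi> x * \<psi> x) \<in> characters U"
proof (rule charactersI[OF assms(3)])
  show "open_subgroup ({x \<in> U. \<phi> x = 1} \<inter> {x \<in> U. \<psi> x = 1})"
    using assms by (intro open_subgroup_Int open_subgroup_kernel)
qed (auto simp: charactersD[OF assms(1)] charactersD[OF assms(2)] power_mult_distrib)

lemma character_inverse:
  assumes "\<phi> \<in> characters U" "open_subgroup U"
  shows "(\<lambda>x. inverse (\<phi> x)) \<in> characters U"
  by (rule charactersI[OF assms(2) open_subgroup_kernel[OF assms]])
    (auto simp: charactersD[OF assms(1)] power_inverse)

lemma character_divide:
  assumes "\<phi> \<in> characters U" "\<psi> \<in> characters U" "open_subgroup U"
  shows "(\<lambda>x. \<phi> x / \<psi> x) \<in> characters U"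
  using character_mult[OF assms(1) character_inverse[OF assms(2,3)] assms(3)]
  by (simp add: divide_inverse)

lemma character_power:
  assumes "\<phi> \<in> characters U" "open_subgroup U"
  shows "(\<lambda>x. \<phi> x ^ n) \<in> characters U"
  by (induction n) (auto intro: character_trivial character_mult assms)

definition conj_char :: "'a set \<Rightarrow> 'a \<Rightarrow> ('a \<Rightarrow> complex) \<Rightarrow> 'a \<Rightarrow> complex" where
  "conj_char U g \<phi> = (\<lambda>x. if x \<in> U then \<phi> (g \<otimes> x \<otimes> inv g) else 1)"

lemma conj_char_in_characters:
  assumes \<phi>: "\<phi> \<in> characters U" and U: "open_subgroup U" and g: "g \<in> carrier G"
    and norm: "\<And>x. x \<in> U \<Longrightarrow> g \<otimes> x \<otimes> inv g \<in> U"
  shows "conj_char U g \<phi> \<in> characters U"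
proof -
  obtain N where N: "open_normal N" "N \<subseteq> {x \<in> U. \<phi> x = 1}"
    using open_normal_core[OF open_subgroup_kernel[OF \<phi> U]] by blast
  show ?thesis
  proof (rule charactersI[OF U open_normal_imp_open_subgroup[OF N(1)]])
    show "conj_char U g \<phi> x = 1" if "x \<in> N" for x
      using open_normal_conj[OF N(1) g that] N(2) by (auto simp: conj_char_def)
    fix x y assume xy: "x \<in> U" "y \<in> U"
    have "g \<otimes> (x \<otimes> y) \<otimes> inv g = (g \<otimes> x \<otimes> inv g) \<otimes> (g \<otimes> y \<otimes> inv g)"
      using xy g open_subgroupD(5)[OF U] by (simp add: word_simps)
    then show "conj_char U g \<phi> (x \<otimes> y) = conj_char U g \<phi> x * conj_char U g \<phi> y"
      using xy open_subgroupD(7)[OF U] charactersD(1)[OF \<phi> norm norm]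
      by (simp add: conj_char_def)
  qed (use N in \<open>auto simp: conj_char_def charactersD(2)[OF \<phi>]\<close>)
qed

lemma inj_on_conj_char:
  assumes H: "open_normal H" and g: "g \<in> carrier G"
  shows "inj_on (conj_char H g) (characters H)"
proof (rule inj_onI, rule ext)
  note Hs = open_subgroupD[OF open_normal_imp_open_subgroup[OF H]]
  fix \<phi> \<psi> x assume \<phi>: "\<phi> \<in> characters H" "\<psi> \<in> characters H" and eq: "conj_char H g \<phi> = conj_char H g \<psi>"
  show "\<phi> x = \<psi> x"
  proof (cases "x \<in> H")
    case True
    have "g \<otimes> (inv g \<otimes> x \<otimes> g) \<otimes> inv g = x" using g Hs(5)[OF True] by (simp add: m_assoc)
    then show ?thesis using fun_cong[OF eq, of "inv g \<otimes> x \<otimes> g"] open_normal_conj'[OF H g True]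
      by (simp add: conj_char_def)
  next
    case False
    then show ?thesis using charactersD(3)[OF \<phi>(1)] charactersD(3)[OF \<phi>(2)] by simp
  qed
qed

end

lemma root_of_unity_prime_power:
  fixes z w :: complex
  assumes p: "prime p" and z: "z ^ p = 1" "z \<noteq> 1"
  shows "inj_on (\<lambda>i. z ^ i) {..<p}" and "w ^ p = 1 \<Longrightarrow> \<exists>i<p. w = z ^ i"
proof -
  have z0: "z \<noteq> 0" using z prime_gt_0_nat[OF p] by (auto simp: power_0_left)
  have *: False if "i < j" "j < p" "z ^ i = z ^ j" for i j
  proof -
    have "z ^ j = z ^ i * z ^ (j - i)" using that by (subst power_add[symmetric]) simp
    then have 1: "z ^ (j - i) = 1" using that z0 by simp
    have "\<not> p dvd j - i" using that by (intro nat_dvd_not_less) auto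
    then have "coprime (j - i) p" using prime_imp_coprime[OF p] coprime_commute by blast
    then have g: "gcd (j - i) p = 1" by simp
    have "j - i \<noteq> 0" using that by simp
    from bezout_nat[OF this, of p] g obtain x y where xy: "(j - i) * x = p * y + 1" by metis
    have "(z ^ (j - i)) ^ x = (z ^ p) ^ y * z"
      unfolding power_mult[symmetric] xy by (simp add: power_add)
    then show False using 1 z by simp
  qed
  show inj: "inj_on (\<lambda>i. z ^ i) {..<p}"
  proof (rule inj_onI)
    fix i j assume "i \<in> {..<p}" "j \<in> {..<p}" "z ^ i = z ^ j"
    then show "i = j" using *[of i j] *[of j i] by (cases i j rule: linorder_cases) auto
  qed
  assume w: "w ^ p = 1"
  have "(\<lambda>i. z ^ i) ` {..<p} \<subseteq> {z. z ^ p = 1}"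
    using z by (auto simp: power_mult[symmetric] mult.commute[of _ p]) (simp add: power_mult)
  moreover have "card ((\<lambda>i. z ^ i) ` {..<p}) = card {z::complex. z ^ p = 1}"
    using inj p by (simp add: card_image card_roots_unity_eq prime_gt_0_nat)
  ultimately have "(\<lambda>i. z ^ i) ` {..<p} = {z. z ^ p = 1}"
    using p by (intro card_subset_eq) (auto intro!: finite_roots_unity prime_ge_1_nat)
  then show "\<exists>i<p. w = z ^ i" using w by auto
qed

lemma card_le_card_image_times:
  assumes "finite A" "\<And>a. a \<in> A \<Longrightarrow> card {x \<in> A. f x = f a} \<le> n"
  shows "card A \<le> n * card (f ` A)"
proof -
  have "card A = (\<Sum>b\<in>f ` A. card {x \<in> A. f x = b})"
    unfolding card_eq_sum by (rule sum.image_gen[OF assms(1)])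
  also have "\<dots> \<le> (\<Sum>b\<in>f ` A. n)" using assms(2) by (intro sum_mono) auto
  finally show ?thesis by (simp add: mult.commute)
qed

context pro_p_group begin

text \<open>This is the form in which sets of characters are counted throughout: the fibres of \<open>f\<close> are translates of
  subsets of \<open>D\<close>.\<close>

lemma card_characters_le_quotient:
  assumes fin: "finite A" "finite D" and A: "A \<subseteq> characters U"
    and D: "\<And>\<phi> \<psi>. \<phi> \<in> A \<Longrightarrow> \<psi> \<in> A \<Longrightarrow> f \<phi> = f \<psi> \<Longrightarrow> (\<lambda>x. \<phi> x / \<psi> x) \<in> D"
  shows "card A \<le> card D * card (f ` A)"
proof (rule card_le_card_image_times[OF fin(1)])
  fix \<psi> assume \<psi>: "\<psi> \<in> A"
  have nz: "\<psi> x \<noteq> 0" for x using \<psi> A charactersD(4) by blast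
  have "inj_on (\<lambda>\<phi> x. \<phi> x / \<psi> x) {\<phi> \<in> A. f \<phi> = f \<psi>}"
  proof (rule inj_onI, rule ext)
    fix \<phi> \<phi>' x assume "(\<lambda>x. \<phi> x / \<psi> x) = (\<lambda>x. \<phi>' x / \<psi> x)"
    then have "\<phi> x / \<psi> x = \<phi>' x / \<psi> x" by meson
    then show "\<phi> x = \<phi>' x" using nz[of x] by simp
  qed
  moreover have "(\<lambda>\<phi> x. \<phi> x / \<psi> x) ` {\<phi> \<in> A. f \<phi> = f \<psi>} \<subseteq> D" using D \<psi> by auto
  ultimately show "card {\<phi> \<in> A. f \<phi> = f \<psi>} \<le> card D" using fin by (intro card_inj_on_le)
qed

section \<open>Proper open subgroups lie in kernels of characters\<close>

lemma exists_coset_representatives: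
  assumes "open_subgroup U" "open_subgroup K" "U \<subseteq> K"
  shows "\<exists>r. (\<forall>k\<in>K. r k \<in> K \<and> k \<otimes> inv (r k) \<in> U) \<and> (\<forall>k\<in>K. \<forall>u\<in>U. r (u \<otimes> k) = r k)
    \<and> finite (r ` K) \<and> card (r ` K) \<le> index_in K U"
proof -
  note Us = open_subgroupD[OF assms(1)] and Ks = open_subgroupD[OF assms(2)]
  define r where "r = (\<lambda>k. SOME x. x \<in> U #> k)"
  have r: "k \<otimes> inv (r k) \<in> U \<and> r k \<in> K" if k: "k \<in> K" for k
  proof -
    have "r k \<in> U #> k"
      unfolding r_def using rcos_self[OF Ks(5)[OF k] Us(1)] by (rule someI)
    then obtain u where u: "u \<in> U" "r k = u \<otimes> k" by (auto simp: r_coset_def)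
    have "u \<in> K" using u assms by blast
    then have "r k \<in> K" using u k Ks(7) by simp
    moreover have "k \<otimes> inv (r k) = inv u" using u k Ks(5)[OF k] Us(5)[OF u(1)]
      by (simp add: word_simps)
    ultimately show ?thesis using Us(6)[OF u(1)] by simp
  qed
  have "r (u \<otimes> k) = r k" if "u \<in> U" "k \<in> K" for u k
  proof -
    have "U #> (u \<otimes> k) = U #> k"
      using that Us Ks(5) coset_join2[OF _ Us(1)] by (simp flip: coset_mult_assoc)
    then show ?thesis by (simp add: r_def)
  qed
  moreover have rim: "r ` K = (\<lambda>c. SOME x. x \<in> c) ` ((\<lambda>k. U #> k) ` K)"
    by (auto simp: r_def image_iff)
  moreover have fin: "finite ((\<lambda>k. U #> k) ` K)" using finite_cosets[OF assms(1) Ks(3)] .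
  moreover have "card (r ` K) \<le> index_in K U"
    unfolding rim index_in_def by (rule card_image_le[OF fin])
  ultimately show ?thesis using r by (intro exI[of _ r]) auto
qed

text \<open>The functions \<open>\<phi>\<close> on the left cosets of \<open>U\<close> in \<open>K\<close> with values in the \<open>p\<close>-th roots of unity and \<open>\<phi> \<one> = 1\<close>
  carry a right action of \<open>K\<close>, sending \<open>\<phi>\<close> to \<open>x \<mapsto> \<phi> (k x) / \<phi> k\<close>.  Its fixed points are exactly the
  characters of \<open>K\<close> that are trivial on \<open>U\<close>.  The number of all such functions is divisible by \<open>p\<close> and the
  orbits have \<open>p\<close>-power size, so the number of fixed points is divisible by \<open>p\<close>, and the trivial character cannot be
  the only one.\<close>

lemma exists_nontrivial_character:
  assumes U: "open_subgroup U" and K: "open_subgroup K" and UK: "U \<subseteq> K" "U \<noteq> K"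
  shows "\<exists>\<phi>\<in>characters K. (\<forall>u\<in>U. \<phi> u = 1) \<and> (\<exists>k\<in>K. \<phi> k \<noteq> 1)"
proof -
  note Us = open_subgroupD[OF U] and Ks = open_subgroupD[OF K]
  define M where "M = {z::complex. z ^ p = 1}"
  have p0: "p > 0" using prime_p prime_gt_0_nat by blast
  have M: "finite M" "card M = p" "\<And>z. z \<in> M \<Longrightarrow> z \<noteq> 0" "1 \<in> M"
    "\<And>z w. z \<in> M \<Longrightarrow> w \<in> M \<Longrightarrow> z * w \<in> M" "\<And>z w. z \<in> M \<Longrightarrow> w \<in> M \<Longrightarrow> z / w \<in> M"
    using p0 unfolding M_def
    by (auto simp: finite_roots_unity card_roots_unity_eq power_0_left power_mult_distrib power_divide)
  define X where "X = {\<phi>. (\<forall>k\<in>K. \<phi> k \<in> M) \<and> (\<forall>k\<in>K. \<forall>u\<in>U. \<phi> (k \<otimes> u) = \<phi> k) \<and> \<phi> \<one> = 1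
      \<and> (\<forall>x. x \<notin> K \<longrightarrow> \<phi> x = 1)}"
  obtain r where r: "\<And>k. k \<in> K \<Longrightarrow> r k \<in> K \<and> k \<otimes> inv (r k) \<in> U" "finite (r ` K)"
    using exists_coset_representatives[OF U K UK(1)] by blast
  have finX: "finite X"
  proof (rule inj_on_finite)
    show "inj_on (\<lambda>\<phi>. restrict (\<lambda>s. \<phi> (inv s)) (r ` K)) X"
    proof (rule inj_onI, rule ext)
      fix \<phi> \<psi> x assume \<phi>: "\<phi> \<in> X" and \<psi>: "\<psi> \<in> X"
        and eq: "restrict (\<lambda>s. \<phi> (inv s)) (r ` K) = restrict (\<lambda>s. \<psi> (inv s)) (r ` K)"
      show "\<phi> x = \<psi> x"
      proof (cases "x \<in> K")
        case True
        let ?s = "r (inv x)"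
        have ix: "inv x \<in> K" using True Ks by simp
        note s = r(1)[OF ix]
        have x: "x = inv ?s \<otimes> inv (inv x \<otimes> inv ?s)"
          using s ix Ks(5)[OF True] Ks(5)[of ?s] by (simp add: word_simps)
        have "inv (inv x \<otimes> inv ?s) \<in> U" "inv ?s \<in> K" using s Us(6) Ks(6) by auto
        then have "\<phi> (inv ?s \<otimes> inv (inv x \<otimes> inv ?s)) = \<phi> (inv ?s)"
            "\<psi> (inv ?s \<otimes> inv (inv x \<otimes> inv ?s)) = \<psi> (inv ?s)"
          using \<phi> \<psi> unfolding X_def by blast+
        then have "\<phi> x = \<phi> (inv ?s)" "\<psi> x = \<psi> (inv ?s)" unfolding x[symmetric] .
        moreover have "\<phi> (inv ?s) = \<psi> (inv ?s)" using fun_cong[OF eq, of ?s] ix by simp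
        ultimately show ?thesis by simp
      qed (use \<phi> \<psi> in \<open>auto simp: X_def\<close>)
    qed
    show "(\<lambda>\<phi>. restrict (\<lambda>s. \<phi> (inv s)) (r ` K)) ` X \<subseteq> PiE (r ` K) (\<lambda>_. M)"
      using r(1) Ks(6) by (auto simp: X_def)
    show "finite (PiE (r ` K) (\<lambda>_. M))" using r(2) M by (intro finite_PiE) auto
  qed
  have pX: "p dvd card X"
  proof -
    \<comment> \<open>Splitting by the value on one nontrivial coset \<open>c\<close> shows that the size is \<open>p\<close> times that of the
    subset with value \<open>1\<close> on \<open>c\<close>.\<close>
    obtain k0 where k0: "k0 \<in> K" "k0 \<notin> U" using UK by blast
    define c where "c = (\<lambda>k. inv k0 \<otimes> k \<in> U \<and> k \<in> K)"
    have c: "c k0" "\<not> c \<one>" "\<And>k u. k \<in> K \<Longrightarrow> u \<in> U \<Longrightarrow> c (k \<otimes> u) = c k"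
    proof -
      show "c k0" using k0 Ks Us by (simp add: c_def)
      show "\<not> c \<one>" using k0 Ks Us(6)[of "inv k0"] by (auto simp: c_def)
      fix k u assume ku: "k \<in> K" "u \<in> U"
      have uK: "u \<in> K" using ku UK by blast
      have e: "inv k0 \<otimes> (k \<otimes> u) = (inv k0 \<otimes> k) \<otimes> u" using ku k0 Ks(5) Us(5) by (simp add: m_assoc)
      have "inv k0 \<otimes> k \<in> U" if "(inv k0 \<otimes> k) \<otimes> u \<in> U"
      proof -
        have "(inv k0 \<otimes> k) \<otimes> u \<otimes> inv u \<in> U" using that Us ku by blast
        then show ?thesis using ku k0 Ks(5) Us(5) by (simp add: m_assoc)
      qed
      then show "c (k \<otimes> u) = c k" using e ku Us(7) Ks(7) uK unfolding c_def by metis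
    qed
    define X1 where "X1 = {\<phi> \<in> X. \<phi> k0 = 1}"
    let ?h = "\<lambda>(z, \<phi>) k. if c k then z * \<phi> k else \<phi> k"
    have "bij_betw ?h (M \<times> X1) X"
    proof (rule bij_betwI[where g = "\<lambda>\<phi>. (\<phi> k0, \<lambda>k. if c k then \<phi> k / \<phi> k0 else \<phi> k)"])
      show "?h \<in> M \<times> X1 \<rightarrow> X"
      proof
        fix z assume z: "z \<in> M \<times> X1"
        then obtain a \<phi> where a: "z = (a, \<phi>)" "a \<in> M" "\<phi> \<in> X" by (auto simp: X1_def)
        show "?h z \<in> X" using a c M(5) unfolding X_def by (auto simp: c_def)
      qed
      show "(\<lambda>\<phi>. (\<phi> k0, \<lambda>k. if c k then \<phi> k / \<phi> k0 else \<phi> k)) \<in> X \<rightarrow> M \<times> X1"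
      proof
        fix \<phi> assume a: "\<phi> \<in> X"
        have "(\<lambda>k. if c k then \<phi> k / \<phi> k0 else \<phi> k) \<in> X"
          using a c M(6) k0 unfolding X_def by (auto simp: c_def)
        moreover have "\<phi> k0 \<in> M" using a k0 by (auto simp: X_def)
        moreover have "\<phi> k0 / \<phi> k0 = 1" using M(3) calculation by simp
        ultimately show "(\<phi> k0, \<lambda>k. if c k then \<phi> k / \<phi> k0 else \<phi> k) \<in> M \<times> X1"
          using c by (auto simp: X1_def)
      qed
      show "(?h z k0, \<lambda>k. if c k then ?h z k / ?h z k0 else ?h z k) = z" if "z \<in> M \<times> X1" for z
        using that c(1) M(3) by (auto simp: X1_def fun_eq_iff)
      show "?h (\<phi> k0, \<lambda>k. if c k then \<phi> k / \<phi> k0 else \<phi> k) = \<phi>" if "\<phi> \<in> X" for \<phi>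
        using that k0 M(3) by (auto simp: X_def fun_eq_iff)
    qed
    then have "card X = card (M \<times> X1)" by (simp add: bij_betw_same_card)
    then show ?thesis by (simp add: card_cartesian_product M)
  qed
  define act where "act = (\<lambda>\<phi> k x. if x \<in> K then \<phi> (k \<otimes> x) / \<phi> k else (1::complex))"
  have actX: "act \<phi> k \<in> X" if "\<phi> \<in> X" "k \<in> K" for \<phi> k
  proof -
    have "\<phi> k \<noteq> 0" using that M(3) by (auto simp: X_def)
    moreover have "\<phi> (k \<otimes> (x \<otimes> u)) = \<phi> (k \<otimes> x)" if "x \<in> K" "u \<in> U" for x u
    proof -
      have "k \<otimes> (x \<otimes> u) = (k \<otimes> x) \<otimes> u" using that \<open>k \<in> K\<close> Ks(5) Us(5) by (simp add: m_assoc)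
      then show ?thesis using \<open>\<phi> \<in> X\<close> that Ks(7) \<open>k \<in> K\<close> by (simp add: X_def)
    qed
    moreover have "u \<in> U \<Longrightarrow> u \<in> K" for u using UK by blast
    ultimately show ?thesis
      using that Ks M(6) unfolding act_def X_def by auto
  qed
  have act_act: "act (act \<phi> k) l = act \<phi> (k \<otimes> l)" if "\<phi> \<in> X" "k \<in> K" "l \<in> K" for \<phi> k l
  proof -
    have "\<phi> k \<noteq> 0" using that M(3) by (auto simp: X_def)
    then show ?thesis using that Ks(5,7) by (auto simp: act_def m_assoc fun_eq_iff)
  qed
  have act_one: "act \<phi> \<one> = \<phi>" if "\<phi> \<in> X" for \<phi>
    using that Ks(5) by (auto simp: act_def X_def fun_eq_iff)
  define orb where "orb = (\<lambda>\<phi>. act \<phi> ` K)"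
  define F where "F = {\<phi> \<in> X. \<forall>k\<in>K. act \<phi> k = \<phi>}"
  have orb_card: "p dvd card (orb \<phi>)" if \<phi>: "\<phi> \<in> X" "\<phi> \<notin> F" for \<phi>
  proof -
    define S where "S = {k \<in> K. act \<phi> k = \<phi>}"
    have "subgroup S G"
    proof (rule subgroupI)
      show "S \<noteq> {}" using Ks act_one \<phi> by (auto simp: S_def)
      show "S \<subseteq> carrier G" using Ks by (auto simp: S_def)
      fix a assume a: "a \<in> S"
      then have "act \<phi> (inv a) = act (act \<phi> a) (inv a)" by (simp add: S_def)
      also have "\<dots> = \<phi>" using a act_act[of \<phi> a "inv a"] Ks act_one \<phi> by (auto simp: S_def)
      finally show "inv a \<in> S" using a Ks by (auto simp: S_def)
      fix b assume b: "b \<in> S"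
      show "a \<otimes> b \<in> S" using a b act_act[of \<phi> a b] \<phi> Ks by (auto simp: S_def)
    qed
    moreover obtain N where N: "open_normal N" "N \<subseteq> U" using open_normal_core[OF U] by blast
    have "N \<subseteq> S"
    proof
      fix n assume n: "n \<in> N"
      have "\<phi> (n \<otimes> x) = \<phi> x" if x: "x \<in> K" for x
      proof -
        have "n \<otimes> x = x \<otimes> (inv x \<otimes> n \<otimes> x)"
          using x n Ks(5) N Us(5) by (simp add: m_assoc subset_iff)
        moreover have "inv x \<otimes> n \<otimes> x \<in> U" using open_normal_conj'[OF N(1)] x Ks(5) n N by blast
        ultimately show ?thesis using x \<phi> by (simp add: X_def)
      qed
      moreover have "\<phi> n = 1" using calculation[of \<one>] Ks \<phi> n N Us(5) by (auto simp: X_def)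
      ultimately have "act \<phi> n = \<phi>" using \<phi> by (auto simp: act_def X_def fun_eq_iff)
      then show "n \<in> S" using n N UK by (auto simp: S_def)
    qed
    ultimately have S: "open_subgroup S"
      using open_subgroup_superset[OF open_normal_imp_open_subgroup[OF N(1)]] by blast
    have SK: "S \<subseteq> K" "S \<noteq> K" using \<phi> by (auto simp: S_def F_def)
    have eq: "act \<phi> k = act \<phi> l \<longleftrightarrow> S #> k = S #> l" if "k \<in> K" "l \<in> K" for k l
    proof -
      have "act \<phi> k = act \<phi> l \<longleftrightarrow> act \<phi> (l \<otimes> inv k) = \<phi>"
      proof
        assume "act \<phi> k = act \<phi> l"
        then have "act (act \<phi> l) (inv k) = act (act \<phi> k) (inv k)" by simp
        then show "act \<phi> (l \<otimes> inv k) = \<phi>" using that \<phi> act_act Ks act_one by simp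
      next
        assume "act \<phi> (l \<otimes> inv k) = \<phi>"
        then have "act \<phi> k = act (act \<phi> (l \<otimes> inv k)) k" by simp
        also have "\<dots> = act \<phi> l" using that \<phi> act_act[of \<phi> "l \<otimes> inv k" k] Ks by (simp add: m_assoc)
        finally show "act \<phi> k = act \<phi> l" .
      qed
      also have "\<dots> \<longleftrightarrow> l \<otimes> inv k \<in> S" using that Ks by (auto simp: S_def)
      finally show ?thesis using r_coset_eq_iff[of S k l] that Ks(5) open_subgroupD(1)[OF S] by simp
    qed
    have "card (orb \<phi>) = index_in K S"
    proof -
      have "bij_betw (\<lambda>c. act \<phi> (SOME k. k \<in> K \<and> S #> k = c)) ((\<lambda>k. S #> k) ` K) (orb \<phi>)"
      proof (rule bij_betw_imageI)
        have sm: "(SOME k. k \<in> K \<and> S #> k = S #> l) \<in> K \<and> S #> (SOME k. k \<in> K \<and> S #> k = S #> l) = S #> l"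
          if "l \<in> K" for l using someI[of "\<lambda>k. k \<in> K \<and> S #> k = S #> l" l] that by blast
        have sm': "act \<phi> (SOME k. k \<in> K \<and> S #> k = S #> l) = act \<phi> l" if "l \<in> K" for l
          using sm[OF that] eq that by blast
        show "inj_on (\<lambda>c. act \<phi> (SOME k. k \<in> K \<and> S #> k = c)) ((\<lambda>k. S #> k) ` K)"
          by (rule inj_onI) (auto simp: sm' eq)
        show "(\<lambda>c. act \<phi> (SOME k. k \<in> K \<and> S #> k = c)) ` (\<lambda>k. S #> k) ` K = orb \<phi>"
          by (auto simp: sm' orb_def image_image)
      qed
      then show ?thesis by (simp add: index_in_def bij_betw_same_card)
    qed
    then show ?thesis using index_in_ge_prime[OF S K SK] by simp
  qed
  have orb_XF: "orb \<phi> \<subseteq> X - F" if \<phi>: "\<phi> \<in> X - F" for \<phi>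
  proof
    fix \<psi> assume "\<psi> \<in> orb \<phi>"
    then obtain k where k: "k \<in> K" "\<psi> = act \<phi> k" by (auto simp: orb_def)
    have "\<psi> \<notin> F"
    proof
      assume F: "\<psi> \<in> F"
      then have "act \<psi> (inv k) = \<psi>" using k Ks by (auto simp: F_def)
      then have "\<phi> = \<psi>" using k \<phi> act_act[of \<phi> k "inv k"] act_one Ks by auto
      then show False using \<phi> F by blast
    qed
    then show "\<psi> \<in> X - F" using k actX \<phi> by blast
  qed
  have self: "\<phi> \<in> orb \<phi>" if "\<phi> \<in> X" for \<phi>
    using act_one[OF that] Ks(4) unfolding orb_def by (metis image_eqI)
  have "p dvd card (\<Union> (orb ` (X - F)))"
  proof (rule dvd_partition)
    have "\<Union> (orb ` (X - F)) \<subseteq> X" using orb_XF by blast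
    then show "finite (\<Union> (orb ` (X - F)))" using finX finite_subset by blast
    show "\<forall>c\<in>orb ` (X - F). p dvd card c" using orb_card by blast
    show "\<forall>c1\<in>orb ` (X - F). \<forall>c2\<in>orb ` (X - F). c1 \<noteq> c2 \<longrightarrow> c1 \<inter> c2 = {}"
    proof (intro ballI impI, rule ccontr)
      fix c1 c2 assume "c1 \<in> orb ` (X - F)" "c2 \<in> orb ` (X - F)" "c1 \<noteq> c2" "c1 \<inter> c2 \<noteq> {}"
      then obtain \<phi> \<psi> k l where a: "\<phi> \<in> X" "\<psi> \<in> X" "c1 = orb \<phi>" "c2 = orb \<psi>"
        "k \<in> K" "l \<in> K" "act \<phi> k = act \<psi> l" by (auto simp: orb_def)
      have *: "orb \<phi> \<subseteq> orb \<psi>" if "\<phi> \<in> X" "\<psi> \<in> X" "k \<in> K" "l \<in> K" "act \<phi> k = act \<psi> l" for \<phi> \<psi> k l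
      proof
        fix \<theta> assume "\<theta> \<in> orb \<phi>"
        then obtain m where m: "m \<in> K" "\<theta> = act \<phi> m" by (auto simp: orb_def)
        have "act \<phi> m = act (act \<phi> k) (inv k \<otimes> m)"
          using act_act[of \<phi> k "inv k \<otimes> m"] that m Ks by simp
        also have "\<dots> = act \<psi> (l \<otimes> (inv k \<otimes> m))"
          using act_act[of \<psi> l "inv k \<otimes> m"] that m Ks by simp
        finally have "\<theta> = act \<psi> (l \<otimes> (inv k \<otimes> m))" using m by simp
        moreover have "l \<otimes> (inv k \<otimes> m) \<in> K" using that m Ks by simp
        ultimately show "\<theta> \<in> orb \<psi>" unfolding orb_def by simp
      qed
      have "orb \<phi> = orb \<psi>"
        using *[of \<phi> \<psi> k l] *[of \<psi> \<phi> l k] a by simp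
      then show False using a \<open>c1 \<noteq> c2\<close> by simp
    qed
  qed
  moreover have "\<Union> (orb ` (X - F)) = X - F" using orb_XF self by blast
  ultimately have "p dvd card (X - F)" by simp
  moreover have "F \<subseteq> X" by (auto simp: F_def)
  then have "card X = card (X - F) + card F"
    using finX by (simp add: card_Diff_subset finite_subset card_mono)
  ultimately have pF: "p dvd card F" using pX by (simp add: dvd_add_right_iff)
  have triv: "(\<lambda>_. 1) \<in> F" using M Ks by (auto simp: F_def X_def act_def fun_eq_iff)
  have "finite F" using finX \<open>F \<subseteq> X\<close> finite_subset by blast
  then have "card F \<ge> p" using pF triv by (metis card_gt_0_iff dvd_imp_le empty_iff)
  then have "card F > 1" using prime_gt_1_nat[OF prime_p] by simp
  then have "F \<noteq> {\<lambda>_. 1}" by auto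
  then obtain \<phi> where \<phi>: "\<phi> \<in> F" "\<phi> \<noteq> (\<lambda>_. 1)" using triv by blast
  have hom: "\<phi> (x \<otimes> y) = \<phi> x * \<phi> y" if "x \<in> K" "y \<in> K" for x y
  proof -
    have "act \<phi> x = \<phi>" using \<phi> that by (simp add: F_def)
    from fun_cong[OF this, of y] have "\<phi> y = \<phi> (x \<otimes> y) / \<phi> x" using that by (simp add: act_def)
    moreover have "\<phi> x \<noteq> 0" using \<phi> that M(3) by (auto simp: F_def X_def)
    ultimately show ?thesis by simp
  qed
  have tU: "\<phi> u = 1" if "u \<in> U" for u
  proof -
    have "\<phi> (\<one> \<otimes> u) = \<phi> \<one>" "\<phi> \<one> = 1" using \<phi> that Ks(4) by (auto simp: F_def X_def)
    then show ?thesis using Us(5)[OF that] by simp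
  qed
  have "\<phi> \<in> characters K"
    using \<phi> hom tU by (intro charactersI[OF K U UK(1)]) (auto simp: F_def X_def M_def)
  moreover have "\<exists>k\<in>K. \<phi> k \<noteq> 1" using \<phi> by (auto simp: F_def X_def fun_eq_iff)
  ultimately show ?thesis using tU by blast
qed

section \<open>Generation and the Burnside basis theorem\<close>

text \<open>Topological generation, tested on open subgroups: a closed subgroup of a profinite group is an intersection of open ones.\<close>

definition generates :: "'a set \<Rightarrow> 'a set \<Rightarrow> bool" where
  "generates X K \<longleftrightarrow> X \<subseteq> K \<and> (\<forall>V. open_subgroup V \<and> X \<subseteq> V \<longrightarrow> K \<subseteq> V)"

lemma card_characters_kernel:
  assumes K: "open_subgroup K" and fin: "finite (characters K)"
    and \<phi>: "\<phi> \<in> characters K" "\<forall>y\<in>X. \<phi> y = 1" and x: "x \<in> K" "\<phi> x \<noteq> 1"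
  shows "p * card {\<psi> \<in> characters K. \<forall>y\<in>insert x X. \<psi> y = 1} \<le> card {\<psi> \<in> characters K. \<forall>y\<in>X. \<psi> y = 1}"
    (is "p * card ?A \<le> card ?B")
proof -
  let ?f = "\<lambda>(i, \<psi>) y. \<phi> y ^ i * \<psi> y"
  note root = root_of_unity_prime_power[OF prime_p charactersD(2)[OF \<phi>(1)] x(2)]
  have "inj_on ?f ({..<p} \<times> ?A)"
  proof (rule inj_onI)
    fix a b assume ab: "a \<in> {..<p} \<times> ?A" "b \<in> {..<p} \<times> ?A" "?f a = ?f b"
    obtain i \<psi> j \<psi>' where ij: "a = (i, \<psi>)" "b = (j, \<psi>')" by fastforce
    have a: "i \<in> {..<p}" "j \<in> {..<p}" "\<psi> \<in> characters K" "\<forall>y\<in>insert x X. \<psi> y = 1"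
      "\<psi>' \<in> characters K" "\<forall>y\<in>insert x X. \<psi>' y = 1"
      and eq: "(\<lambda>y. \<phi> y ^ i * \<psi> y) = (\<lambda>y. \<phi> y ^ j * \<psi>' y)"
      using ab ij by auto
    have "\<phi> x ^ i = \<phi> x ^ j" using fun_cong[OF eq, of x] a by simp
    then have "i = j" using inj_onD[OF root(1)] a by blast
    moreover have "\<psi> y = \<psi>' y" for y
      using fun_cong[OF eq, of y] \<open>i = j\<close> charactersD(4)[OF \<phi>(1), of y] by simp
    ultimately show "a = b" unfolding ij by auto
  qed
  moreover have "?f ` ({..<p} \<times> ?A) \<subseteq> ?B"
    using \<phi> by (auto intro!: character_mult character_power K)
  moreover have "finite ?B" using fin by simp
  ultimately have "card ({..<p} \<times> ?A) \<le> card ?B" by (rule card_inj_on_le)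
  then show ?thesis by (simp add: card_cartesian_product)
qed

text \<open>Elements are chosen one at a time, each outside the kernel of some character that is trivial on the previous ones;
  every choice divides the number of remaining characters by at least \<open>p\<close>.  When only the trivial
  character is left, no proper open subgroup of \<open>K\<close> contains the chosen elements, by \<open>exists_nontrivial_character\<close>.\<close>

lemma burnside_basis:
  assumes K: "open_subgroup K" and fin: "finite (characters K)"
  shows "\<exists>X. finite X \<and> generates X K \<and> p ^ card X \<le> card (characters K)"
proof -
  let ?A = "\<lambda>X. {\<psi> \<in> characters K. \<forall>y\<in>X. \<psi> y = 1}"
  have p0: "p > 1" using prime_p prime_gt_1_nat by blast
  have "\<exists>Y. finite Y \<and> Y \<subseteq> K \<and> p ^ card Y \<le> card (characters K) \<and> ?A Y \<subseteq> {\<lambda>_. 1}"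
    if "finite X" "X \<subseteq> K" "p ^ card X * card (?A X) \<le> card (characters K)" for X
    using that
  proof (induction "card (?A X)" arbitrary: X rule: less_induct)
    case (less X)
    have one: "(\<lambda>_. 1) \<in> ?A X" using character_trivial[OF K] by simp
    have finA: "finite (?A Y)" for Y using fin by simp
    then have "card (?A X) > 0" using one by (subst card_gt_0_iff) blast
    then have A1: "card (?A X) \<ge> 1" by simp
    show ?case
    proof (cases "?A X \<subseteq> {\<lambda>_. 1}")
      case True
      then show ?thesis using less.prems A1
        by (intro exI[of _ X] conjI) (auto intro: order_trans[rotated])
    next
      case False
      then obtain \<phi> where \<phi>: "\<phi> \<in> characters K" "\<forall>y\<in>X. \<phi> y = 1" "\<phi> \<noteq> (\<lambda>_. 1)" by auto
      then obtain x where x: "\<phi> x \<noteq> 1" by auto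
      then have xK: "x \<in> K" using charactersD(3)[OF \<phi>(1)] by blast
      have le: "p * card (?A (insert x X)) \<le> card (?A X)"
        using card_characters_kernel[OF K fin \<phi>(1,2) xK x] .
      have "x \<notin> X" using \<phi> x by blast
      have "card (?A (insert x X)) \<ge> 1" using finA[of "insert x X"] character_trivial[OF K]
        by (auto simp: Suc_le_eq card_gt_0_iff)
      then have "card (?A (insert x X)) < p * card (?A (insert x X))" using p0 by simp
      then have lt: "card (?A (insert x X)) < card (?A X)" using le by linarith
      have "p ^ card (insert x X) * card (?A (insert x X)) = p ^ card X * (p * card (?A (insert x X)))"
        using \<open>x \<notin> X\<close> less.prems by simp
      also have "\<dots> \<le> p ^ card X * card (?A X)" using le by (intro mult_left_mono) auto
      also have "\<dots> \<le> card (characters K)" using less.prems by simp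
      finally show ?thesis using less.prems xK by (intro less.hyps[OF lt]) auto
    qed
  qed
  from this[of "{}"] obtain Y where Y: "finite Y" "Y \<subseteq> K" "p ^ card Y \<le> card (characters K)"
    "?A Y \<subseteq> {\<lambda>_. 1}" by auto
  have "K \<subseteq> V" if V: "open_subgroup V" "Y \<subseteq> V" for V
  proof (rule ccontr)
    assume "\<not> K \<subseteq> V"
    then have "V \<inter> K \<noteq> K" by blast
    then obtain \<phi> where \<phi>: "\<phi> \<in> characters K" "\<forall>u\<in>V \<inter> K. \<phi> u = 1" "\<exists>k\<in>K. \<phi> k \<noteq> 1"
      using exists_nontrivial_character[OF open_subgroup_Int[OF V(1) K] K] by auto
    then have "\<phi> \<in> ?A Y" using V Y by auto
    then show False using Y \<phi> by auto
  qed
  then show ?thesis using Y by (auto simp: generates_def)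
qed

text \<open>The elements \<open>r k \<otimes> x \<otimes> inv (r (r k \<otimes> x))\<close> are the Schreier generators of \<open>U\<close>.  Extend \<open>\<phi>\<close> to the
  function \<open>f\<close> on \<open>K\<close> with \<open>f (u \<otimes> r k) = \<phi> u\<close>.  Triviality on the Schreier generators makes
  \<open>f\<close> invariant under right multiplication by \<open>X\<close>, hence by an open subgroup containing \<open>X\<close>, hence by \<open>K\<close>; so \<open>f\<close>
  is constant.\<close>

lemma character_eq_1_if_schreier_trivial:
  assumes U: "open_subgroup U" and K: "open_subgroup K" and UK: "U \<subseteq> K" and X: "generates X K"
    and r: "\<And>k. k \<in> K \<Longrightarrow> r k \<in> K \<and> k \<otimes> inv (r k) \<in> U"
      "\<And>k u. k \<in> K \<Longrightarrow> u \<in> U \<Longrightarrow> r (u \<otimes> k) = r k"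
    and \<phi>: "\<phi> \<in> characters U"
    and triv: "\<And>k x. k \<in> K \<Longrightarrow> x \<in> X \<Longrightarrow> \<phi> (r k \<otimes> x \<otimes> inv (r (r k \<otimes> x))) = 1"
    and u: "u \<in> U"
  shows "\<phi> u = 1"
proof -
  note Us = open_subgroupD[OF U] and Ks = open_subgroupD[OF K]
  define f where "f = (\<lambda>k. \<phi> (k \<otimes> inv (r k)))"
  define V where "V = {v \<in> K. \<forall>k\<in>K. f (k \<otimes> v) = f k}"
  have rK: "r k \<in> K" "r k \<in> carrier G" "k \<otimes> inv (r k) \<in> U" if "k \<in> K" for k
    using r(1)[OF that] Ks(5) by auto
  have UKs: "v \<in> K" "v \<in> carrier G" if "v \<in> U" for v using that UK Us(5) by auto
  have "subgroup V G"
  proof (rule subgroupI)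
    show "V \<noteq> {}" using Ks by (auto simp: V_def intro!: exI[of _ \<one>])
    show "V \<subseteq> carrier G" using Ks(5) by (auto simp: V_def)
    fix a assume a: "a \<in> V"
    have aK: "a \<in> K" using a by (simp add: V_def)
    have "f (k \<otimes> inv a) = f k" if k: "k \<in> K" for k
    proof -
      have "f ((k \<otimes> inv a) \<otimes> a) = f (k \<otimes> inv a)" using a k Ks(6,7) aK by (simp add: V_def)
      moreover have "(k \<otimes> inv a) \<otimes> a = k" using k aK Ks(5) by (simp add: m_assoc)
      ultimately show ?thesis by simp
    qed
    then show "inv a \<in> V" using aK Ks(6) by (simp add: V_def)
    fix b assume b: "b \<in> V"
    have bK: "b \<in> K" using b by (simp add: V_def)
    have "f (k \<otimes> (a \<otimes> b)) = f k" if k: "k \<in> K" for k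
    proof -
      have "f ((k \<otimes> a) \<otimes> b) = f k" using a b k Ks(7) by (simp add: V_def)
      then show ?thesis using k aK bK Ks(5) by (simp add: m_assoc)
    qed
    then show "a \<otimes> b \<in> V" using aK bK Ks(7) by (simp add: V_def)
  qed
  moreover obtain N where N: "open_normal N" "N \<subseteq> {x \<in> U. \<phi> x = 1}"
    using open_normal_core[OF open_subgroup_kernel[OF \<phi> U]] by blast
  have "N \<subseteq> V"
  proof
    fix n assume n: "n \<in> N"
    have nK: "n \<in> K" using n N UKs by blast
    have "f (k \<otimes> n) = f k" if k: "k \<in> K" for k
    proof -
      let ?m = "k \<otimes> n \<otimes> inv k"
      have m: "?m \<in> U" "\<phi> ?m = 1" using open_normal_conj[OF N(1) Ks(5)[OF k] n] N(2) by auto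
      have e: "k \<otimes> n = ?m \<otimes> k" using k nK Ks(5) by (simp add: m_assoc)
      have "r (k \<otimes> n) = r k" using r(2)[OF k m(1)] e by simp
      moreover have "k \<otimes> n \<otimes> inv (r k) = ?m \<otimes> (k \<otimes> inv (r k))"
        using k nK Ks(5) rK(2)[OF k] by (simp add: m_assoc)
      ultimately show ?thesis
        using charactersD(1)[OF \<phi> m(1) rK(3)[OF k]] m(2) by (simp add: f_def)
    qed
    then show "n \<in> V" using nK by (simp add: V_def)
  qed
  ultimately have V: "open_subgroup V"
    using open_subgroup_superset[OF open_normal_imp_open_subgroup[OF N(1)]] by blast
  have "X \<subseteq> V"
  proof
    fix x assume x: "x \<in> X"
    have xK: "x \<in> K" using x X by (auto simp: generates_def)
    have "f (k \<otimes> x) = f k" if k: "k \<in> K" for k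
    proof -
      define v where "v = k \<otimes> inv (r k)"
      define s where "s = r k \<otimes> x \<otimes> inv (r (r k \<otimes> x))"
      note k' = rK[OF k]
      have rx: "r k \<otimes> x \<in> K" using k' xK Ks(7) by simp
      have kx: "k \<otimes> x = v \<otimes> (r k \<otimes> x)"
        unfolding v_def using Ks(5)[OF k] Ks(5)[OF xK] k'(2) by (simp add: m_assoc)
      have vU: "v \<in> U" using k'(3) by (simp add: v_def)
      have rkx: "r (k \<otimes> x) = r (r k \<otimes> x)" using r(2)[OF rx vU] kx by (simp only:)
      have "k \<otimes> x \<otimes> inv (r (k \<otimes> x)) = v \<otimes> (r k \<otimes> x) \<otimes> inv (r (r k \<otimes> x))"
        by (subst rkx, subst kx) (rule refl)
      also have "\<dots> = v \<otimes> s"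
        unfolding s_def using Us(5)[OF vU] k'(2) Ks(5)[OF xK] rK(2)[OF rx] by (simp add: m_assoc)
      finally have "k \<otimes> x \<otimes> inv (r (k \<otimes> x)) = v \<otimes> s" .
      moreover have "s \<in> U" using rK(3)[OF rx] by (simp add: s_def)
      moreover have "\<phi> s = 1" using triv[OF k x] by (simp add: s_def)
      ultimately show ?thesis using charactersD(1)[OF \<phi>] k' by (simp add: f_def v_def)
    qed
    then show "x \<in> V" using xK by (simp add: V_def)
  qed
  then have "K \<subseteq> V" using X V by (simp add: generates_def)
  then have "u \<in> V" using UKs[OF u] by blast
  then have "f (\<one> \<otimes> u) = f \<one>" using Ks(4) unfolding V_def by blast
  then have fu: "f u = f \<one>" using UKs[OF u] by simp
  have "r (u \<otimes> \<one>) = r \<one>" using r(2)[OF Ks(4) u] .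
  then have ru: "r u = r \<one>" using UKs[OF u] by simp
  have "inv (r \<one>) \<in> U" using rK[OF Ks(4)] by simp
  then have "f u = \<phi> u * \<phi> (inv (r \<one>))" using charactersD(1)[OF \<phi> u] ru by (simp add: f_def)
  moreover have "f \<one> = \<phi> (inv (r \<one>))" using rK[OF Ks(4)] by (simp add: f_def)
  ultimately show ?thesis using fu charactersD(4)[OF \<phi>, of "inv (r \<one>)"] by simp
qed

text \<open>A character of \<open>U\<close> is determined by its values on the Schreier generators.\<close>

lemma schreier_bound:
  assumes U: "open_subgroup U" and K: "open_subgroup K" and UK: "U \<subseteq> K"
    and X: "generates X K" "finite X"
  shows "finite (characters U)" "card (characters U) \<le> p ^ (index_in K U * card X)"
proof -
  note Us = open_subgroupD[OF U] and Ks = open_subgroupD[OF K]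
  obtain r where r: "\<And>k. k \<in> K \<Longrightarrow> r k \<in> K \<and> k \<otimes> inv (r k) \<in> U"
      "\<And>k u. k \<in> K \<Longrightarrow> u \<in> U \<Longrightarrow> r (u \<otimes> k) = r k" "finite (r ` K)" "card (r ` K) \<le> index_in K U"
    using exists_coset_representatives[OF U K UK] by blast
  let ?I = "r ` K \<times> X" and ?M = "{z::complex. z ^ p = 1}"
  let ?f = "\<lambda>\<phi>. restrict (\<lambda>(s, x). \<phi> (s \<otimes> x \<otimes> inv (r (s \<otimes> x)))) ?I"
  have p0: "p > 0" using prime_p prime_gt_0_nat by blast
  have inj: "inj_on ?f (characters U)"
  proof (rule inj_onI, rule ext)
    fix \<phi> \<psi> x assume \<phi>: "\<phi> \<in> characters U" "\<psi> \<in> characters U" and eq: "?f \<phi> = ?f \<psi>"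
    have d: "(\<lambda>x. \<phi> x / \<psi> x) \<in> characters U" using character_divide[OF \<phi> U] .
    have "\<phi> (r k \<otimes> y \<otimes> inv (r (r k \<otimes> y))) / \<psi> (r k \<otimes> y \<otimes> inv (r (r k \<otimes> y))) = 1"
      if "k \<in> K" "y \<in> X" for k y
      using fun_cong[OF eq, of "(r k, y)"] that charactersD(4)[OF \<phi>(2)] by simp
    then have "\<phi> x / \<psi> x = 1" if "x \<in> U"
      using character_eq_1_if_schreier_trivial[OF U K UK X(1) r(1,2) d _ that] by blast
    then show "\<phi> x = \<psi> x" using charactersD(3)[OF \<phi>(1), of x] charactersD(3)[OF \<phi>(2), of x]
      by (cases "x \<in> U") auto
  qed
  have im: "?f ` characters U \<subseteq> PiE ?I (\<lambda>_. ?M)"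
  proof (rule image_subsetI)
    fix \<phi> assume "\<phi> \<in> characters U"
    then have "\<phi> y ^ p = 1" for y by (rule charactersD(2))
    then show "?f \<phi> \<in> PiE ?I (\<lambda>_. ?M)" by (auto split: prod.split)
  qed
  have finI: "finite ?I" using r X by simp
  have finP: "finite (PiE ?I (\<lambda>_. ?M))" using finI p0 by (intro finite_PiE) (auto intro!: finite_roots_unity)
  show "finite (characters U)" using inj_on_finite[OF inj im finP] .
  have "card (characters U) \<le> card (PiE ?I (\<lambda>_. ?M))" using card_inj_on_le[OF inj im finP] .
  also have "\<dots> = p ^ card ?I" using finI p0 by (simp add: card_PiE card_roots_unity_eq del: PiE_eq_empty_iff)
  also have "\<dots> \<le> p ^ (index_in K U * card X)"
    using r p0 by (intro power_increasing) (auto simp: card_cartesian_product)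
  finally show "card (characters U) \<le> p ^ (index_in K U * card X)" .
qed

lemma card_characters_index_bound:
  assumes U: "open_subgroup U" and K: "open_subgroup K" and UK: "U \<subseteq> K" and fin: "finite (characters K)"
  shows "card (characters U) \<le> card (characters K) ^ index_in K U"
proof -
  obtain X where X: "finite X" "generates X K" "p ^ card X \<le> card (characters K)"
    using burnside_basis[OF K fin] by blast
  have "card (characters U) \<le> (p ^ card X) ^ index_in K U"
    using schreier_bound(2)[OF U K UK X(2,1)] by (simp add: power_mult[symmetric] mult.commute)
  also have "\<dots> \<le> card (characters K) ^ index_in K U" using X by (intro power_mono) auto
  finally show ?thesis .
qed

section \<open>Extending characters\<close>

text \<open>The extension is \<open>q \<otimes> y \<mapsto> \<phi> y\<close>.  It is well defined because \<open>\<phi>\<close> is trivial on \<open>Q \<inter> N\<close>, and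
  multiplicative because \<open>Q\<close> fixes \<open>\<phi>\<close>.\<close>

lemma extend_character:
  assumes N: "open_subgroup N" and Q: "subgroup Q G" and \<phi>: "\<phi> \<in> characters N"
    and norm: "\<And>q y. q \<in> Q \<Longrightarrow> y \<in> N \<Longrightarrow> q \<otimes> y \<otimes> inv q \<in> N \<and> \<phi> (q \<otimes> y \<otimes> inv q) = \<phi> y"
    and triv: "\<And>q. q \<in> Q \<Longrightarrow> q \<in> N \<Longrightarrow> \<phi> q = 1"
  shows "open_subgroup (Q <#> N)"
    and "\<exists>\<psi>\<in>characters (Q <#> N). (\<forall>y\<in>N. \<psi> y = \<phi> y) \<and> (\<forall>q\<in>Q. \<psi> q = 1)"
proof -
  note Ns = open_subgroupD[OF N]
  have Qs: "q \<in> carrier G" "inv q \<in> Q" if "q \<in> Q" for q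
    using that Q by (auto intro: subgroup.mem_carrier subgroup.m_inv_closed)
  have Q1: "\<one> \<in> Q" and Qm: "\<And>a b. a \<in> Q \<Longrightarrow> b \<in> Q \<Longrightarrow> a \<otimes> b \<in> Q"
    using Q by (auto intro: subgroup.one_closed subgroup.m_closed)
  let ?K = "Q <#> N"
  have KI: "q \<otimes> y \<in> ?K" if "q \<in> Q" "y \<in> N" for q y using that by (auto simp: set_mult_def)
  have KE: "\<exists>q y. q \<in> Q \<and> y \<in> N \<and> k = q \<otimes> y" if "k \<in> ?K" for k
    using that by (auto simp: set_mult_def)
  have norm': "inv q \<otimes> y \<otimes> q \<in> N" "\<phi> (inv q \<otimes> y \<otimes> q) = \<phi> y" if "q \<in> Q" "y \<in> N" for q y
    using norm[OF Qs(2) that(2), of q] that Qs(1) by auto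
  have prod: "(q \<otimes> y) \<otimes> (q' \<otimes> y') = (q \<otimes> q') \<otimes> ((inv q' \<otimes> y \<otimes> q') \<otimes> y')"
    if "q \<in> Q" "q' \<in> Q" "y \<in> N" "y' \<in> N" for q q' y y'
    using that Qs Ns(5) by (simp add: m_assoc)
  have "subgroup ?K G"
  proof (rule subgroupI)
    show "?K \<subseteq> carrier G" using Qs Ns(5) by (auto simp: set_mult_def)
    show "?K \<noteq> {}" using KI[OF Q1 Ns(4)] by blast
    fix a assume "a \<in> ?K"
    then obtain q y where a: "q \<in> Q" "y \<in> N" "a = q \<otimes> y" using KE by blast
    have "inv a = inv q \<otimes> (q \<otimes> inv y \<otimes> inv q)" using a Qs Ns(5) by (simp add: word_simps)
    then show "inv a \<in> ?K" using KI norm a Qs Ns(6) by metis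
    fix b assume "b \<in> ?K"
    then obtain q' y' where b: "q' \<in> Q" "y' \<in> N" "b = q' \<otimes> y'" using KE by blast
    show "a \<otimes> b \<in> ?K"
      unfolding a(3) b(3) prod[OF a(1) b(1) a(2) b(2)]
      by (intro KI Qm Ns(7) norm' a b)
  qed
  moreover have NK: "N \<subseteq> ?K"
  proof
    fix y assume "y \<in> N"
    then have "\<one> \<otimes> y \<in> ?K" "\<one> \<otimes> y = y" using KI[OF Q1] Ns(5) by auto
    then show "y \<in> ?K" by simp
  qed
  ultimately show K: "open_subgroup ?K" using open_subgroup_superset[OF N] by blast
  define \<psi> where "\<psi> = (\<lambda>k. if k \<in> ?K then \<phi> (SOME y. y \<in> N \<and> (\<exists>q\<in>Q. k = q \<otimes> y)) else 1)"
  have \<psi>: "\<psi> (q \<otimes> y) = \<phi> y" if qy: "q \<in> Q" "y \<in> N" for q y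
  proof -
    let ?P = "\<lambda>z. z \<in> N \<and> (\<exists>r\<in>Q. q \<otimes> y = r \<otimes> z)"
    define z where "z = Eps ?P"
    have "?P z" unfolding z_def by (rule someI[of ?P y]) (use qy in blast)
    then obtain r where r: "z \<in> N" "r \<in> Q" "q \<otimes> y = r \<otimes> z" by blast
    have c: "q \<in> carrier G" "r \<in> carrier G" "y \<in> carrier G" "z \<in> carrier G"
      using r qy Qs Ns(5) by auto
    have z: "z = (inv r \<otimes> q) \<otimes> y" using r(3) c by (simp add: m_assoc)
    have "z \<otimes> inv y = inv r \<otimes> q" unfolding z using c by (simp add: m_assoc)
    moreover have "z \<otimes> inv y \<in> N" using r qy Ns(6,7) by blast
    ultimately have w: "inv r \<otimes> q \<in> N" by simp
    have "\<phi> (inv r \<otimes> q) = 1" by (rule triv[OF Qm[OF Qs(2)[OF r(2)] qy(1)] w])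
    then have "\<phi> z = \<phi> y" using charactersD(1)[OF \<phi> w qy(2)] z by simp
    then show ?thesis using KI[OF qy] by (simp add: \<psi>_def z_def)
  qed
  have out: "\<psi> k = 1" if "k \<notin> ?K" for k using that by (simp add: \<psi>_def)
  have on_N: "\<psi> y = \<phi> y" if "y \<in> N" for y
    using \<psi>[OF Q1 that] Ns(5)[OF that] by simp
  have "\<psi> \<in> characters ?K"
  proof (rule charactersI[OF K open_subgroup_kernel[OF \<phi> N]])
    show "{x \<in> N. \<phi> x = 1} \<subseteq> ?K" using NK by blast
    show "\<psi> x = 1" if "x \<in> {x \<in> N. \<phi> x = 1}" for x using that on_N by simp
    fix a b assume "a \<in> ?K" "b \<in> ?K"
    then obtain q y q' y' where ab: "q \<in> Q" "y \<in> N" "a = q \<otimes> y" "q' \<in> Q" "y' \<in> N" "b = q' \<otimes> y'"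
      using KE by metis
    have "\<psi> (a \<otimes> b) = \<phi> ((inv q' \<otimes> y \<otimes> q') \<otimes> y')"
      unfolding ab prod[OF ab(1,4,2,5)] by (intro \<psi> Qm Ns(7) norm' ab)
    also have "\<dots> = \<phi> y * \<phi> y'" using charactersD(1)[OF \<phi>] norm' ab by simp
    finally show "\<psi> (a \<otimes> b) = \<psi> a * \<psi> b" using ab \<psi> by simp
  next
    fix x assume "x \<in> ?K"
    then obtain q y where "q \<in> Q" "y \<in> N" "x = q \<otimes> y" using KE by blast
    then show "\<psi> x ^ p = 1" using \<psi> charactersD(2)[OF \<phi>] by simp
  qed (use out in auto)
  moreover have "\<psi> q = 1" if "q \<in> Q" for q
    using \<psi>[OF that Ns(4)] Qs(1)[OF that] character_one[OF \<phi> N] by simp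
  ultimately show "\<exists>\<psi>\<in>characters ?K. (\<forall>y\<in>N. \<psi> y = \<phi> y) \<and> (\<forall>q\<in>Q. \<psi> q = 1)"
    using on_N by blast
qed

lemma card_le_characters_of_extendable:
  assumes "open_subgroup N" "open_subgroup K" "N \<subseteq> K" "finite E" "E \<subseteq> characters K" "D \<subseteq> characters N"
    and ext: "\<And>\<phi>. \<phi> \<in> D \<Longrightarrow> \<exists>\<psi>\<in>E. \<forall>y\<in>N. \<psi> y = \<phi> y"
  shows "card D \<le> card E"
proof (rule surj_card_le[OF assms(4)])
  show "D \<subseteq> (\<lambda>\<psi> y. if y \<in> N then \<psi> y else 1) ` E"
  proof
    fix \<phi> assume \<phi>: "\<phi> \<in> D"
    then obtain \<psi> where \<psi>: "\<psi> \<in> E" "\<forall>y\<in>N. \<psi> y = \<phi> y" using ext by blast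
    have "\<phi> = (\<lambda>y. if y \<in> N then \<psi> y else 1)"
      using \<psi> charactersD(3)[of \<phi> N] \<phi> assms by (auto simp: fun_eq_iff)
    then show "\<phi> \<in> (\<lambda>\<psi> y. if y \<in> N then \<psi> y else 1) ` E" using \<psi> by blast
  qed
qed

definition stabilizer_of_char :: "'a set \<Rightarrow> ('a \<Rightarrow> complex) \<Rightarrow> 'a set" where
  "stabilizer_of_char N \<phi> = {g \<in> carrier G. \<forall>y\<in>N. g \<otimes> y \<otimes> inv g \<in> N \<and> inv g \<otimes> y \<otimes> g \<in> N
     \<and> \<phi> (g \<otimes> y \<otimes> inv g) = \<phi> y}"

lemma subgroup_stabilizer_of_char:
  assumes "N \<subseteq> carrier G"
  shows "subgroup (stabilizer_of_char N \<phi>) G"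
proof (rule subgroupI)
  have Nc: "y \<in> carrier G" if "y \<in> N" for y using that assms by blast
  have "\<one> \<in> stabilizer_of_char N \<phi>" using Nc by (simp add: stabilizer_of_char_def)
  then show "stabilizer_of_char N \<phi> \<noteq> {}" by blast
  show "stabilizer_of_char N \<phi> \<subseteq> carrier G" by (auto simp: stabilizer_of_char_def)
  fix g assume g: "g \<in> stabilizer_of_char N \<phi>"
  then have gc: "g \<in> carrier G" by (simp add: stabilizer_of_char_def)
  have "\<phi> (inv g \<otimes> y \<otimes> g) = \<phi> y" if y: "y \<in> N" for y
  proof -
    have "inv g \<otimes> y \<otimes> g \<in> N" using g y by (simp add: stabilizer_of_char_def)
    then have "\<phi> (g \<otimes> (inv g \<otimes> y \<otimes> g) \<otimes> inv g) = \<phi> (inv g \<otimes> y \<otimes> g)"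
      using g unfolding stabilizer_of_char_def by blast
    moreover have "g \<otimes> (inv g \<otimes> y \<otimes> g) \<otimes> inv g = y" using gc Nc[OF y] by (simp add: m_assoc)
    ultimately show ?thesis by simp
  qed
  then show "inv g \<in> stabilizer_of_char N \<phi>" using g gc by (simp add: stabilizer_of_char_def)
  fix h assume h: "h \<in> stabilizer_of_char N \<phi>"
  then have hc: "h \<in> carrier G" by (simp add: stabilizer_of_char_def)
  have "(g \<otimes> h) \<otimes> y \<otimes> inv (g \<otimes> h) = g \<otimes> (h \<otimes> y \<otimes> inv h) \<otimes> inv g"
    "inv (g \<otimes> h) \<otimes> y \<otimes> (g \<otimes> h) = inv h \<otimes> (inv g \<otimes> y \<otimes> g) \<otimes> h" if "y \<in> N" for y
    using gc hc Nc[OF that] by (simp_all add: word_simps)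
  then show "g \<otimes> h \<in> stabilizer_of_char N \<phi>"
    using g h gc hc unfolding stabilizer_of_char_def by simp
qed

definition fixed_characters :: "'a set \<Rightarrow> 'a \<Rightarrow> ('a \<Rightarrow> complex) set" where
  "fixed_characters H t = {\<phi> \<in> characters H. \<forall>y\<in>H. \<phi> (t \<otimes> y \<otimes> inv t) = \<phi> y}"

lemma fixed_characters_stabilizer:
  assumes "open_normal H" "t \<in> carrier G" "\<phi> \<in> fixed_characters H t"
  shows "t \<in> stabilizer_of_char H \<phi>"
  using assms open_normal_conj[OF assms(1,2)] open_normal_conj'[OF assms(1,2)]
  by (simp add: stabilizer_of_char_def fixed_characters_def)

lemma exists_power_in:
  assumes H: "open_subgroup H" and t: "t \<in> carrier G"
  shows "\<exists>n>0. t [^] (n::nat) \<in> H \<and> (\<forall>a::int. t [^] a \<in> H \<longrightarrow> (int n) dvd a)"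
proof -
  note Hs = open_subgroupD[OF H]
  have "\<not> inj (\<lambda>n::nat. H #> (t [^] n))"
  proof
    assume "inj (\<lambda>n::nat. H #> (t [^] n))"
    moreover have "range (\<lambda>n::nat. H #> (t [^] n)) \<subseteq> (\<lambda>k. H #> k) ` carrier G" using t by auto
    ultimately have "finite (UNIV :: nat set)"
      using finite_cosets[OF H order_refl] by (meson finite_imageD finite_subset)
    then show False by simp
  qed
  then obtain i j :: nat where ij: "i < j" "H #> (t [^] i) = H #> (t [^] j)"
    unfolding inj_def by (metis linorder_neqE_nat)
  have "t [^] j \<otimes> inv (t [^] i) \<in> H" using r_coset_eq_iff[OF Hs(1), of "t [^] i" "t [^] j"] ij t by simp
  moreover have "t [^] j = t [^] (j - i) \<otimes> t [^] i" using nat_pow_mult[OF t, of "j - i" i] ij by simp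
  ultimately have "t [^] (j - i) \<in> H" using t by (simp add: m_assoc)
  then have ex: "\<exists>n. n > 0 \<and> t [^] (n::nat) \<in> H" using ij by (intro exI[of _ "j - i"]) auto
  define n where "n = (LEAST n. n > 0 \<and> t [^] (n::nat) \<in> H)"
  have n: "n > 0" "t [^] n \<in> H" using LeastI_ex[OF ex] by (auto simp: n_def)
  have "int n dvd a" if a: "t [^] a \<in> H" for a :: int
  proof -
    let ?r = "nat (a mod int n)"
    have r: "int ?r = a mod int n" using n by simp
    have e: "t [^] a = t [^] (int n * (a div int n)) \<otimes> t [^] (a mod int n)"
      using int_pow_mult[OF t, of "int n * (a div int n)" "a mod int n"] by simp
    have "t [^] (int n * (a div int n)) = (t [^] n) [^] (a div int n)"
      using int_pow_pow[OF t, of "int n" "a div int n"] by (simp add: int_pow_int)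
    then have m: "t [^] (int n * (a div int n)) \<in> H" using subgroup_int_pow_closed[OF Hs(1) n(2)] by simp
    have "inv (t [^] (int n * (a div int n))) \<otimes> t [^] a \<in> H" using Hs(6)[OF m] Hs(7) a by blast
    then have "t [^] (a mod int n) \<in> H" unfolding e using t by simp
    then have "t [^] ?r \<in> H" using r by (metis int_pow_int)
    moreover have "?r < n" using n r by (metis of_nat_0_less_iff of_nat_less_iff pos_mod_bound)
    ultimately have "?r = 0" using not_less_Least[of ?r "\<lambda>n. n > 0 \<and> t [^] (n::nat) \<in> H"]
      unfolding n_def by auto
    then have "a mod int n = 0" using r by simp
    then show ?thesis by auto
  qed
  then show ?thesis using n by blast
qed

text \<open>A character of \<open>H\<close> fixed by \<open>t\<close> extends to the group generated by \<open>t\<close> and \<open>H\<close> as soon as it is trivial on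
  the first power of \<open>t\<close> in \<open>H\<close>, a condition that costs a factor of at most \<open>p\<close>.\<close>

lemma card_fixed_characters_le:
  assumes H: "open_normal H" and t: "t \<in> carrier G" and fin: "finite (characters H)"
  shows "open_subgroup (generate G {t} <#> H)" "H \<subseteq> generate G {t} <#> H" "t \<in> generate G {t} <#> H"
    and "finite (characters (generate G {t} <#> H)) \<Longrightarrow>
      card (fixed_characters H t) \<le> card (characters (generate G {t} <#> H)) * p"
proof -
  note Ho = open_normal_imp_open_subgroup[OF H]
  note Hs = open_subgroupD[OF Ho]
  let ?Q = "generate G {t}" and ?K = "generate G {t} <#> H"
  have Q: "subgroup ?Q G" using t by (intro generate_is_subgroup) simp
  have gen: "?Q \<subseteq> stabilizer_of_char H \<phi>" if "\<phi> \<in> fixed_characters H t" for \<phi>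
    using fixed_characters_stabilizer[OF H t that] subgroup_stabilizer_of_char[OF Hs(3)]
    by (intro generate_subgroup_incl) auto
  have triv: "(\<lambda>_. 1) \<in> fixed_characters H t"
    using character_trivial[OF Ho] by (simp add: fixed_characters_def)
  have norm: "q \<otimes> y \<otimes> inv q \<in> H \<and> \<phi> (q \<otimes> y \<otimes> inv q) = \<phi> y"
    if "\<phi> \<in> fixed_characters H t" "q \<in> ?Q" "y \<in> H" for \<phi> q y
    using gen[OF that(1)] that(2,3) by (auto simp: stabilizer_of_char_def)
  show K: "open_subgroup ?K"
    using extend_character(1)[OF Ho Q character_trivial[OF Ho]] norm[OF triv] by auto
  have KI: "q \<otimes> y \<in> ?K" if "q \<in> ?Q" "y \<in> H" for q y using that by (auto simp: set_mult_def)
  have "y \<in> ?K" if "y \<in> H" for y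
    using KI[OF subgroup.one_closed[OF Q] that] Hs(5)[OF that] by simp
  then show HK: "H \<subseteq> ?K" by (rule subsetI)
  show "t \<in> ?K" using KI[OF generate.incl Hs(4), of t] t by simp
  assume finK: "finite (characters ?K)"
  obtain n :: nat where n: "n > 0" "t [^] n \<in> H" "\<forall>a::int. t [^] a \<in> H \<longrightarrow> (int n) dvd a"
    using exists_power_in[OF Ho t] by blast
  let ?A = "fixed_characters H t" and ?D = "{\<phi> \<in> fixed_characters H t. \<phi> (t [^] n) = 1}"
  have finA: "finite ?A" using fin by (simp add: fixed_characters_def)
  have "card ?D \<le> card (characters ?K)"
  proof (rule card_le_characters_of_extendable[OF Ho K HK finK])
    fix \<phi> assume \<phi>: "\<phi> \<in> ?D"
    then have \<phi>c: "\<phi> \<in> characters H" by (simp add: fixed_characters_def)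
    have "\<phi> q = 1" if q: "q \<in> ?Q" "q \<in> H" for q
    proof -
      obtain a :: int where a: "q = t [^] a" using q t by (auto simp: generate_pow)
      then obtain b where b: "a = int n * b" using n q by (auto elim: dvdE)
      have q': "q = (t [^] n) [^] b" using a b int_pow_pow[OF t, of "int n" b] by (simp add: int_pow_int)
      have "subgroup {x \<in> H. \<phi> x = 1} G" using open_subgroup_kernel[OF \<phi>c Ho] open_subgroupD(1) by blast
      from subgroup_int_pow_closed[OF this, of "t [^] n" b] show ?thesis
        using n \<phi> q' by auto
    qed
    then show "\<exists>\<psi>\<in>characters ?K. \<forall>y\<in>H. \<psi> y = \<phi> y"
      using extend_character(2)[OF Ho Q \<phi>c] norm[of \<phi>] \<phi> by blast
  qed (auto simp: fixed_characters_def)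
  moreover have "card ?A \<le> card ?D * card ((\<lambda>\<phi>. \<phi> (t [^] n)) ` ?A)"
  proof (rule card_characters_le_quotient[OF finA])
    show "?A \<subseteq> characters H" by (auto simp: fixed_characters_def)
    fix \<phi> \<psi> assume "\<phi> \<in> ?A" "\<psi> \<in> ?A" "\<phi> (t [^] n) = \<psi> (t [^] n)"
    then show "(\<lambda>x. \<phi> x / \<psi> x) \<in> ?D"
      using character_divide[OF _ _ Ho] charactersD(4)[of \<psi> H] by (auto simp: fixed_characters_def)
  qed (use finA in auto)
  moreover have "card ((\<lambda>\<phi>. \<phi> (t [^] n)) ` ?A) \<le> card {z::complex. z ^ p = 1}"
    using prime_gt_0_nat[OF prime_p]
    by (intro card_mono) (auto simp: fixed_characters_def charactersD(2) intro!: finite_roots_unity)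
  ultimately show "card (fixed_characters H t) \<le> card (characters ?K) * p"
    using prime_gt_0_nat[OF prime_p] by (simp add: card_roots_unity_eq) (meson mult_le_mono order_trans)
qed

text \<open>The fibres of the quotient map \<open>A \<times> B \<rightarrow> characters U\<close> have at most the size of \<open>A \<inter> B\<close>.\<close>

lemma card_mult_le_card_Int:
  assumes U: "open_subgroup U" and fin: "finite (characters U)"
    and A: "A \<subseteq> characters U" "\<And>\<phi> \<psi>. \<phi> \<in> A \<Longrightarrow> \<psi> \<in> A \<Longrightarrow> (\<lambda>x. \<phi> x / \<psi> x) \<in> A"
    and B: "B \<subseteq> characters U" "\<And>\<phi> \<psi>. \<phi> \<in> B \<Longrightarrow> \<psi> \<in> B \<Longrightarrow> (\<lambda>x. \<phi> x / \<psi> x) \<in> B"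
  shows "card A * card B \<le> card (A \<inter> B) * card (characters U)"
proof -
  let ?f = "\<lambda>(\<phi>, \<psi>) x. \<phi> x / \<psi> x :: complex"
  have finA: "finite A" "finite B" using finite_subset[OF A(1) fin] finite_subset[OF B(1) fin] .
  have "card (A \<times> B) \<le> card (A \<inter> B) * card (?f ` (A \<times> B))"
  proof (rule card_le_card_image_times)
    show "finite (A \<times> B)" using finA by simp
    fix a assume "a \<in> A \<times> B"
    then obtain \<phi>0 \<psi>0 where a: "a = (\<phi>0, \<psi>0)" "\<phi>0 \<in> A" "\<psi>0 \<in> B" by blast
    have nz: "\<phi> x \<noteq> 0" if "\<phi> \<in> A \<or> \<phi> \<in> B" for \<phi> x using that A(1) B(1) charactersD(4) by blast
    let ?F = "{z \<in> A \<times> B. ?f z = ?f a}" and ?g = "\<lambda>z x. fst z x / \<phi>0 x"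
    have F: "\<phi> x / \<psi> x = \<phi>0 x / \<psi>0 x" if "(\<phi>, \<psi>) \<in> ?F" for \<phi> \<psi> x
    proof -
      have "(\<lambda>x. \<phi> x / \<psi> x) = (\<lambda>x. \<phi>0 x / \<psi>0 x)" using that a by simp
      from fun_cong[OF this, of x] show ?thesis .
    qed
    have "inj_on ?g ?F"
    proof (rule inj_onI)
      fix y z assume yz: "y \<in> ?F" "z \<in> ?F" "?g y = ?g z"
      obtain \<phi> \<psi> \<phi>' \<psi>' where e: "y = (\<phi>, \<psi>)" "z = (\<phi>', \<psi>')" by fastforce
      have 1: "\<phi> x = \<phi>' x" for x using fun_cong[OF yz(3), of x] nz[of \<phi>0 x] a by (simp add: e)
      moreover have "\<psi> x = \<psi>' x" for x
        using F[of \<phi> \<psi> x] F[of \<phi>' \<psi>' x] yz(1,2) 1[of x] nz[of \<phi> x] nz[of \<phi>' x] nz[of \<psi> x] nz[of \<psi>' x]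
        by (auto simp: e field_simps)
      ultimately show "y = z" unfolding e by auto
    qed
    moreover have "?g ` ?F \<subseteq> A \<inter> B"
    proof
      fix \<theta> assume "\<theta> \<in> ?g ` ?F"
      then obtain \<phi> \<psi> where z: "(\<phi>, \<psi>) \<in> ?F" "\<theta> = (\<lambda>x. \<phi> x / \<phi>0 x)" by force
      have AB: "\<phi> \<in> A" "\<psi> \<in> B" using z(1) by auto
      have "\<phi> x / \<phi>0 x = \<psi> x / \<psi>0 x" for x
        using F[OF z(1), of x] AB a nz[of \<phi>0 x] nz[of \<psi> x] nz[of \<psi>0 x] by (auto simp: field_simps)
      then have "\<theta> = (\<lambda>x. \<psi> x / \<psi>0 x)" using z by simp
      then have "\<theta> \<in> B" using B(2)[OF AB(2) a(3)] by simp
      moreover have "\<theta> \<in> A" using A(2)[OF AB(1) a(2)] z(2) by simp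
      ultimately show "\<theta> \<in> A \<inter> B" by blast
    qed
    ultimately show "card ?F \<le> card (A \<inter> B)" using finA by (intro card_inj_on_le) auto
  qed
  also have "\<dots> \<le> card (A \<inter> B) * card (characters U)"
    using A(1) B(1) by (intro mult_left_mono card_mono fin) (auto intro!: character_divide[OF _ _ U])
  finally show ?thesis by (simp add: card_cartesian_product)
qed

end

section \<open>Groups whose rank gradient is nearly attained\<close>

text \<open>The constant \<open>3/2\<close> could be any number strictly between \<open>1\<close> and \<open>2\<close>: it has to be less than the smallest possible
  index of a proper open subgroup of \<open>H0\<close>.\<close>

locale tight_pro_p_group = pro_p_group +
  fixes \<rho> :: real and H0 :: "'a set"
  assumes \<rho>_pos: "\<rho> > 0"
    and H0: "open_normal H0"
    and finite_characters: "\<And>K. open_subgroup K \<Longrightarrow> finite (characters K)"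
    and rank_lower: "\<And>K. open_subgroup K \<Longrightarrow>
      \<rho> * index_in (carrier G) K \<le> log p (card (characters K))"
    and rank_upper: "\<And>K. open_subgroup K \<Longrightarrow> K \<subseteq> H0 \<Longrightarrow>
      log p (card (characters K)) \<le> 3 / 2 * \<rho> * index_in (carrier G) K"

context pro_p_group begin

text \<open>\<open>\<rho>\<close> is the infimum of the quotients \<open>log p (card (characters K)) / index\<close>, and \<open>H0\<close> lies in a subgroup where
  the quotient is below \<open>3/2 \<rho>\<close>.  By the Schreier bound the quotient does not increase when passing to
  open subgroups.\<close>

lemma exists_tight:
  fixes c :: real
  assumes fin: "\<And>K. open_subgroup K \<Longrightarrow> finite (characters K)"
    and c: "c > 0" "\<And>K. open_subgroup K \<Longrightarrow> c * index_in (carrier G) K \<le> log p (card (characters K))"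
  shows "\<exists>\<rho> H0. tight_pro_p_group G T p \<rho> H0"
proof -
  let ?i = "\<lambda>K. real (index_in (carrier G) K)" and ?r = "\<lambda>K. log p (card (characters K))"
  let ?S = "(\<lambda>K. ?r K / ?i K) ` {K. open_subgroup K}"
  have ipos: "?i K > 0" if "open_subgroup K" for K
    using index_in_pos[OF that open_subgroup_carrier] open_subgroupD(3)[OF that] by simp
  have p1: "real p > 1" using prime_gt_1_nat[OF prime_p] by simp
  define \<rho> where "\<rho> = Inf ?S"
  have ne: "?S \<noteq> {}" using open_subgroup_carrier by blast
  have cb: "c \<le> x" if "x \<in> ?S" for x
    using that c(2) ipos by (auto simp: field_simps)
  have bdd: "bdd_below ?S" using cb by (rule bdd_belowI)
  have "c \<le> \<rho>" unfolding \<rho>_def using cInf_greatest[OF ne cb] .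
  then have pos: "\<rho> > 0" using c by simp
  have low: "\<rho> * ?i K \<le> ?r K" if "open_subgroup K" for K
  proof -
    have "\<rho> \<le> ?r K / ?i K" unfolding \<rho>_def using that by (intro cInf_lower bdd) blast
    then show ?thesis using ipos[OF that] by (simp add: field_simps)
  qed
  have "\<rho> < 3 / 2 * \<rho>" using pos by simp
  then obtain x where x: "x \<in> ?S" "x < 3 / 2 * \<rho>"
    using cInf_lessD[OF ne] unfolding \<rho>_def by blast
  then obtain K0 where K0: "open_subgroup K0" "?r K0 / ?i K0 < 3 / 2 * \<rho>" by blast
  obtain H0 where H0: "open_normal H0" "H0 \<subseteq> K0" using open_normal_core K0 by blast
  have up: "?r K \<le> 3 / 2 * \<rho> * ?i K" if K: "open_subgroup K" "K \<subseteq> H0" for K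
  proof -
    have KK: "K \<subseteq> K0" using K H0 by blast
    have c1: "card (characters U) > 0" if "open_subgroup U" for U
      using fin[OF that] character_trivial[OF that] by (auto simp: card_gt_0_iff)
    have "real (card (characters K)) \<le> real (card (characters K0) ^ index_in K0 K)"
      using card_characters_index_bound[OF K(1) K0(1) KK fin[OF K0(1)]] by (rule of_nat_mono)
    then have "?r K \<le> log p (card (characters K0) ^ index_in K0 K)"
      using c1[OF K(1)] p1 by (intro log_mono) auto
    also have "\<dots> = index_in K0 K * ?r K0" using c1[OF K0(1)] p1 by (simp add: log_nat_power)
    also have "\<dots> \<le> index_in K0 K * (3 / 2 * \<rho> * ?i K0)"
      using K0(2) ipos[OF K0(1)] by (intro mult_left_mono) (auto simp: field_simps)
    also have "\<dots> = 3 / 2 * \<rho> * ?i K"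
      using index_in_open_trans[OF K(1) K0(1) open_subgroup_carrier KK] open_subgroupD(3)[OF K0(1)]
      by simp
    finally show ?thesis .
  qed
  have "tight_pro_p_group G T p \<rho> H0"
    by unfold_locales (use pos H0 fin low up in auto)
  then show ?thesis by blast
qed

end

context tight_pro_p_group begin

abbreviation idx :: "'a set \<Rightarrow> real" where
  "idx K \<equiv> real (index_in (carrier G) K)"

lemma p_gt_1: "real p > 1" using prime_gt_1_nat[OF prime_p] by simp

lemma card_characters_pos: "open_subgroup K \<Longrightarrow> card (characters K) > 0"
  using finite_characters character_trivial by (auto simp: card_gt_0_iff)

lemma idx_pos: "open_subgroup K \<Longrightarrow> idx K > 0"
  using index_in_pos[OF _ open_subgroup_carrier] open_subgroupD(3) by simp

lemma card_lower: "open_subgroup K \<Longrightarrow> p powr (\<rho> * idx K) \<le> card (characters K)"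
  using rank_lower card_characters_pos p_gt_1 by (simp add: le_log_iff)

lemma card_upper: "open_subgroup K \<Longrightarrow> K \<subseteq> H0 \<Longrightarrow> card (characters K) \<le> p powr (3 / 2 * \<rho> * idx K)"
  using rank_upper[of K] card_characters_pos[of K] p_gt_1
  by (subst log_le_iff[symmetric]) (auto simp del: times_divide_eq_left)

text \<open>By the lower bound every open subgroup has a nontrivial character, whose kernel is a smaller open subgroup.\<close>

lemma exists_deep_open_normal:
  assumes "open_subgroup V"
  shows "\<exists>N. open_normal N \<and> N \<subseteq> V \<and> idx N \<ge> r"
proof -
  have "\<exists>N. open_normal N \<and> N \<subseteq> V \<and> index_in (carrier G) N \<ge> m" for m
  proof (induction m)
    case 0
    then show ?case using open_normal_core[OF assms] by auto
  next
    case (Suc m)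
    then obtain N where N: "open_normal N" "N \<subseteq> V" "index_in (carrier G) N \<ge> m" by blast
    note No = open_normal_imp_open_subgroup[OF N(1)]
    have "p powr 0 < p powr (\<rho> * idx N)" using \<rho>_pos idx_pos[OF No] p_gt_1 by (intro powr_less_mono) auto
    then have "card (characters N) > 1" using card_lower[OF No] p_gt_1 by simp
    then have "characters N \<noteq> {\<lambda>_. 1}" by auto
    then obtain \<phi> where \<phi>: "\<phi> \<in> characters N" "\<phi> \<noteq> (\<lambda>_. 1)" using character_trivial[OF No] by blast
    let ?U = "{x \<in> N. \<phi> x = 1}"
    have U: "open_subgroup ?U" using open_subgroup_kernel[OF \<phi>(1) No] .
    have "?U \<noteq> N" using \<phi> charactersD(3)[OF \<phi>(1)] by (auto simp: fun_eq_iff)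
    then have U2: "index_in N ?U \<ge> 2"
      using index_in_ge_prime(2)[OF U No] prime_ge_2_nat[OF prime_p] by fastforce
    obtain M where M: "open_normal M" "M \<subseteq> ?U" using open_normal_core[OF U] by blast
    have Mo: "open_subgroup M" using open_normal_imp_open_subgroup[OF M(1)] .
    have "index_in (carrier G) ?U = index_in (carrier G) N * index_in N ?U"
      using open_subgroupD(3)[OF No] by (intro index_in_open_trans U No open_subgroup_carrier) auto
    moreover have "index_in (carrier G) M = index_in (carrier G) ?U * index_in ?U M"
      using open_subgroupD(3)[OF U] M by (intro index_in_open_trans U Mo open_subgroup_carrier)
    ultimately have "index_in (carrier G) M = (index_in (carrier G) N * index_in N ?U) * index_in ?U M"
      by (simp only:)
    moreover have "(index_in (carrier G) N * 2) * 1 \<le> (index_in (carrier G) N * index_in N ?U) * index_in ?U M"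
      using U2 index_in_pos[OF Mo U M(2)] by (intro mult_le_mono) auto
    moreover have "index_in (carrier G) N > 0" using idx_pos[OF No] by simp
    ultimately have "index_in (carrier G) M \<ge> Suc m" using N(3) by linarith
    then show ?case using M N by blast
  qed
  from this[of "nat \<lceil>r\<rceil>"] show ?thesis by (metis nat_ceiling_le_eq)
qed

text \<open>The group generated by \<open>t\<close> and \<open>H\<close> lies in \<open>H0\<close> and has at most half the index of \<open>H\<close>, so the upper bound
  applies to it with constant \<open>3/4 = 3/2 / 2\<close>, which is less than \<open>1\<close>.  The summand \<open>1\<close> accounts for characters
  that do not extend.\<close>

lemma card_fixed_characters_in_H0:
  assumes H: "open_normal H" "H \<subseteq> H0" and t: "t \<in> H0" "t \<notin> H"
  shows "card (fixed_characters H t) \<le> p powr (1 + 3 / 4 * \<rho> * idx H)"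
proof -
  note H0s = open_subgroupD[OF open_normal_imp_open_subgroup[OF H0]]
  note Ho = open_normal_imp_open_subgroup[OF H(1)]
  have tc: "t \<in> carrier G" using t H0s by blast
  let ?K = "generate G {t} <#> H"
  note K = card_fixed_characters_le[OF H(1) tc finite_characters[OF Ho]]
  have "generate G {t} \<subseteq> H0" using t H0s by (intro generate_subgroup_incl) auto
  then have KH0: "?K \<subseteq> H0" using H H0s(7) by (auto simp: set_mult_def)
  have "index_in ?K H \<ge> 2"
    using index_in_ge_prime(2)[OF Ho K(1,2)] K(3) t(2) prime_ge_2_nat[OF prime_p] by fastforce
  moreover have "index_in (carrier G) H = index_in (carrier G) ?K * index_in ?K H"
    using open_subgroupD(3)[OF K(1)] by (intro index_in_open_trans Ho K(1,2) open_subgroup_carrier)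
  ultimately have "index_in (carrier G) ?K * 2 \<le> index_in (carrier G) H"
    by (metis mult_le_mono2)
  then have i: "idx ?K \<le> idx H / 2" by simp
  have "real (card (fixed_characters H t)) \<le> real (card (characters ?K)) * real p"
    using of_nat_mono[OF K(4)[OF finite_characters[OF K(1)]]] by simp
  also have "\<dots> \<le> p powr (3 / 2 * \<rho> * idx ?K) * p"
    using card_upper[OF K(1) KH0] by (intro mult_right_mono) auto
  also have "\<dots> = p powr (1 + 3 / 2 * \<rho> * idx ?K)" using p_gt_1 by (simp add: powr_add)
  also have "\<dots> \<le> p powr (1 + 3 / 4 * \<rho> * idx H)"
  proof (rule powr_mono)
    have "3 / 2 * \<rho> * idx ?K \<le> 3 / 2 * \<rho> * (idx H / 2)"
      using i \<rho>_pos by (intro mult_left_mono) auto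
    then show "1 + 3 / 2 * \<rho> * idx ?K \<le> 1 + 3 / 4 * \<rho> * idx H" by simp
  qed (use p_gt_1 in simp)
  finally show ?thesis .
qed

definition centralizer :: "'a set" where
  "centralizer = {g \<in> carrier G. \<forall>h\<in>H0. g \<otimes> h = h \<otimes> g}"

text \<open>A central element of \<open>H0\<close> fixes all characters of every \<open>H\<close>, against the previous bound when \<open>H\<close> is small.\<close>

lemma centralizer_Int_H0:
  assumes "z \<in> centralizer" "z \<in> H0"
  shows "z = \<one>"
proof (rule ccontr)
  assume "z \<noteq> \<one>"
  have zc: "z \<in> carrier G" using assms by (simp add: centralizer_def)
  obtain N where N: "open_normal N" "z \<notin> N" using open_normal_avoids[OF zc \<open>z \<noteq> \<one>\<close>] by blast
  obtain H where H: "open_normal H" "H \<subseteq> N \<inter> H0" "idx H \<ge> 5 / \<rho>"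
    using exists_deep_open_normal[of "N \<inter> H0" "5 / \<rho>"] open_normal_Int[OF N(1) H0]
      open_normal_imp_open_subgroup by blast
  note Ho = open_normal_imp_open_subgroup[OF H(1)]
  have "z \<otimes> y \<otimes> inv z = y" if "y \<in> H" for y
  proof -
    have "z \<otimes> y = y \<otimes> z" using assms H that by (auto simp: centralizer_def)
    then show ?thesis using zc open_subgroupD(5)[OF Ho that] by (simp add: m_assoc)
  qed
  then have "fixed_characters H z = characters H" by (auto simp: fixed_characters_def)
  then have "p powr (\<rho> * idx H) \<le> p powr (1 + 3 / 4 * \<rho> * idx H)"
    using card_fixed_characters_in_H0[OF H(1) _ assms(2)] card_lower[OF Ho] H N by fastforce
  then have "\<rho> * idx H \<le> 1 + 3 / 4 * \<rho> * idx H" using p_gt_1 by (simp add: powr_le_cancel_iff)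
  moreover have "\<rho> * idx H \<ge> 5" using H(3) \<rho>_pos by (simp add: field_simps)
  ultimately show False by simp
qed

lemma card_fixed_characters_conj:
  assumes H: "open_normal H" and g: "g \<in> carrier G" and h: "h \<in> carrier G"
  shows "card (fixed_characters H g) \<le> card (fixed_characters H (h \<otimes> g \<otimes> inv h))"
proof (rule card_inj_on_le)
  note Ho = open_normal_imp_open_subgroup[OF H]
  note Hs = open_subgroupD[OF Ho]
  let ?F = "conj_char H (inv h)"
  have ih: "inv h \<in> carrier G" using h by simp
  show "inj_on ?F (fixed_characters H g)"
    using inj_on_subset[OF inj_on_conj_char[OF H ih]] by (auto simp: fixed_characters_def)
  show "?F ` fixed_characters H g \<subseteq> fixed_characters H (h \<otimes> g \<otimes> inv h)"
  proof (rule image_subsetI)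
    fix \<phi> assume \<phi>: "\<phi> \<in> fixed_characters H g"
    have "?F \<phi> \<in> characters H"
      using \<phi> open_normal_conj[OF H ih] ih Ho by (auto simp: fixed_characters_def intro!: conj_char_in_characters)
    moreover have "?F \<phi> ((h \<otimes> g \<otimes> inv h) \<otimes> y \<otimes> inv (h \<otimes> g \<otimes> inv h)) = ?F \<phi> y" if y: "y \<in> H" for y
    proof -
      let ?z = "inv h \<otimes> y \<otimes> inv (inv h)"
      have z: "?z \<in> H" using open_normal_conj[OF H ih y] .
      have e: "inv h \<otimes> ((h \<otimes> g \<otimes> inv h) \<otimes> y \<otimes> inv (h \<otimes> g \<otimes> inv h)) \<otimes> inv (inv h) = g \<otimes> ?z \<otimes> inv g"
        using g h Hs(5)[OF y] by (simp add: word_simps)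
      have "(h \<otimes> g \<otimes> inv h) \<otimes> y \<otimes> inv (h \<otimes> g \<otimes> inv h) \<in> H" using g h y by (intro open_normal_conj[OF H]) auto
      then have "?F \<phi> ((h \<otimes> g \<otimes> inv h) \<otimes> y \<otimes> inv (h \<otimes> g \<otimes> inv h)) = \<phi> (g \<otimes> ?z \<otimes> inv g)"
        unfolding conj_char_def e by (simp only: if_True)
      also have "\<dots> = \<phi> ?z" using \<phi> z unfolding fixed_characters_def by blast
      also have "\<dots> = ?F \<phi> y" unfolding conj_char_def using y by (simp only: if_True)
      finally show ?thesis .
    qed
    ultimately show "?F \<phi> \<in> fixed_characters H (h \<otimes> g \<otimes> inv h)" by (simp add: fixed_characters_def)
  qed
  show "finite (fixed_characters H (h \<otimes> g \<otimes> inv h))"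
    using finite_characters[OF Ho] by (simp add: fixed_characters_def)
qed

lemma fixed_characters_divide:
  assumes "open_subgroup H" "\<phi> \<in> fixed_characters H g" "\<psi> \<in> fixed_characters H g"
  shows "(\<lambda>x. \<phi> x / \<psi> x) \<in> fixed_characters H g"
  using assms character_divide by (simp add: fixed_characters_def)

text \<open>If \<open>g\<close> does not commute with \<open>h \<in> H0\<close>, then \<open>t = g \<otimes> inv (h \<otimes> g \<otimes> inv h)\<close> is a nontrivial element of \<open>H0\<close>, and
  every character fixed by \<open>g\<close> and by its conjugate is fixed by \<open>t\<close>.  Two subgroups of equal size
  with a small intersection must be small.\<close>

lemma card_fixed_characters_noncentral:
  assumes g: "g \<in> carrier G" "g \<notin> centralizer"
  shows "\<exists>V. open_subgroup V \<and> (\<forall>H. open_normal H \<and> H \<subseteq> V \<longrightarrow>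
    card (fixed_characters H g) ^ 2 \<le> p powr (1 + 3 / 4 * \<rho> * idx H) * card (characters H))"
proof -
  obtain h where h: "h \<in> H0" "g \<otimes> h \<noteq> h \<otimes> g" using g by (auto simp: centralizer_def)
  note H0s = open_subgroupD[OF open_normal_imp_open_subgroup[OF H0]]
  have hc: "h \<in> carrier G" using h H0s by blast
  define u where "u = h \<otimes> g \<otimes> inv h"
  define t where "t = g \<otimes> inv u"
  have uc: "u \<in> carrier G" and tc: "t \<in> carrier G" using g hc by (auto simp: u_def t_def)
  have t': "t = (g \<otimes> h \<otimes> inv g) \<otimes> inv h" using g hc by (simp add: t_def u_def word_simps)
  have tH0: "t \<in> H0" unfolding t' using open_normal_conj[OF H0 g(1) h(1)] H0s(6,7) h by blast
  have "t \<noteq> \<one>"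
  proof
    assume "t = \<one>"
    then have "t \<otimes> h \<otimes> g = h \<otimes> g" using g hc by simp
    then show False using h g hc by (simp add: t' m_assoc)
  qed
  then obtain N where N: "open_normal N" "t \<notin> N" using open_normal_avoids[OF tc] by blast
  show ?thesis
  proof (intro exI[of _ "N \<inter> H0"] conjI allI impI)
    show "open_subgroup (N \<inter> H0)"
      using open_normal_Int[OF N(1) H0] open_normal_imp_open_subgroup by blast
    fix H assume "open_normal H \<and> H \<subseteq> N \<inter> H0"
    then have H: "open_normal H" "H \<subseteq> H0" "t \<notin> H" using N by auto
    note Ho = open_normal_imp_open_subgroup[OF H(1)]
    have sub: "fixed_characters H g \<inter> fixed_characters H u \<subseteq> fixed_characters H t"
    proof
      fix \<phi> assume \<phi>: "\<phi> \<in> fixed_characters H g \<inter> fixed_characters H u"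
      have S: "subgroup (stabilizer_of_char H \<phi>) G"
        using subgroup_stabilizer_of_char[OF open_subgroupD(3)[OF Ho]] .
      have gS: "g \<in> stabilizer_of_char H \<phi>" "u \<in> stabilizer_of_char H \<phi>"
        using fixed_characters_stabilizer[OF H(1)] g uc \<phi> by auto
      then have "t \<in> stabilizer_of_char H \<phi>"
        unfolding t_def using subgroup.m_closed[OF S] subgroup.m_inv_closed[OF S] by blast
      then show "\<phi> \<in> fixed_characters H t"
        using \<phi> by (simp add: fixed_characters_def stabilizer_of_char_def)
    qed
    have fc: "fixed_characters H x \<subseteq> characters H" for x by (auto simp: fixed_characters_def)
    have "card (fixed_characters H g) * card (fixed_characters H g)
        \<le> card (fixed_characters H g) * card (fixed_characters H u)"
      using card_fixed_characters_conj[OF H(1) g(1) hc] by (simp add: u_def)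
    also have "\<dots> \<le> card (fixed_characters H g \<inter> fixed_characters H u) * card (characters H)"
      by (intro card_mult_le_card_Int[OF Ho finite_characters[OF Ho]] fc fixed_characters_divide[OF Ho])
    also have "\<dots> \<le> card (fixed_characters H t) * card (characters H)"
      using finite_subset[OF fc finite_characters[OF Ho]] by (intro mult_right_mono card_mono sub) auto
    finally have "real (card (fixed_characters H g) ^ 2) \<le> real (card (fixed_characters H t)) * card (characters H)"
      by (simp add: power2_eq_square flip: of_nat_mult)
    also have "\<dots> \<le> p powr (1 + 3 / 4 * \<rho> * idx H) * card (characters H)"
      using card_fixed_characters_in_H0[OF H(1,2) tH0 H(3)] by (intro mult_right_mono) auto
    finally show "card (fixed_characters H g) ^ 2 \<le> p powr (1 + 3 / 4 * \<rho> * idx H) * card (characters H)"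
      by simp
  qed
qed

end

section \<open>Iterated kernels of characters\<close>

lemma root_of_unity_prime_power_eq_1:
  fixes z :: complex
  assumes "prime p" "z ^ p = 1" "i < p" "j < p" "i \<noteq> j" "z ^ i = z ^ j"
  shows "z = 1"
  using root_of_unity_prime_power(1)[OF assms(1,2)] inj_onD[of "\<lambda>i. z ^ i" "{..<p}" i j] assms
  by auto

text \<open>Exponents matter modulo \<open>p\<close>, and raising to the \<open>p\<close>-th power is the identity modulo \<open>p\<close> by Fermat.\<close>

lemma root_of_unity_frobenius:
  fixes z :: complex
  assumes p: "prime p" and z: "z ^ p = 1"
  shows "z ^ (i ^ p ^ e) = z ^ i"
proof -
  have cong: "z ^ a = z ^ b" if "[a = b] (mod p)" for a b
  proof -
    have "z ^ c = z ^ (c mod p)" for c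
    proof -
      have "z ^ c = z ^ (p * (c div p) + c mod p)" by simp
      also have "\<dots> = z ^ (c mod p)" using z by (simp only: power_add power_mult) simp
      finally show ?thesis .
    qed
    then show ?thesis using that unfolding cong_def by metis
  qed
  have step: "[i ^ p = i] (mod p)" for i :: nat
  proof (cases "p dvd i")
    case True
    then have "p dvd i ^ p" using dvd_power[of p i] prime_gt_0_nat[OF p] dvd_trans by blast
    then show ?thesis using True by (simp add: cong_def mod_eq_0_iff_dvd)
  next
    case False
    have "[i * i ^ (p - 1) = i * 1] (mod p)" using fermat_theorem[OF p False] by (rule cong_scalar_left)
    moreover have "i * i ^ (p - 1) = i ^ p" using prime_gt_0_nat[OF p] by (cases p) auto
    ultimately show ?thesis by simp
  qed
  have "[i ^ p ^ e = i] (mod p)"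
  proof (induction e)
    case (Suc e)
    have "i ^ p ^ Suc e = (i ^ p ^ e) ^ p" by (simp add: power_mult mult.commute[of p])
    then show ?case using Suc step[of "i ^ p ^ e"] cong_trans by metis
  qed simp
  then show ?thesis by (rule cong)
qed

context pro_p_group begin

lemma prime_power_in_open_normal:
  assumes H: "open_normal H" and h: "h \<in> carrier G"
  shows "\<exists>e. h [^] (p ^ e :: nat) \<in> H"
proof -
  interpret H: normal H G using H by (simp add: open_normal_def)
  obtain e where e: "order (G Mod H) = p ^ e"
    using index_p_power H by (auto simp: open_normal_def)
  interpret Q: group "G Mod H" by (rule H.factorgroup_is_group)
  have pow: "(H #> h) [^]\<^bsub>G Mod H\<^esub> n = H #> (h [^] n)" for n :: nat
  proof (induction n)
    case 0
    then show ?case by (simp add: FactGroup_def H.subset)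
  next
    case (Suc n)
    then show ?case using h by (simp add: FactGroup_def H.rcos_sum)
  qed
  have "H #> h \<in> carrier (G Mod H)" using h by (auto simp: FactGroup_def intro: rcosetsI H.subset)
  then have "(H #> h) [^]\<^bsub>G Mod H\<^esub> (p ^ e) = \<one>\<^bsub>G Mod H\<^esub>" using Q.pow_order_eq_1 e by simp
  then have "H #> (h [^] (p ^ e)) = H" using pow by (simp add: FactGroup_def)
  then show ?thesis using coset_join1[OF _ _ H.is_subgroup] h by blast
qed

text \<open>If the conjugation \<open>\<tau>\<close> by \<open>h\<close> satisfies \<open>f^i = \<tau>(f)^j\<close>, then \<open>f\<close> is an eigenvector of \<open>\<tau>\<close> on the vector space
  of characters over the field with \<open>p\<close> elements.  As \<open>\<tau>\<close> has \<open>p\<close>-power order, its only eigenvalue is \<open>1\<close>.\<close>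

lemma twisted_power_kernel:
  assumes H: "open_normal H" and h: "h \<in> carrier G" and f: "f \<in> characters H"
    and ij: "i < p" "j < p" "(i, j) \<noteq> (0, 0)"
    and eq: "\<And>y. y \<in> H \<Longrightarrow> f y ^ i = f (h \<otimes> y \<otimes> inv h) ^ j"
  shows "f \<in> fixed_characters H h"
proof -
  note Ho = open_normal_imp_open_subgroup[OF H]
  have conj: "h \<otimes> y \<otimes> inv h \<in> H" if "y \<in> H" for y using open_normal_conj[OF H h that] .
  have conj': "inv h \<otimes> y \<otimes> h \<in> H" if "y \<in> H" for y using open_normal_conj'[OF H h that] .
  have root: "u = 1" if "u ^ p = 1" "i' < p" "j' < p" "i' \<noteq> j'" "u ^ i' = u ^ j'" for u :: complex and i' j'
    using root_of_unity_prime_power_eq_1[OF prime_p that] .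
  note fp = charactersD(2)[OF f]
  have p0: "0 < p" using prime_gt_0_nat[OF prime_p] .
  have "f (h \<otimes> y \<otimes> inv h) = f y" if y: "y \<in> H" for y
  proof (cases "i = j")
    case True
    let ?u = "f (h \<otimes> y \<otimes> inv h) / f y"
    have "?u ^ i = ?u ^ 0" using eq[OF y] True charactersD(4)[OF f] by (simp add: power_divide)
    then have "?u = 1" using root[of ?u i 0] ij True fp p0 by (auto simp: power_divide)
    then show ?thesis using charactersD(4)[OF f, of y] by simp
  next
    case False
    obtain e where e: "h [^] (p ^ e :: nat) \<in> H" using prime_power_in_open_normal[OF H h] by blast
    have it: "h [^] n \<otimes> y \<otimes> inv (h [^] n) \<in> H \<and>
        f y ^ (i ^ n) = f (h [^] n \<otimes> y \<otimes> inv (h [^] n)) ^ (j ^ n)" if "y \<in> H" for n :: nat and y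
    proof (induction n)
      case 0
      then show ?case using that open_subgroupD(5)[OF Ho that] by simp
    next
      case (Suc n)
      let ?z = "h [^] n \<otimes> y \<otimes> inv (h [^] n)"
      have hn: "h [^] Suc n = h \<otimes> h [^] n" using nat_pow_Suc2[OF h] .
      have zc: "h [^] Suc n \<otimes> y \<otimes> inv (h [^] Suc n) = h \<otimes> ?z \<otimes> inv h"
        unfolding hn using h open_subgroupD(5)[OF Ho that] by (simp add: word_simps)
      have z: "?z \<in> H" using Suc by blast
      have "f y ^ (i ^ Suc n) = (f y ^ (i ^ n)) ^ i" by (simp add: power_mult[symmetric] mult.commute)
      also have "\<dots> = (f ?z ^ i) ^ (j ^ n)" using Suc by (simp add: power_mult[symmetric] mult.commute)
      also have "\<dots> = f (h \<otimes> ?z \<otimes> inv h) ^ (j ^ Suc n)"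
        unfolding eq[OF z] by (simp add: power_mult[symmetric])
      finally show ?case unfolding zc using conj[OF z] by simp
    qed
    have f1: "f y = 1" if y: "y \<in> H" for y
    proof -
      have "f y ^ (i ^ (p ^ e)) = f y ^ (j ^ (p ^ e))"
        using it[OF y, of "p ^ e"] character_conj_inside[OF f Ho e y] by simp
      then have "f y ^ i = f y ^ j"
        using root_of_unity_frobenius[OF prime_p fp] by simp
      then show ?thesis using root[OF fp ij(1,2) False] by blast
    qed
    show ?thesis using f1[OF y] f1[OF conj[OF y]] by simp
  qed
  then show ?thesis using f by (simp add: fixed_characters_def)
qed

text \<open>\<open>L\<close> is cut out of \<open>H\<close> by successive characters, and each element of the list witnesses that the corresponding step is proper;
  so \<open>H\<close> is generated by \<open>L\<close> and the list, and \<open>H / L\<close> is elementary abelian of rank the length of the list.\<close>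

inductive kernel_chain :: "'a set \<Rightarrow> 'a set \<Rightarrow> 'a list \<Rightarrow> bool" for H where
  kernel_chain_Nil: "kernel_chain H H []"
| kernel_chain_Cons: "kernel_chain H L xs \<Longrightarrow> f \<in> characters H \<Longrightarrow> x \<in> L \<Longrightarrow> f x \<noteq> 1
    \<Longrightarrow> kernel_chain H {y \<in> L. f y = 1} (x # xs)"

lemma kernel_chain_open:
  assumes "kernel_chain H L xs" "open_subgroup H"
  shows "open_subgroup L \<and> L \<subseteq> H \<and> set xs \<subseteq> H"
  using assms
proof (induction rule: kernel_chain.induct)
  case (kernel_chain_Cons L xs f x)
  have "{y \<in> L. f y = 1} = L \<inter> {y \<in> H. f y = 1}" using kernel_chain_Cons by auto
  then show ?case
    using kernel_chain_Cons open_subgroup_Int[OF _ open_subgroup_kernel] by auto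
qed auto

lemma kernel_chain_contains_common_kernel:
  assumes "kernel_chain H L xs" "y \<in> H" "\<forall>\<psi>\<in>characters H. \<psi> y = 1"
  shows "y \<in> L"
  using assms by (induction rule: kernel_chain.induct) auto

lemma kernel_chain_conj:
  assumes "kernel_chain H L xs" "open_subgroup H" "x \<in> H" "y \<in> L"
  shows "x \<otimes> y \<otimes> inv x \<in> L"
  using assms
proof (induction arbitrary: y rule: kernel_chain.induct)
  case (kernel_chain_Cons L xs f z)
  then have "y \<in> H" using kernel_chain_open by blast
  then show ?case using kernel_chain_Cons character_conj_inside[of f H x y] by auto
qed (auto intro: open_subgroupD)

text \<open>The image of \<open>f\<close> has prime order, so every element of \<open>L\<close> is a power of \<open>x\<close> times an element of the kernel.\<close>

lemma subgroup_of_kernel_and_element: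
  assumes L: "open_subgroup L" "L \<subseteq> H" and fH: "f \<in> characters H" and x: "x \<in> L" "f x \<noteq> 1"
    and Z: "subgroup Z G" "x \<in> Z" "{y \<in> L. f y = 1} \<subseteq> Z"
  shows "L \<subseteq> Z"
proof
  fix y assume y: "y \<in> L"
  note Ls = open_subgroupD[OF L(1)]
  have f: "\<And>y z. y \<in> L \<Longrightarrow> z \<in> L \<Longrightarrow> f (y \<otimes> z) = f y * f z" "\<And>y. y \<in> L \<Longrightarrow> f y ^ p = 1"
    using L(2) charactersD[OF fH] by (simp_all add: subset_iff)
  have pw: "x [^] i \<in> L \<and> f (x [^] i) = f x ^ i" for i :: nat
  proof (induction i)
    case 0
    have "f \<one> = f \<one> * f \<one>" using f(1)[of \<one> \<one>] Ls by simp
    moreover have "f \<one> \<noteq> 0" using f(2)[of \<one>] Ls prime_gt_0_nat[OF prime_p] by (auto simp: power_0_left)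
    ultimately show ?case using Ls by simp
  next
    case (Suc i)
    then show ?case using f(1)[of "x [^] i" x] x Ls by simp
  qed
  obtain i where i: "f y = f x ^ i"
    using root_of_unity_prime_power(2)[OF prime_p f(2)[OF x(1)] x(2) f(2)[OF y]] by blast
  let ?z = "inv (x [^] i) \<otimes> y"
  have z: "?z \<in> L" using pw y Ls by blast
  have y': "x [^] i \<otimes> ?z = y" using x y Ls(5) by simp
  have "f y = f (x [^] i) * f ?z" using f(1)[of "x [^] i" ?z] pw[of i] z unfolding y' by blast
  moreover have "f y \<noteq> 0" using f(2)[OF y] prime_gt_0_nat[OF prime_p] by (auto simp: power_0_left)
  moreover have "f (x [^] i) = f y" using pw[of i] i by simp
  ultimately have "f ?z = 1" by simp
  then have "?z \<in> Z" using Z(3) z by blast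
  moreover have "x [^] i \<in> Z" using subgroup_int_pow_closed[OF Z(1,2), of "int i"] by (simp add: int_pow_int)
  ultimately have "x [^] i \<otimes> ?z \<in> Z" by (rule subgroup.m_closed[OF Z(1), rotated])
  then show "y \<in> Z" unfolding y' .
qed

lemma kernel_chain_generates:
  assumes "kernel_chain H L xs" "open_subgroup H" "subgroup Z G" "L \<subseteq> Z" "set xs \<subseteq> Z"
  shows "H \<subseteq> Z"
  using assms
proof (induction rule: kernel_chain.induct)
  case (kernel_chain_Cons L xs f x)
  have L: "open_subgroup L" "L \<subseteq> H" using kernel_chain_open[OF kernel_chain_Cons(1,6)] by auto
  have "L \<subseteq> Z"
    by (rule subgroup_of_kernel_and_element[OF L kernel_chain_Cons(2,3,4,7)])
      (use kernel_chain_Cons in auto)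
  then show ?case using kernel_chain_Cons by auto
qed auto

lemma kernel_chain_index:
  assumes "kernel_chain H L xs" "open_subgroup H"
  shows "index_in (carrier G) L \<ge> index_in (carrier G) H * p ^ length xs"
  using assms
proof (induction rule: kernel_chain.induct)
  case (kernel_chain_Cons L xs f x)
  have L: "open_subgroup L" "L \<subseteq> H" using kernel_chain_open[OF kernel_chain_Cons(1,6)] by auto
  have L': "open_subgroup {y \<in> L. f y = 1}"
    using kernel_chain_open[OF kernel_chain.kernel_chain_Cons[OF kernel_chain_Cons(1-4)] kernel_chain_Cons(6)] by blast
  have "{y \<in> L. f y = 1} \<noteq> L" using kernel_chain_Cons(3,4) by blast
  then have ge: "p \<le> index_in L {y \<in> L. f y = 1}" using index_in_ge_prime(2)[OF L' L(1)] by auto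
  have "index_in (carrier G) H * p ^ length (x # xs) = (index_in (carrier G) H * p ^ length xs) * p" by simp
  also have "\<dots> \<le> index_in (carrier G) L * index_in L {y \<in> L. f y = 1}"
    using kernel_chain_Cons(5)[OF kernel_chain_Cons(6)] ge by (rule mult_le_mono)
  also have "\<dots> = index_in (carrier G) {y \<in> L. f y = 1}"
    using open_subgroupD(3)[OF L(1)] by (intro index_in_open_trans[symmetric] L' L open_subgroup_carrier) auto
  finally show ?case .
qed auto

definition annihilator :: "'a set \<Rightarrow> 'a set \<Rightarrow> ('a \<Rightarrow> complex) set" where
  "annihilator H L = {\<psi> \<in> characters H. \<forall>y\<in>L. \<psi> y = 1}"

text \<open>Duality for one step of a chain: a character that is trivial on the kernel of \<open>f\<close> on \<open>L\<close> agrees on \<open>L\<close> with a power of \<open>f\<close>.\<close>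

lemma annihilator_kernel:
  assumes H: "open_subgroup H" and L: "open_subgroup L" "L \<subseteq> H" and f: "f \<in> characters H"
    and \<psi>: "\<psi> \<in> annihilator H {y \<in> L. f y = 1}"
  shows "\<exists>i<p. \<exists>w\<in>annihilator H L. \<forall>y. \<psi> y = w y * f y ^ i"
proof -
  have p0: "0 < p" using prime_gt_0_nat[OF prime_p] .
  have \<psi>c: "\<psi> \<in> characters H" "\<And>y. y \<in> L \<Longrightarrow> f y = 1 \<Longrightarrow> \<psi> y = 1"
    using \<psi> by (auto simp: annihilator_def)
  show ?thesis
  proof (cases "\<exists>x\<in>L. f x \<noteq> 1")
    case False
    then have "\<psi> \<in> annihilator H L" using \<psi>c by (auto simp: annihilator_def)
    then show ?thesis using p0 by (intro exI[of _ 0]) auto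
  next
    case True
    then obtain x where x: "x \<in> L" "f x \<noteq> 1" by blast
    obtain i where i: "i < p" "\<psi> x = f x ^ i"
      using root_of_unity_prime_power(2)[OF prime_p charactersD(2)[OF f] x(2) charactersD(2)[OF \<psi>c(1)]] by blast
    define w where "w = (\<lambda>y. \<psi> y / f y ^ i)"
    have w: "w \<in> characters H"
      unfolding w_def using character_divide[OF \<psi>c(1) character_power[OF f H] H] .
    have "L \<subseteq> {y \<in> H. w y = 1}"
    proof (rule subgroup_of_kernel_and_element[OF L f x])
      show "subgroup {y \<in> H. w y = 1} G" using open_subgroupD(1)[OF open_subgroup_kernel[OF w H]] .
      show "x \<in> {y \<in> H. w y = 1}" using x L i charactersD(4)[OF f, of x] by (auto simp: w_def)
      show "{y \<in> L. f y = 1} \<subseteq> {y \<in> H. w y = 1}" using L \<psi>c by (auto simp: w_def)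
    qed
    then have "w \<in> annihilator H L" using w by (auto simp: annihilator_def)
    moreover have "\<psi> y = w y * f y ^ i" for y using charactersD(4)[OF f, of y] by (simp add: w_def)
    ultimately show ?thesis using i by blast
  qed
qed

lemma card_annihilator_kernel:
  assumes H: "open_subgroup H" and L: "open_subgroup L" "L \<subseteq> H" and f: "f \<in> characters H"
    and fin: "finite (characters H)"
  shows "card (annihilator H {y \<in> L. f y = 1}) \<le> p * card (annihilator H L)"
proof -
  have finA: "finite (annihilator H L)" using fin by (simp add: annihilator_def)
  have "annihilator H {y \<in> L. f y = 1} \<subseteq> (\<lambda>(i, w) y. w y * f y ^ i) ` ({..<p} \<times> annihilator H L)"
  proof
    fix \<psi> assume "\<psi> \<in> annihilator H {y \<in> L. f y = 1}"
    then obtain i w where "i < p" "w \<in> annihilator H L" "\<forall>y. \<psi> y = w y * f y ^ i"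
      using annihilator_kernel[OF H L f] by blast
    then show "\<psi> \<in> (\<lambda>(i, w) y. w y * f y ^ i) ` ({..<p} \<times> annihilator H L)"
      by (intro image_eqI[of _ _ "(i, w)"]) auto
  qed
  then have "card (annihilator H {y \<in> L. f y = 1}) \<le> card ({..<p} \<times> annihilator H L)"
    using finA by (intro surj_card_le) auto
  then show ?thesis by (simp add: card_cartesian_product)
qed

lemma card_annihilator_kernel_chain:
  assumes "kernel_chain H L xs" "open_subgroup H" "finite (characters H)"
  shows "card (annihilator H L) \<le> p ^ length xs"
  using assms
proof (induction rule: kernel_chain.induct)
  case kernel_chain_Nil
  have "annihilator H H \<subseteq> {\<lambda>_. 1}"
    using charactersD(3) by (fastforce simp: annihilator_def fun_eq_iff)
  then show ?case using card_mono[of "{\<lambda>_::'a. 1::complex}" "annihilator H H"] by simp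
next
  case (kernel_chain_Cons L xs f x)
  have "card (annihilator H {y \<in> L. f y = 1}) \<le> p * card (annihilator H L)"
    using kernel_chain_open[OF kernel_chain_Cons(1,6)] kernel_chain_Cons
    by (intro card_annihilator_kernel) auto
  also have "\<dots> \<le> p * p ^ length xs" using kernel_chain_Cons by simp
  finally show ?case by simp
qed

definition invariant_characters :: "'a set \<Rightarrow> 'a set \<Rightarrow> ('a \<Rightarrow> complex) set" where
  "invariant_characters H L = {\<phi> \<in> characters L. H \<subseteq> stabilizer_of_char L \<phi>}"

lemma subset_stabilizer_of_charI:
  assumes "open_subgroup H" "kernel_chain H L xs" "\<phi> \<in> characters L" "Y \<subseteq> H"
    and "\<And>x y. x \<in> Y \<Longrightarrow> y \<in> L \<Longrightarrow> \<phi> (x \<otimes> y \<otimes> inv x) = \<phi> y"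
  shows "Y \<subseteq> stabilizer_of_char L \<phi>"
proof
  fix x assume x: "x \<in> Y"
  note Hs = open_subgroupD[OF assms(1)]
  have xH: "x \<in> H" using x assms by blast
  have "inv x \<otimes> y \<otimes> inv (inv x) \<in> L" if "y \<in> L" for y
    using kernel_chain_conj[OF assms(2,1) Hs(6)[OF xH] that] .
  then show "x \<in> stabilizer_of_char L \<phi>"
    using x xH assms Hs(5)[OF xH] kernel_chain_conj[OF assms(2,1) xH] by (simp add: stabilizer_of_char_def)
qed

lemma invariant_characters_divide:
  assumes "open_subgroup L" "\<phi> \<in> invariant_characters H L" "\<psi> \<in> invariant_characters H L"
  shows "(\<lambda>x. \<phi> x / \<psi> x) \<in> invariant_characters H L"
proof -
  have "H \<subseteq> stabilizer_of_char L (\<lambda>x. \<phi> x / \<psi> x)"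
  proof
    fix x assume "x \<in> H"
    then have "x \<in> stabilizer_of_char L \<phi>" "x \<in> stabilizer_of_char L \<psi>"
      using assms by (auto simp: invariant_characters_def)
    then show "x \<in> stabilizer_of_char L (\<lambda>x. \<phi> x / \<psi> x)" by (simp add: stabilizer_of_char_def)
  qed
  then show ?thesis using assms character_divide[OF _ _ assms(1)] by (simp add: invariant_characters_def)
qed

text \<open>For an open subgroup \<open>L\<close> of a pro-\<open>p\<close> group this is the Frattini subgroup of \<open>L\<close>.\<close>

definition common_kernel :: "'a set \<Rightarrow> 'a set" where
  "common_kernel L = {y \<in> L. \<forall>\<phi>\<in>characters L. \<phi> y = 1}"

lemma commutator_in_common_kernel:
  assumes L: "open_subgroup L" and x: "x \<in> L" and y: "y \<in> L"
  shows "x \<otimes> y \<otimes> inv x \<otimes> inv y \<in> common_kernel L"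
proof -
  note Ls = open_subgroupD[OF L]
  have "\<psi> (x \<otimes> y \<otimes> inv x \<otimes> inv y) = 1" if \<psi>: "\<psi> \<in> characters L" for \<psi>
  proof -
    have "\<psi> (x \<otimes> y \<otimes> inv x \<otimes> inv y) = \<psi> (x \<otimes> y \<otimes> inv x) * \<psi> (inv y)"
      using x y Ls by (intro charactersD(1)[OF \<psi>]) simp_all
    also have "\<dots> = 1"
      using character_conj_inside[OF \<psi> L x y] character_inv[OF \<psi> L y] charactersD(4)[OF \<psi>, of y] by simp
    finally show ?thesis .
  qed
  moreover have "x \<otimes> y \<otimes> inv x \<otimes> inv y \<in> L" using x y Ls by simp
  ultimately show ?thesis by (simp add: common_kernel_def)
qed

lemma commutator_in_kernel_chain:
  assumes "open_subgroup H" "kernel_chain H L xs" "x \<in> H" "y \<in> H"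
  shows "x \<otimes> y \<otimes> inv x \<otimes> inv y \<in> L"
  using commutator_in_common_kernel[OF assms(1,3,4)] kernel_chain_contains_common_kernel[OF assms(2)]
  by (simp add: common_kernel_def)

text \<open>The conditions on \<open>\<phi>\<close> say that \<open>\<phi>\<close> extends to \<open>L\<close> with value \<open>1\<close> at \<open>x\<close>, and that this extension takes the same value at
  \<open>x\<close> and at its conjugates by the generators \<open>xs\<close> of \<open>H\<close> modulo \<open>L\<close>; the extension is then invariant under \<open>H\<close>.\<close>

lemma extend_invariant_character:
  assumes H: "open_subgroup H" and ch: "kernel_chain H L xs" and f: "f \<in> characters H"
    and x: "x \<in> L" "f x \<noteq> 1"
    and \<phi>: "\<phi> \<in> invariant_characters H {y \<in> L. f y = 1}" "\<phi> (x [^] p) = 1"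
      "\<forall>t\<in>set xs. \<phi> (t \<otimes> x \<otimes> inv t \<otimes> inv x) = 1"
  shows "\<exists>\<psi>\<in>invariant_characters H L. \<forall>y\<in>{y \<in> L. f y = 1}. \<psi> y = \<phi> y"
proof -
  let ?L' = "{y \<in> L. f y = 1}"
  have L: "open_subgroup L" "L \<subseteq> H" "set xs \<subseteq> H" using kernel_chain_open[OF ch H] by auto
  note Hs = open_subgroupD[OF H]
  note Ls = open_subgroupD[OF L(1)]
  have ch': "kernel_chain H ?L' (x # xs)" using kernel_chain_Cons[OF ch f x] .
  have L': "open_subgroup ?L'" using kernel_chain_open[OF ch' H] by blast
  have \<phi>c: "\<phi> \<in> characters ?L'" "H \<subseteq> stabilizer_of_char ?L' \<phi>"
    using \<phi>(1) by (auto simp: invariant_characters_def)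
  have xc: "x \<in> carrier G" using x Ls by blast
  let ?Q = "generate G {x}"
  have Q: "subgroup ?Q G" using xc by (intro generate_is_subgroup) simp
  have QL: "?Q \<subseteq> L" using x Ls by (intro generate_subgroup_incl) auto
  have norm: "q \<otimes> y \<otimes> inv q \<in> ?L' \<and> \<phi> (q \<otimes> y \<otimes> inv q) = \<phi> y" if "q \<in> ?Q" "y \<in> ?L'" for q y
  proof -
    have "q \<in> stabilizer_of_char ?L' \<phi>" using that QL L \<phi>c by blast
    then show ?thesis using that(2) unfolding stabilizer_of_char_def by blast
  qed
  have powL: "f (x [^] n) = f x ^ n" for n :: nat
  proof (induction n)
    case 0
    then show ?case using character_one[OF f H] by simp
  next
    case (Suc n)
    have "x [^] n \<in> H" using subgroup_int_pow_closed[OF Hs(1), of x "int n"] x L by (auto simp: int_pow_int)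
    then show ?case using Suc charactersD(1)[OF f, of "x [^] n" x] x L by auto
  qed
  have "x [^] p \<in> L" using subgroup_int_pow_closed[OF Ls(1) x(1), of "int p"] by (simp add: int_pow_int)
  then have xp: "x [^] p \<in> ?L'" using powL[of p] charactersD(2)[OF f, of x] by simp
  have triv: "\<phi> q = 1" if q: "q \<in> ?Q" "q \<in> ?L'" for q
  proof -
    obtain a :: int where a: "q = x [^] a" using q xc by (auto simp: generate_pow)
    let ?b = "a div int p"
    have p0: "p > 0" using prime_gt_0_nat[OF prime_p] .
    have "a mod int p \<ge> 0" "a mod int p < int p" using p0 by auto
    then obtain r where r: "int r = a mod int p" "r < p" by (metis nonneg_int_cases of_nat_less_iff)
    have "q = x [^] (int p * ?b) \<otimes> x [^] (a mod int p)"
      using int_pow_mult[OF xc, of "int p * ?b" "a mod int p"] a by simp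
    also have "x [^] (int p * ?b) = (x [^] p) [^] ?b"
      using int_pow_pow[OF xc, of "int p" ?b] by (simp add: int_pow_int)
    also have "x [^] (a mod int p) = x [^] r" by (simp add: r(1)[symmetric] int_pow_int)
    finally have q': "q = (x [^] p) [^] ?b \<otimes> x [^] r" .
    have K: "subgroup {y \<in> ?L'. \<phi> y = 1} G" using open_subgroupD(1)[OF open_subgroup_kernel[OF \<phi>c(1) L']] .
    have xb: "(x [^] p) [^] ?b \<in> {y \<in> ?L'. \<phi> y = 1}"
      using subgroup_int_pow_closed[OF K, of "x [^] p" ?b] xp \<phi>(2) by blast
    have xrH: "x [^] r \<in> H" using subgroup_int_pow_closed[OF Hs(1), of x "int r"] x L by (auto simp: int_pow_int)
    have "f q = f ((x [^] p) [^] ?b) * f (x [^] r)"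
      unfolding q' using xb L xrH by (intro charactersD(1)[OF f]) auto
    then have "f x ^ r = f x ^ 0" using q xb powL by simp
    then have "r = 0"
      using root_of_unity_prime_power_eq_1[OF prime_p charactersD(2)[OF f] r(2) p0] x(2) by blast
    then have "q = (x [^] p) [^] ?b" using q' xc by simp
    then show ?thesis using xb by simp
  qed
  have K: "open_subgroup (?Q <#> ?L')" by (rule extend_character(1)[OF L' Q \<phi>c(1) norm triv])
  have KI: "q \<otimes> y \<in> ?Q <#> ?L'" if "q \<in> ?Q" "y \<in> ?L'" for q y using that by (auto simp: set_mult_def)
  have KL: "?Q <#> ?L' = L"
  proof
    show "?Q <#> ?L' \<subseteq> L" using QL Ls by (auto simp: set_mult_def)
    show "L \<subseteq> ?Q <#> ?L'"
    proof (rule subgroup_of_kernel_and_element[OF L(1,2) f x open_subgroupD(1)[OF K]])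
      show "x \<in> ?Q <#> ?L'" using KI[OF generate.incl open_subgroupD(4)[OF L'], of x] xc by simp
      show "?L' \<subseteq> ?Q <#> ?L'"
      proof
        fix y assume y: "y \<in> ?L'"
        show "y \<in> ?Q <#> ?L'"
          using KI[OF subgroup.one_closed[OF Q] y] open_subgroupD(5)[OF L' y] by simp
      qed
    qed
  qed
  obtain \<psi> where \<psi>: "\<psi> \<in> characters L" "\<And>y. y \<in> ?L' \<Longrightarrow> \<psi> y = \<phi> y" "\<And>q. q \<in> ?Q \<Longrightarrow> \<psi> q = 1"
    using extend_character(2)[OF L' Q \<phi>c(1) norm triv] unfolding KL by blast
  have S: "subgroup (stabilizer_of_char L \<psi>) G" using subgroup_stabilizer_of_char[OF Ls(3)] .
  have "H \<subseteq> stabilizer_of_char L \<psi>"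
  proof (rule kernel_chain_generates[OF ch H S])
    show "L \<subseteq> stabilizer_of_char L \<psi>"
      using character_conj_inside[OF \<psi>(1) L(1)] by (intro subset_stabilizer_of_charI[OF H ch \<psi>(1) L(2)]) auto
    show "set xs \<subseteq> stabilizer_of_char L \<psi>"
    proof (rule subset_stabilizer_of_charI[OF H ch \<psi>(1) L(3)])
      fix t y assume t: "t \<in> set xs" and y: "y \<in> L"
      have tH: "t \<in> H" using t L by blast
      have tc: "t \<in> carrier G" using Hs(5)[OF tH] .
      have conj: "t \<otimes> z \<otimes> inv t \<in> L" if "z \<in> L" for z using kernel_chain_conj[OF ch H tH that] .
      define \<theta> where "\<theta> = (\<lambda>z. conj_char L t \<psi> z / \<psi> z)"
      have \<theta>: "\<theta> \<in> characters L"
        unfolding \<theta>_def using conj_char_in_characters[OF \<psi>(1) L(1) tc conj] by (intro character_divide \<psi>(1) L(1))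
      have \<theta>_eq: "\<theta> z = \<psi> (t \<otimes> z \<otimes> inv t) / \<psi> z" if "z \<in> L" for z
        using that by (simp add: \<theta>_def conj_char_def)
      have "L \<subseteq> {z \<in> L. \<theta> z = 1}"
      proof (rule subgroup_of_kernel_and_element[OF L(1,2) f x])
        show "subgroup {z \<in> L. \<theta> z = 1} G" using open_subgroupD(1)[OF open_subgroup_kernel[OF \<theta> L(1)]] .
        have c: "t \<otimes> x \<otimes> inv t \<otimes> inv x \<in> ?L'" using commutator_in_kernel_chain[OF H ch' tH] x L by blast
        have "\<psi> (t \<otimes> x \<otimes> inv t) = \<psi> ((t \<otimes> x \<otimes> inv t \<otimes> inv x) \<otimes> x)"
          using tc xc by (simp add: m_assoc)
        also have "\<dots> = \<psi> (t \<otimes> x \<otimes> inv t \<otimes> inv x) * \<psi> x"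
          using c x by (intro charactersD(1)[OF \<psi>(1)]) auto
        also have "\<dots> = \<psi> x" using \<psi>(2)[OF c] \<phi>(3) t by simp
        finally show "x \<in> {z \<in> L. \<theta> z = 1}" using x \<theta>_eq charactersD(4)[OF \<psi>(1), of x] by simp
        show "?L' \<subseteq> {z \<in> L. \<theta> z = 1}"
        proof
          fix z assume z: "z \<in> ?L'"
          have "t \<in> stabilizer_of_char ?L' \<phi>" using tH \<phi>c by blast
          then have "t \<otimes> z \<otimes> inv t \<in> ?L'" "\<phi> (t \<otimes> z \<otimes> inv t) = \<phi> z"
            using z unfolding stabilizer_of_char_def by blast+
          then have "\<psi> (t \<otimes> z \<otimes> inv t) = \<psi> z" using \<psi>(2) z by metis
          then show "z \<in> {z \<in> L. \<theta> z = 1}" using z \<theta>_eq charactersD(4)[OF \<psi>(1), of z] by auto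
        qed
      qed
      then have "\<theta> y = 1" using y by blast
      then show "\<psi> (t \<otimes> y \<otimes> inv t) = \<psi> y" using \<theta>_eq[OF y] charactersD(4)[OF \<psi>(1), of y] by simp
    qed
  qed
  then have "\<psi> \<in> invariant_characters H L" using \<psi> by (simp add: invariant_characters_def)
  then show ?thesis using \<psi>(2) by blast
qed

text \<open>At a chain of length \<open>n\<close> the \<open>n + 1\<close> conditions of \<open>extend_invariant_character\<close> cost a factor of at most \<open>p ^ (n + 1)\<close>,
  and \<open>n ^ 2 + (n + 1) \<le> (n + 1) ^ 2\<close>.\<close>

lemma card_invariant_characters:
  assumes "kernel_chain H L xs" "open_subgroup H" and fin: "\<And>K. open_subgroup K \<Longrightarrow> finite (characters K)"
  shows "card (invariant_characters H L) \<le> p ^ (length xs ^ 2) * card (characters H)"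
  using assms(1,2)
proof (induction rule: kernel_chain.induct)
  case kernel_chain_Nil
  have "invariant_characters H H \<subseteq> characters H" by (auto simp: invariant_characters_def)
  then show ?case using card_mono fin[OF kernel_chain_Nil] by auto
next
  case (kernel_chain_Cons L xs f x)
  note H = kernel_chain_Cons(6)
  let ?L' = "{y \<in> L. f y = 1}" and ?M = "{z::complex. z ^ p = 1}" and ?n = "length xs"
  have p0: "p > 0" using prime_gt_0_nat[OF prime_p] .
  have finM: "finite ?M" "card ?M = p" using p0 by (auto simp: finite_roots_unity card_roots_unity_eq)
  have L: "open_subgroup L" "L \<subseteq> H" using kernel_chain_open[OF kernel_chain_Cons(1) H] by auto
  have ch': "kernel_chain H ?L' (x # xs)" using kernel_chain.kernel_chain_Cons[OF kernel_chain_Cons(1-4)] .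
  have L': "open_subgroup ?L'" using kernel_chain_open[OF ch' H] by blast
  let ?A = "invariant_characters H ?L'"
  let ?F = "\<lambda>\<phi>. (\<phi> (x [^] p), map (\<lambda>t. \<phi> (t \<otimes> x \<otimes> inv t \<otimes> inv x)) xs) :: complex \<times> complex list"
  let ?D = "{\<phi> \<in> ?A. \<phi> (x [^] p) = 1 \<and> (\<forall>t\<in>set xs. \<phi> (t \<otimes> x \<otimes> inv t \<otimes> inv x) = 1)}"
  have Ac: "?A \<subseteq> characters ?L'" by (auto simp: invariant_characters_def)
  have finA: "finite ?A" using finite_subset[OF Ac fin[OF L']] .
  have finE: "finite (invariant_characters H L)"
    using finite_subset[OF _ fin[OF L(1)]] by (auto simp: invariant_characters_def)
  have "card ?A \<le> card ?D * card (?F ` ?A)"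
  proof (rule card_characters_le_quotient[OF finA _ Ac])
    show "finite ?D" using finA by simp
    fix \<phi> \<psi> assume a: "\<phi> \<in> ?A" "\<psi> \<in> ?A" "?F \<phi> = ?F \<psi>"
    have nz: "\<psi> z \<noteq> 0" for z using a Ac charactersD(4) by blast
    have "(\<lambda>x. \<phi> x / \<psi> x) \<in> ?A" using invariant_characters_divide[OF L' a(1,2)] .
    then show "(\<lambda>x. \<phi> x / \<psi> x) \<in> ?D" using a(3) nz by auto
  qed
  also have "\<dots> \<le> card (invariant_characters H L) * (p * p ^ ?n)"
  proof (rule mult_le_mono)
    show "card ?D \<le> card (invariant_characters H L)"
    proof (rule card_le_characters_of_extendable[OF L' L(1) _ finE])
      fix \<phi> assume "\<phi> \<in> ?D"
      then show "\<exists>\<psi>\<in>invariant_characters H L. \<forall>y\<in>?L'. \<psi> y = \<phi> y"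
        using extend_invariant_character[OF H kernel_chain_Cons(1-4)] by blast
    qed (use Ac in \<open>auto simp: invariant_characters_def\<close>)
    have "?F ` ?A \<subseteq> ?M \<times> {l. set l \<subseteq> ?M \<and> length l = ?n}"
      using charactersD(2)[OF subsetD[OF Ac]] by auto
    then have "card (?F ` ?A) \<le> card (?M \<times> {l. set l \<subseteq> ?M \<and> length l = ?n})"
      by (rule card_mono[OF finite_cartesian_product[OF finM(1) finite_lists_length_eq[OF finM(1)]]])
    then show "card (?F ` ?A) \<le> p * p ^ ?n"
      using finM by (simp add: card_cartesian_product card_lists_length_eq)
  qed
  also have "\<dots> \<le> (p ^ (?n ^ 2) * card (characters H)) * (p * p ^ ?n)"
    using kernel_chain_Cons(5)[OF H] by (intro mult_right_mono) auto
  also have "\<dots> = p ^ (?n ^ 2 + ?n + 1) * card (characters H)" by (simp add: power_add)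
  also have "\<dots> \<le> p ^ (length (x # xs) ^ 2) * card (characters H)"
    using p0 by (intro mult_right_mono power_increasing) (auto simp: power2_eq_square)
  finally show ?case .
qed

section \<open>Characters killed by iterated commutators\<close>

text \<open>In the end these elements are forced into the Frattini subgroup of \<open>L\<close>; the recursion along the list is the one by which
  characters are counted in \<open>card_characters_trivial_on_conj_kernel\<close>.\<close>

fun conj_kernel :: "'a set \<Rightarrow> 'a set \<Rightarrow> 'a list \<Rightarrow> 'a set" where
  "conj_kernel H L [] = common_kernel H"
| "conj_kernel H L (h # hs) = {y \<in> conj_kernel H L hs. h \<otimes> y \<otimes> inv h \<in> common_kernel L}"

lemma subgroup_common_kernel:
  assumes "open_subgroup L"
  shows "subgroup (common_kernel L) G"
  using open_subgroupD[OF assms]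
  by (intro subgroupI)
    (auto simp: common_kernel_def character_one[OF _ assms] character_inv[OF _ assms] charactersD(1)
      intro!: exI[of _ \<one>])

lemma common_kernel_conj:
  assumes L: "open_subgroup L" and x: "x \<in> carrier G" "\<And>y. y \<in> L \<Longrightarrow> x \<otimes> y \<otimes> inv x \<in> L"
    and y: "y \<in> common_kernel L"
  shows "x \<otimes> y \<otimes> inv x \<in> common_kernel L"
proof -
  have yL: "y \<in> L" "\<And>\<phi>. \<phi> \<in> characters L \<Longrightarrow> \<phi> y = 1" using y by (auto simp: common_kernel_def)
  have "\<phi> (x \<otimes> y \<otimes> inv x) = 1" if "\<phi> \<in> characters L" for \<phi>
    using yL(2)[OF conj_char_in_characters[OF that L x]] yL(1) by (simp add: conj_char_def)
  then show ?thesis using x(2)[OF yL(1)] by (simp add: common_kernel_def)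
qed

lemma conj_kernel_subset:
  assumes "kernel_chain H L xs"
  shows "conj_kernel H L hs \<subseteq> common_kernel H" "conj_kernel H L hs \<subseteq> L"
proof -
  show 1: "conj_kernel H L hs \<subseteq> common_kernel H" by (induction hs) auto
  have "common_kernel H \<subseteq> L"
    using kernel_chain_contains_common_kernel[OF assms] by (auto simp: common_kernel_def)
  then show "conj_kernel H L hs \<subseteq> L" using 1 by blast
qed

lemma conj_kernel_normal:
  assumes H: "open_normal H" and ch: "kernel_chain H L xs" and hs: "set hs \<subseteq> carrier G"
  shows "subgroup (conj_kernel H L hs) G \<and>
    (\<forall>x\<in>H. \<forall>y\<in>conj_kernel H L hs. x \<otimes> y \<otimes> inv x \<in> conj_kernel H L hs)"
  using hs
proof (induction hs)
  case Nil
  note Ho = open_normal_imp_open_subgroup[OF H]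
  have "x \<otimes> y \<otimes> inv x \<in> common_kernel H" if "x \<in> H" "y \<in> common_kernel H" for x y
    using common_kernel_conj[OF Ho _ open_normal_conj[OF H]] that open_subgroupD(5)[OF Ho] by blast
  then show ?case using subgroup_common_kernel[OF Ho] by simp
next
  case (Cons h hs)
  note Ho = open_normal_imp_open_subgroup[OF H]
  have L: "open_subgroup L" "L \<subseteq> H" using kernel_chain_open[OF ch Ho] by auto
  let ?P = "conj_kernel H L hs"
  have P: "subgroup ?P G" "\<And>x y. x \<in> H \<Longrightarrow> y \<in> ?P \<Longrightarrow> x \<otimes> y \<otimes> inv x \<in> ?P" using Cons by auto
  have h: "h \<in> carrier G" using Cons by simp
  have Pc: "y \<in> carrier G" if "y \<in> ?P" for y using subgroup.mem_carrier[OF P(1) that] .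
  note C = subgroup_common_kernel[OF L(1)]
  have "subgroup (conj_kernel H L (h # hs)) G"
  proof (rule subgroupI)
    have "\<one> \<in> conj_kernel H L (h # hs)"
      using h subgroup.one_closed[OF P(1)] subgroup.one_closed[OF C] by simp
    then show "conj_kernel H L (h # hs) \<noteq> {}" by blast
    show "conj_kernel H L (h # hs) \<subseteq> carrier G" using Pc by auto
    fix a assume a: "a \<in> conj_kernel H L (h # hs)"
    have "inv (h \<otimes> a \<otimes> inv h) = h \<otimes> inv a \<otimes> inv h" using h a Pc by (simp add: word_simps)
    then show "inv a \<in> conj_kernel H L (h # hs)"
      using a subgroup.m_inv_closed[OF P(1), of a] subgroup.m_inv_closed[OF C, of "h \<otimes> a \<otimes> inv h"] by simp
    fix b assume b: "b \<in> conj_kernel H L (h # hs)"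
    have "(h \<otimes> a \<otimes> inv h) \<otimes> (h \<otimes> b \<otimes> inv h) = h \<otimes> (a \<otimes> b) \<otimes> inv h"
      using h a b Pc by (simp add: word_simps)
    then show "a \<otimes> b \<in> conj_kernel H L (h # hs)"
      using a b subgroup.m_closed[OF P(1), of a b]
        subgroup.m_closed[OF C, of "h \<otimes> a \<otimes> inv h" "h \<otimes> b \<otimes> inv h"] by simp
  qed
  moreover have "x \<otimes> y \<otimes> inv x \<in> conj_kernel H L (h # hs)"
    if x: "x \<in> H" and y: "y \<in> conj_kernel H L (h # hs)" for x y
  proof -
    let ?x = "h \<otimes> x \<otimes> inv h"
    have xH: "?x \<in> H" using open_normal_conj[OF H h x] .
    have yP: "y \<in> ?P" "h \<otimes> y \<otimes> inv h \<in> common_kernel L" using y by auto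
    have "?x \<otimes> (h \<otimes> y \<otimes> inv h) \<otimes> inv ?x \<in> common_kernel L"
      by (rule common_kernel_conj[OF L(1) open_subgroupD(5)[OF Ho xH] kernel_chain_conj[OF ch Ho xH] yP(2)])
    moreover have "?x \<otimes> (h \<otimes> y \<otimes> inv h) \<otimes> inv ?x = h \<otimes> (x \<otimes> y \<otimes> inv x) \<otimes> inv h"
      using h Pc[OF yP(1)] open_subgroupD(5)[OF Ho x] by (simp add: word_simps)
    ultimately have "h \<otimes> (x \<otimes> y \<otimes> inv x) \<otimes> inv h \<in> common_kernel L" by (simp only:)
    then show ?thesis using P(2)[OF x yP(1)] by simp
  qed
  ultimately show ?case by blast
qed

text \<open>Induction along the list, from larger to smaller kernels.  Let \<open>\<phi>\<close> be trivial on the kernel belonging to \<open>h # hs\<close>.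
  An element \<open>x \<in> H\<close> acts on \<open>\<phi>\<close> like some \<open>z\<close> with \<open>h \<otimes> z \<otimes> inv h \<in> L\<close>, as the two differ by an element of \<open>L\<close>.  For
  \<open>y\<close> in the kernel belonging to \<open>hs\<close>, the commutator of \<open>z\<close> and \<open>y\<close> is then conjugated by \<open>h\<close> to a commutator of
  elements of \<open>L\<close>, so it lies in the smaller kernel.  Hence the quotient of \<open>\<phi>\<close> conjugated by \<open>x\<close> and \<open>\<phi>\<close> is trivial on the kernel belonging to
  \<open>hs\<close>.  These quotients, for \<open>x\<close> in the list of generators \<open>xs\<close>, determine \<open>\<phi>\<close> up to an invariant character.  The
  exponents satisfy \<open>e_0 = 1\<close> and \<open>e_(k+1) = 1 + s e_k\<close>, which gives \<open>e_k \<le> (s + 1) ^ k\<close>.\<close>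

lemma card_characters_trivial_on_conj_kernel:
  assumes H: "open_normal H" and ch: "kernel_chain H L xs"
    and fin: "\<And>K. open_subgroup K \<Longrightarrow> finite (characters K)"
    and hs: "set hs \<subseteq> carrier G"
    and prod: "\<And>h x. h \<in> set hs \<Longrightarrow> x \<in> H \<Longrightarrow> \<exists>l\<in>L. \<exists>y\<in>H. h \<otimes> y \<otimes> inv h \<in> L \<and> x = l \<otimes> y"
  shows "card {\<phi> \<in> characters L. \<forall>y\<in>conj_kernel H L hs. \<phi> y = 1}
    \<le> card (invariant_characters H L) ^ ((length xs + 1) ^ length hs)"
  using hs prod
proof (induction hs)
  note Ho = open_normal_imp_open_subgroup[OF H]
  note Hs = open_subgroupD[OF Ho]
  have L: "open_subgroup L" "L \<subseteq> H" "set xs \<subseteq> H" using kernel_chain_open[OF ch Ho] by auto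
  have finI: "finite (invariant_characters H L)"
    using finite_subset[OF _ fin[OF L(1)]] by (auto simp: invariant_characters_def)
  {
    case Nil
    have "H \<subseteq> stabilizer_of_char L \<phi>"
      if \<phi>: "\<phi> \<in> characters L" "\<forall>y\<in>common_kernel H. \<phi> y = 1" for \<phi>
    proof (rule subset_stabilizer_of_charI[OF Ho ch \<phi>(1) order_refl])
      fix x y assume x: "x \<in> H" and y: "y \<in> L"
      let ?c = "x \<otimes> y \<otimes> inv x \<otimes> inv y"
      have yH: "y \<in> H" using y L by blast
      have c: "?c \<in> L" using commutator_in_kernel_chain[OF Ho ch x yH] .
      have "\<phi> ?c = 1" using \<phi>(2) commutator_in_common_kernel[OF Ho x yH] by blast
      moreover have "?c \<otimes> y = x \<otimes> y \<otimes> inv x" using Hs(5)[OF x] Hs(5)[OF yH] by (simp add: m_assoc)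
      ultimately show "\<phi> (x \<otimes> y \<otimes> inv x) = \<phi> y" using charactersD(1)[OF \<phi>(1) c y] by simp
    qed
    then have "{\<phi> \<in> characters L. \<forall>y\<in>conj_kernel H L []. \<phi> y = 1} \<subseteq> invariant_characters H L"
      by (auto simp: invariant_characters_def)
    then show ?case using card_mono[OF finI] by simp
  next
    case (Cons h hs)
    let ?A = "\<lambda>hs. {\<phi> \<in> characters L. \<forall>y\<in>conj_kernel H L hs. \<phi> y = 1}"
    let ?I = "invariant_characters H L" and ?s = "length xs"
    define ratio where "ratio = (\<lambda>\<phi> x y. conj_char L x \<phi> y / \<phi> y :: complex)"
    have conj: "x \<otimes> y \<otimes> inv x \<in> L" if "x \<in> H" "y \<in> L" for x y
      using kernel_chain_conj[OF ch Ho that] .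
    have ratio: "ratio \<phi> x \<in> characters L" if "\<phi> \<in> characters L" "x \<in> H" for \<phi> x
      unfolding ratio_def
      using that conj Hs(5) by (intro character_divide conj_char_in_characters L) auto
    have IH: "card (?A hs) \<le> card ?I ^ ((?s + 1) ^ length hs)" using Cons by auto
    have h: "h \<in> carrier G" "set hs \<subseteq> carrier G" "set (h # hs) \<subseteq> carrier G" using Cons by auto
    have finA: "finite (?A k)" for k using fin[OF L(1)] by simp
    note P = conj_kernel_normal[OF H ch h(2)]
    have PL: "conj_kernel H L hs \<subseteq> L" using conj_kernel_subset[OF ch] by blast
    have ratioA: "ratio \<phi> x \<in> ?A hs" if \<phi>: "\<phi> \<in> ?A (h # hs)" and x: "x \<in> H" for \<phi> x
    proof -
      have \<phi>c: "\<phi> \<in> characters L" using \<phi> by simp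
      obtain l z where lz: "l \<in> L" "z \<in> H" "h \<otimes> z \<otimes> inv h \<in> L" "x = l \<otimes> z"
        using Cons.prems(2)[of h x] x by auto
      have "ratio \<phi> x y = 1" if y: "y \<in> conj_kernel H L hs" for y
      proof -
        have yL: "y \<in> L" using y PL by blast
        have c: "l \<in> carrier G" "z \<in> carrier G" "y \<in> carrier G"
          using lz Hs(5) open_subgroupD(5)[OF L(1)] yL by auto
        let ?e = "z \<otimes> y \<otimes> inv z \<otimes> inv y"
        have zy: "z \<otimes> y \<otimes> inv z \<in> L" using conj[OF lz(2) yL] .
        have "?e \<in> conj_kernel H L hs"
          using bspec[OF bspec[OF conjunct2[OF P] lz(2)] y]
          by (rule subgroup.m_closed[OF conjunct1[OF P] _ subgroup.m_inv_closed[OF conjunct1[OF P] y]])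
        moreover have "h \<otimes> ?e \<otimes> inv h \<in> common_kernel L"
        proof -
          let ?z = "h \<otimes> z \<otimes> inv h" and ?y = "h \<otimes> y \<otimes> inv h"
          have "?y \<in> common_kernel H"
            using conj_kernel_subset(1)[OF ch] y common_kernel_conj[OF Ho h(1) open_normal_conj[OF H h(1)]]
            by blast
          then have "?y \<in> L" using kernel_chain_contains_common_kernel[OF ch] by (auto simp: common_kernel_def)
          then have "?z \<otimes> ?y \<otimes> inv ?z \<otimes> inv ?y \<in> common_kernel L"
            using commutator_in_common_kernel[OF L(1) lz(3)] by blast
          moreover have "?z \<otimes> ?y \<otimes> inv ?z \<otimes> inv ?y = h \<otimes> ?e \<otimes> inv h"
            using c h by (simp add: word_simps)
          ultimately show ?thesis by simp
        qed
        ultimately have "\<phi> ?e = 1" using \<phi> by simp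
        moreover have "?e \<otimes> y = z \<otimes> y \<otimes> inv z" using c by (simp add: m_assoc)
        moreover have eL: "?e \<in> L" using zy yL open_subgroupD(6,7)[OF L(1)] by blast
        ultimately have 1: "\<phi> (z \<otimes> y \<otimes> inv z) = \<phi> y" using charactersD(1)[OF \<phi>c eL yL] by simp
        have "x \<otimes> y \<otimes> inv x = l \<otimes> (z \<otimes> y \<otimes> inv z) \<otimes> inv l" using c lz by (simp add: word_simps)
        then have "\<phi> (x \<otimes> y \<otimes> inv x) = \<phi> y"
          using character_conj_inside[OF \<phi>c L(1) lz(1) zy] 1 by simp
        then show ?thesis using yL charactersD(4)[OF \<phi>c, of y] by (simp add: ratio_def conj_char_def)
      qed
      then show ?thesis using ratio[OF \<phi>c x] by simp
    qed
    let ?F = "\<lambda>\<phi>. map (ratio \<phi>) xs"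
    have "card (?A (h # hs)) \<le> card ?I * card (?F ` ?A (h # hs))"
    proof (rule card_characters_le_quotient[OF finA finI])
      show "?A (h # hs) \<subseteq> characters L" by auto
      fix \<phi> \<psi> assume a: "\<phi> \<in> ?A (h # hs)" "\<psi> \<in> ?A (h # hs)" "?F \<phi> = ?F \<psi>"
      let ?\<theta> = "\<lambda>x. \<phi> x / \<psi> x"
      have c: "\<phi> \<in> characters L" "\<psi> \<in> characters L" using a by auto
      have \<theta>: "?\<theta> \<in> characters L" using character_divide[OF c L(1)] .
      have nz: "\<phi> y \<noteq> 0" "\<psi> y \<noteq> 0" for y using charactersD(4) c by auto
      have "H \<subseteq> stabilizer_of_char L ?\<theta>"
      proof (rule kernel_chain_generates[OF ch Ho subgroup_stabilizer_of_char[OF open_subgroupD(3)[OF L(1)]]])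
        show "L \<subseteq> stabilizer_of_char L ?\<theta>"
          using character_conj_inside[OF \<theta> L(1)] by (intro subset_stabilizer_of_charI[OF Ho ch \<theta> L(2)])
        show "set xs \<subseteq> stabilizer_of_char L ?\<theta>"
        proof (rule subset_stabilizer_of_charI[OF Ho ch \<theta> L(3)])
          fix x y assume x: "x \<in> set xs" and y: "y \<in> L"
          have "ratio \<phi> x = ratio \<psi> x" using a(3) x by simp
          then have "ratio \<phi> x y = ratio \<psi> x y" by simp
          then have e: "\<phi> (x \<otimes> y \<otimes> inv x) / \<phi> y = \<psi> (x \<otimes> y \<otimes> inv x) / \<psi> y"
            using y by (simp add: ratio_def conj_char_def)
          show "?\<theta> (x \<otimes> y \<otimes> inv x) = ?\<theta> y"
            using e nz[of y] nz[of "x \<otimes> y \<otimes> inv x"] by (simp add: field_simps)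
        qed
      qed
      then show "?\<theta> \<in> ?I" using \<theta> by (simp add: invariant_characters_def)
    qed
    also have "card (?F ` ?A (h # hs)) \<le> card {l. set l \<subseteq> ?A hs \<and> length l = ?s}"
    proof (rule card_mono[OF finite_lists_length_eq[OF finA]])
      show "?F ` ?A (h # hs) \<subseteq> {l. set l \<subseteq> ?A hs \<and> length l = ?s}"
      proof (rule image_subsetI)
        fix \<phi> assume "\<phi> \<in> ?A (h # hs)"
        then have "ratio \<phi> x \<in> ?A hs" if "x \<in> set xs" for x using ratioA that L by blast
        then show "?F \<phi> \<in> {l. set l \<subseteq> ?A hs \<and> length l = ?s}" by auto
      qed
    qed
    also have "\<dots> = card (?A hs) ^ ?s" using card_lists_length_eq[OF finA] by simp
    also have "\<dots> \<le> (card ?I ^ ((?s + 1) ^ length hs)) ^ ?s" using IH by (rule power_mono) simp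
    finally have "card (?A (h # hs)) \<le> card ?I * card ?I ^ ((?s + 1) ^ length hs * ?s)"
      by (simp add: power_mult)
    also have "\<dots> = card ?I ^ ((?s + 1) ^ length hs * ?s + 1)" by simp
    also have "\<dots> \<le> card ?I ^ ((?s + 1) ^ length (h # hs))"
    proof (rule power_increasing)
      have "(\<lambda>_. 1) \<in> ?I"
        using character_trivial[OF L(1)] subset_stabilizer_of_charI[OF Ho ch character_trivial[OF L(1)] order_refl]
        by (simp add: invariant_characters_def)
      then show "1 \<le> card ?I" using finI by (auto simp: Suc_le_eq card_gt_0_iff)
    qed (simp add: add_mono)
    finally show ?case .
  }
qed

section \<open>Kernels in general position with respect to conjugation\<close>

definition conj_preimage :: "'a set \<Rightarrow> 'a \<Rightarrow> 'a set \<Rightarrow> 'a set" where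
  "conj_preimage H h L = {y \<in> H. h \<otimes> y \<otimes> inv h \<in> L}"

text \<open>This is the dual form of \<open>H = L (h^-1 L h)\<close>; see \<open>in_general_position_product\<close>.\<close>

definition in_general_position :: "'a set \<Rightarrow> 'a set \<Rightarrow> 'a \<Rightarrow> bool" where
  "in_general_position H L h \<longleftrightarrow> annihilator H L \<inter> annihilator H (conj_preimage H h L) \<subseteq> {\<lambda>_. 1}"

lemma open_subgroup_conj_preimage:
  assumes H: "open_normal H" and L: "open_subgroup L" "L \<subseteq> H" and h: "h \<in> carrier G"
  shows "open_subgroup (conj_preimage H h L)" "conj_preimage H h L \<subseteq> H"
proof -
  note Hs = open_subgroupD[OF open_normal_imp_open_subgroup[OF H]]
  note Ls = open_subgroupD[OF L(1)]
  have "subgroup (conj_preimage H h L) G"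
  proof (rule subgroupI)
    show "conj_preimage H h L \<noteq> {}" using h Hs Ls by (auto simp: conj_preimage_def intro!: exI[of _ \<one>])
    show "conj_preimage H h L \<subseteq> carrier G" using Hs by (auto simp: conj_preimage_def)
    fix a assume a: "a \<in> conj_preimage H h L"
    have "inv (h \<otimes> a \<otimes> inv h) = h \<otimes> inv a \<otimes> inv h"
      using h a Hs(5) by (simp add: word_simps conj_preimage_def)
    then show "inv a \<in> conj_preimage H h L"
      using a Hs(6) Ls(6)[of "h \<otimes> a \<otimes> inv h"] by (simp add: conj_preimage_def)
    fix b assume b: "b \<in> conj_preimage H h L"
    have "(h \<otimes> a \<otimes> inv h) \<otimes> (h \<otimes> b \<otimes> inv h) = h \<otimes> (a \<otimes> b) \<otimes> inv h"
      using h a b Hs(5) by (simp add: word_simps conj_preimage_def)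
    then show "a \<otimes> b \<in> conj_preimage H h L"
      using a b Hs(7) Ls(7)[of "h \<otimes> a \<otimes> inv h" "h \<otimes> b \<otimes> inv h"] by (simp add: conj_preimage_def)
  qed
  moreover obtain N where N: "open_normal N" "N \<subseteq> L" using open_normal_core[OF L(1)] by blast
  have "N \<subseteq> conj_preimage H h L"
    using open_normal_conj[OF N(1) h] N L by (auto simp: conj_preimage_def)
  ultimately show "open_subgroup (conj_preimage H h L)"
    using open_subgroup_superset[OF open_normal_imp_open_subgroup[OF N(1)]] by blast
  show "conj_preimage H h L \<subseteq> H" by (auto simp: conj_preimage_def)
qed

lemma conj_preimage_kernel:
  assumes "L \<subseteq> H"
  shows "conj_preimage H h {y \<in> L. f y = 1} = {y \<in> conj_preimage H h L. conj_char H h f y = 1}"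
  by (auto simp: conj_preimage_def conj_char_def)

lemma card_annihilator_conj_preimage:
  assumes H: "open_normal H" and L: "L \<subseteq> H" and h: "h \<in> carrier G" and fin: "finite (characters H)"
  shows "card (annihilator H (conj_preimage H h L)) \<le> card (annihilator H L)"
proof (rule card_inj_on_le)
  note Ho = open_normal_imp_open_subgroup[OF H]
  note Hs = open_subgroupD[OF Ho]
  let ?F = "conj_char H (inv h)"
  have ih: "inv h \<in> carrier G" using h by simp
  show "inj_on ?F (annihilator H (conj_preimage H h L))"
    using inj_on_subset[OF inj_on_conj_char[OF H ih]] by (auto simp: annihilator_def)
  show "?F ` annihilator H (conj_preimage H h L) \<subseteq> annihilator H L"
  proof
    fix \<psi> assume "\<psi> \<in> ?F ` annihilator H (conj_preimage H h L)"
    then obtain \<phi> where \<phi>: "\<phi> \<in> characters H" "\<forall>y\<in>conj_preimage H h L. \<phi> y = 1" "\<psi> = ?F \<phi>"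
      by (auto simp: annihilator_def)
    have "\<psi> y = 1" if y: "y \<in> L" for y
    proof -
      have yH: "y \<in> H" using y L by blast
      have "h \<otimes> (inv h \<otimes> y \<otimes> inv (inv h)) \<otimes> inv h = y" using h Hs(5)[OF yH] by (simp add: m_assoc)
      then have "inv h \<otimes> y \<otimes> inv (inv h) \<in> conj_preimage H h L"
        using open_normal_conj[OF H ih yH] y unfolding conj_preimage_def by auto
      then show ?thesis using \<phi> yH unfolding conj_char_def by auto
    qed
    moreover have "\<psi> \<in> characters H"
      unfolding \<phi>(3) using open_normal_conj[OF H ih] by (intro conj_char_in_characters \<phi> Ho ih)
    ultimately show "\<psi> \<in> annihilator H L" by (simp add: annihilator_def)
  qed
  show "finite (annihilator H L)" using fin by (simp add: annihilator_def)
qed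

definition twisted_quotient :: "'a set \<Rightarrow> 'a \<Rightarrow> nat \<Rightarrow> nat \<Rightarrow> ('a \<Rightarrow> complex) \<Rightarrow> 'a \<Rightarrow> complex" where
  "twisted_quotient H h i j f = (\<lambda>y. f y ^ i / conj_char H h f y ^ j)"

text \<open>The map \<open>f \<mapsto> twisted_quotient H h i j f\<close> is a homomorphism, with kernel inside the characters fixed by \<open>h\<close> by
  \<open>twisted_power_kernel\<close>.\<close>

lemma card_twisted_quotient_preimage:
  assumes H: "open_normal H" and h: "h \<in> carrier G" and fin: "finite (characters H)"
    and ij: "i < p" "j < p" "(i, j) \<noteq> (0, 0)" and Q: "finite Q"
  shows "card {f \<in> characters H. twisted_quotient H h i j f \<in> Q} \<le> card (fixed_characters H h) * card Q"
proof -
  let ?B = "{f \<in> characters H. twisted_quotient H h i j f \<in> Q}"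
  note Ho = open_normal_imp_open_subgroup[OF H]
  have "card ?B \<le> card (fixed_characters H h) * card (twisted_quotient H h i j ` ?B)"
  proof (rule card_characters_le_quotient)
    show "finite ?B" "?B \<subseteq> characters H" "finite (fixed_characters H h)"
      using fin by (auto simp: fixed_characters_def)
    fix f g assume f: "f \<in> ?B" "g \<in> ?B" and eq: "twisted_quotient H h i j f = twisted_quotient H h i j g"
    have c: "f \<in> characters H" "g \<in> characters H" using f by auto
    have nz: "f y \<noteq> 0" "g y \<noteq> 0" for y using charactersD(4) c by auto
    show "(\<lambda>x. f x / g x) \<in> fixed_characters H h"
    proof (rule twisted_power_kernel[OF H h character_divide[OF c Ho] ij])
      fix y assume y: "y \<in> H"
      have "f y ^ i / f (h \<otimes> y \<otimes> inv h) ^ j = g y ^ i / g (h \<otimes> y \<otimes> inv h) ^ j"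
        using fun_cong[OF eq, of y] y by (simp add: twisted_quotient_def conj_char_def)
      then show "(f y / g y) ^ i = (f (h \<otimes> y \<otimes> inv h) / g (h \<otimes> y \<otimes> inv h)) ^ j"
        using nz by (simp add: power_divide field_simps)
    qed
  qed
  also have "\<dots> \<le> card (fixed_characters H h) * card Q"
    using Q by (intro mult_left_mono card_mono) auto
  finally show ?thesis .
qed

text \<open>A character in both new annihilators has the form \<open>w f^i = w' \<tau>(f)^j\<close> with \<open>w\<close> and \<open>w'\<close> in the old ones and
  \<open>\<tau>\<close> the conjugation by \<open>h\<close>; so \<open>f^i / \<tau>(f)^j = w' / w\<close>, which is excluded unless \<open>i = j = 0\<close>.\<close>

lemma in_general_position_kernel:
  assumes H: "open_normal H" and L: "open_subgroup L" "L \<subseteq> H" and h: "h \<in> carrier G"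
    and gen: "in_general_position H L h" and f: "f \<in> characters H"
    and good: "\<And>i j. i < p \<Longrightarrow> j < p \<Longrightarrow> (i, j) \<noteq> (0, 0) \<Longrightarrow>
      twisted_quotient H h i j f \<notin>
        (\<lambda>(w, w') y. w' y / w y) ` (annihilator H L \<times> annihilator H (conj_preimage H h L))"
  shows "in_general_position H {y \<in> L. f y = 1} h"
  unfolding in_general_position_def
proof
  fix \<psi> assume \<psi>: "\<psi> \<in> annihilator H {y \<in> L. f y = 1} \<inter> annihilator H (conj_preimage H h {y \<in> L. f y = 1})"
  note Ho = open_normal_imp_open_subgroup[OF H]
  have fc: "conj_char H h f \<in> characters H"
    using open_normal_conj[OF H h] by (intro conj_char_in_characters f Ho h)
  obtain i w where i: "i < p" "w \<in> annihilator H L" "\<And>y. \<psi> y = w y * f y ^ i"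
    using annihilator_kernel[OF Ho L f] \<psi> by blast
  have "\<psi> \<in> annihilator H {y \<in> conj_preimage H h L. conj_char H h f y = 1}"
    using \<psi> conj_preimage_kernel[OF L(2), of h f] by simp
  then obtain j w' where j: "j < p" "w' \<in> annihilator H (conj_preimage H h L)"
      "\<And>y. \<psi> y = w' y * conj_char H h f y ^ j"
    using annihilator_kernel[OF Ho open_subgroup_conj_preimage[OF H L h] fc] by blast
  have nz: "w y \<noteq> 0" "w' y \<noteq> 0" "f y \<noteq> 0" "conj_char H h f y \<noteq> 0" for y
    using charactersD(4)[of w H y] charactersD(4)[of w' H y] charactersD(4)[OF f, of y]
      charactersD(4)[OF fc, of y] i j by (auto simp: annihilator_def)
  have "twisted_quotient H h i j f y = w' y / w y" for y
    using i(3)[of y] j(3)[of y] nz[of y] by (simp add: twisted_quotient_def field_simps)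
  then have "twisted_quotient H h i j f = (\<lambda>y. w' y / w y)" by auto
  then have "twisted_quotient H h i j f \<in>
      (\<lambda>(w, w') y. w' y / w y) ` (annihilator H L \<times> annihilator H (conj_preimage H h L))"
    using i j by (intro image_eqI[of _ _ "(w, w')"]) auto
  then have "(i, j) = (0, 0)" using good i j by blast
  then have "\<psi> = w" "\<psi> = w'" using i(3) j(3) by auto
  then show "\<psi> \<in> {\<lambda>_. 1}" using gen i j unfolding in_general_position_def by blast
qed

text \<open>At most \<open>p^s\<close> characters are trivial on \<open>L\<close>.  For each \<open>h\<close> and each of fewer than \<open>p^2\<close> exponent pairs, at most \<open>M p^(2 s)\<close>
  characters violate the condition of \<open>in_general_position_kernel\<close>.  So some character avoids all these sets.\<close>

lemma exists_kernel_in_general_position: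
  assumes H: "open_normal H" and hs: "set hs \<subseteq> carrier G" and fin: "finite (characters H)"
    and M: "M \<ge> 1" "\<And>h. h \<in> set hs \<Longrightarrow> real (card (fixed_characters H h)) \<le> M"
    and large: "(real (length hs) + 1) * real p ^ (2 * s + 2) * M < card (characters H)"
    and ch: "kernel_chain H L xs" and xs: "length xs \<le> s"
    and gen: "\<And>h. h \<in> set hs \<Longrightarrow> in_general_position H L h"
  shows "\<exists>f\<in>characters H. \<exists>x\<in>L. f x \<noteq> 1 \<and> (\<forall>h\<in>set hs. in_general_position H {y \<in> L. f y = 1} h)"
proof -
  note Ho = open_normal_imp_open_subgroup[OF H]
  have L: "open_subgroup L" "L \<subseteq> H" using kernel_chain_open[OF ch Ho] by auto
  have p1: "real p \<ge> 1" "p \<ge> 1" using prime_ge_1_nat[OF prime_p] by auto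
  let ?I = "{..<p} \<times> {..<p} - {(0, 0)}"
  define Q where "Q = (\<lambda>h. (\<lambda>(w, w') y. w' y / w y :: complex) `
      (annihilator H L \<times> annihilator H (conj_preimage H h L)))"
  define B where "B = (\<lambda>h (i, j). {f \<in> characters H. twisted_quotient H h i j f \<in> Q h})"
  have cA: "card (annihilator H L) \<le> p ^ s"
    using card_annihilator_kernel_chain[OF ch Ho fin] power_increasing[OF xs p1(2)] by linarith
  have finA: "finite (annihilator H L)" "finite (annihilator H (conj_preimage H h L))" for h
    using fin by (auto simp: annihilator_def)
  have Q: "finite (Q h)" "card (Q h) \<le> p ^ (2 * s)" if "h \<in> set hs" for h
  proof -
    show "finite (Q h)" using finA by (simp add: Q_def)
    have "card (Q h) \<le> card (annihilator H L) * card (annihilator H (conj_preimage H h L))"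
      unfolding Q_def card_cartesian_product[symmetric]
      by (rule card_image_le[OF finite_cartesian_product[OF finA]])
    also have "\<dots> \<le> p ^ s * p ^ s"
      using cA card_annihilator_conj_preimage[OF H L(2) _ fin, of h] that hs
      by (intro mult_le_mono) auto
    finally show "card (Q h) \<le> p ^ (2 * s)" by (simp add: power_add[symmetric] mult_2)
  qed
  have B: "real (card (B h ij)) \<le> M * real p ^ (2 * s)" if "h \<in> set hs" "ij \<in> ?I" for h ij
  proof -
    obtain i j where ij: "ij = (i, j)" by fastforce
    have "card (B h ij) \<le> card (fixed_characters H h) * card (Q h)"
      using card_twisted_quotient_preimage[OF H _ fin _ _ _ Q(1)[OF that(1)], of h i j] that hs
      by (auto simp: B_def ij)
    also have "real (card (fixed_characters H h) * card (Q h)) \<le> M * real p ^ (2 * s)"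
      unfolding of_nat_mult using M that of_nat_mono[OF Q(2)[OF that(1)], where 'a = real]
      by (intro mult_mono) auto
    finally show ?thesis by simp
  qed
  let ?Bad = "annihilator H L \<union> (\<Union>h\<in>set hs. \<Union>ij\<in>?I. B h ij)"
  have "real (card ?Bad) \<le> real (card (annihilator H L)) + real (card (\<Union>h\<in>set hs. \<Union>ij\<in>?I. B h ij))"
    using of_nat_mono[OF card_Un_le[of "annihilator H L" "\<Union>h\<in>set hs. \<Union>ij\<in>?I. B h ij"], where 'a = real]
    by simp
  also have "real (card (\<Union>h\<in>set hs. \<Union>ij\<in>?I. B h ij)) \<le> (\<Sum>h\<in>set hs. \<Sum>ij\<in>?I. real (card (B h ij)))"
  proof -
    have "card (\<Union>h\<in>set hs. \<Union>ij\<in>?I. B h ij) \<le> (\<Sum>h\<in>set hs. card (\<Union>ij\<in>?I. B h ij))"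
      by (rule card_UN_le) simp
    also have "\<dots> \<le> (\<Sum>h\<in>set hs. \<Sum>ij\<in>?I. card (B h ij))"
      by (intro sum_mono card_UN_le) simp
    finally have "real (card (\<Union>h\<in>set hs. \<Union>ij\<in>?I. B h ij)) \<le> real (\<Sum>h\<in>set hs. \<Sum>ij\<in>?I. card (B h ij))"
      by (rule of_nat_mono)
    then show ?thesis by (simp only: of_nat_sum)
  qed
  also have "\<dots> \<le> (\<Sum>h\<in>set hs. \<Sum>ij\<in>?I. M * real p ^ (2 * s))"
    using B by (intro sum_mono) auto
  also have "\<dots> = real (card (set hs)) * (real (card ?I) * (M * real p ^ (2 * s)))" by simp
  also have "\<dots> \<le> real (length hs) * (real p ^ 2 * (M * real p ^ (2 * s)))"
  proof (intro mult_mono)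
    show "real (card (set hs)) \<le> real (length hs)" using card_length by auto
    have "card ?I \<le> card ({..<p} \<times> {..<p})" by (intro card_mono) auto
    then have "card ?I \<le> p ^ 2" by (simp add: card_cartesian_product power2_eq_square)
    then show "real (card ?I) \<le> real p ^ 2" by (metis of_nat_mono of_nat_power)
  qed (use M in auto)
  also have "real (card (annihilator H L)) \<le> real p ^ (2 * s + 2) * M"
  proof -
    have "real (card (annihilator H L)) \<le> real p ^ s" using cA by (metis of_nat_mono of_nat_power)
    also have "\<dots> \<le> real p ^ (2 * s + 2)" using p1 by (intro power_increasing) auto
    also have "\<dots> \<le> real p ^ (2 * s + 2) * M" using M p1 by simp
    finally show ?thesis .
  qed
  finally have "real (card ?Bad) \<le> (real (length hs) + 1) * real p ^ (2 * s + 2) * M"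
    by (simp add: algebra_simps power_add power2_eq_square)
  then have "real (card ?Bad) < real (card (characters H))" using large by linarith
  then have "card ?Bad < card (characters H)" by (simp only: of_nat_less_iff)
  then have "\<not> characters H \<subseteq> ?Bad"
  proof -
    have "?Bad \<subseteq> characters H" by (auto simp: B_def annihilator_def)
    then have "finite ?Bad" by (rule finite_subset[OF _ fin])
    then show ?thesis
      using \<open>card ?Bad < card (characters H)\<close> card_mono[of ?Bad "characters H"] not_le by blast
  qed
  then obtain f where f: "f \<in> characters H" "f \<notin> ?Bad" by blast
  then obtain x where x: "x \<in> L" "f x \<noteq> 1" by (auto simp: annihilator_def)
  have "in_general_position H {y \<in> L. f y = 1} h" if "h \<in> set hs" for h
  proof (rule in_general_position_kernel[OF H L _ gen[OF that] f(1)])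
    show "h \<in> carrier G" using that hs by blast
    fix i j assume "i < p" "j < p" "(i, j) \<noteq> (0, 0)"
    then have "(i, j) \<in> ?I" by simp
    then have "f \<notin> B h (i, j)" using f(2) that by blast
    then show "twisted_quotient H h i j f \<notin>
        (\<lambda>(w, w') y. w' y / w y) ` (annihilator H L \<times> annihilator H (conj_preimage H h L))"
      using f(1) by (simp add: B_def Q_def)
  qed
  then show ?thesis using f(1) x by blast
qed

lemma exists_long_kernel_chain:
  assumes H: "open_normal H" and hs: "set hs \<subseteq> carrier G" and fin: "finite (characters H)"
    and M: "M \<ge> 1" "\<And>h. h \<in> set hs \<Longrightarrow> real (card (fixed_characters H h)) \<le> M"
    and large: "(real (length hs) + 1) * real p ^ (2 * s + 2) * M < card (characters H)"
  shows "\<exists>L xs. kernel_chain H L xs \<and> length xs = s \<and> (\<forall>h\<in>set hs. in_general_position H L h)"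
proof -
  have "\<exists>L xs. kernel_chain H L xs \<and> length xs = n \<and> (\<forall>h\<in>set hs. in_general_position H L h)"
    if "n \<le> s" for n
    using that
  proof (induction n)
    case 0
    have "\<psi> = (\<lambda>_. 1)" if "\<psi> \<in> annihilator H H" for \<psi>
    proof
      show "\<psi> x = 1" for x
        using that charactersD(3)[of \<psi> H x] by (cases "x \<in> H") (auto simp: annihilator_def)
    qed
    then have "in_general_position H H h" for h by (auto simp: in_general_position_def)
    then show ?case using kernel_chain_Nil[of H] by auto
  next
    case (Suc n)
    then obtain L xs where L: "kernel_chain H L xs" "length xs = n" "\<forall>h\<in>set hs. in_general_position H L h"
      by auto
    obtain f x where "f \<in> characters H" "x \<in> L" "f x \<noteq> 1"
        "\<forall>h\<in>set hs. in_general_position H {y \<in> L. f y = 1} h"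
      using exists_kernel_in_general_position[OF H hs fin M large L(1)] L Suc by auto
    then show ?case using kernel_chain_Cons[OF L(1)] L(2)
      by (intro exI[of _ "{y \<in> L. f y = 1}"] exI[of _ "x # xs"]) auto
  qed
  then show ?thesis by blast
qed

text \<open>If the open subgroup generated by \<open>L\<close> and \<open>h^-1 L h\<close> were proper in \<open>H\<close>, a nontrivial character of \<open>H\<close> would be trivial
  on both.\<close>

lemma in_general_position_product:
  assumes H: "open_normal H" and ch: "kernel_chain H L xs" and h: "h \<in> carrier G"
    and gen: "in_general_position H L h" and x: "x \<in> H"
  shows "\<exists>l\<in>L. \<exists>y\<in>H. h \<otimes> y \<otimes> inv h \<in> L \<and> x = l \<otimes> y"
proof -
  note Ho = open_normal_imp_open_subgroup[OF H]
  have L: "open_subgroup L" "L \<subseteq> H" using kernel_chain_open[OF ch Ho] by auto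
  let ?P = "conj_preimage H h L"
  note P = open_subgroup_conj_preimage[OF H L h]
  have conj: "q \<otimes> y \<otimes> inv q \<in> L" if "q \<in> ?P" "y \<in> L" for q y
    using kernel_chain_conj[OF ch Ho _ that(2)] that P by blast
  have K: "open_subgroup (?P <#> L)"
    by (rule extend_character(1)[OF L(1) open_subgroupD(1)[OF P(1)] character_trivial[OF L(1)]])
      (use conj in auto)
  have KI: "q \<otimes> y \<in> ?P <#> L" if "q \<in> ?P" "y \<in> L" for q y using that by (auto simp: set_mult_def)
  have sub: "L \<subseteq> ?P <#> L" "?P \<subseteq> ?P <#> L"
  proof -
    show "L \<subseteq> ?P <#> L"
    proof
      fix y assume y: "y \<in> L"
      show "y \<in> ?P <#> L"
        using KI[OF open_subgroupD(4)[OF P(1)] y] open_subgroupD(5)[OF L(1) y] by simp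
    qed
    show "?P \<subseteq> ?P <#> L"
    proof
      fix y assume y: "y \<in> ?P"
      show "y \<in> ?P <#> L"
        using KI[OF y open_subgroupD(4)[OF L(1)]] open_subgroupD(5)[OF P(1) y] by simp
    qed
  qed
  have KH: "?P <#> L \<subseteq> H"
    using P(2) L(2) open_subgroupD(7)[OF Ho] by (auto simp: set_mult_def)
  have "?P <#> L = H"
  proof (rule ccontr)
    assume "?P <#> L \<noteq> H"
    then obtain \<psi> where \<psi>: "\<psi> \<in> characters H" "\<forall>u\<in>?P <#> L. \<psi> u = 1" "\<exists>k\<in>H. \<psi> k \<noteq> 1"
      using exists_nontrivial_character[OF K Ho KH] by blast
    then have "\<psi> \<in> annihilator H L \<inter> annihilator H ?P" using sub by (auto simp: annihilator_def)
    then show False using gen \<psi>(3) by (auto simp: in_general_position_def)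
  qed
  then have "x \<in> ?P <#> L" using x by simp
  then obtain q y where q: "q \<in> ?P" "y \<in> L" "x = q \<otimes> y" by (auto simp: set_mult_def)
  have "x = (q \<otimes> y \<otimes> inv q) \<otimes> q"
    using q open_subgroupD(5)[OF P(1) q(1)] open_subgroupD(5)[OF L(1) q(2)] by (simp add: m_assoc)
  moreover have "q \<in> H" "h \<otimes> q \<otimes> inv h \<in> L" using q(1) by (auto simp: conj_preimage_def)
  ultimately show ?thesis using conj[OF q(1,2)] by blast
qed

end

context tight_pro_p_group begin

section \<open>Non-central conjugates do not control a neighbourhood of the identity\<close>

lemma exists_fixed_character_bound:
  assumes "set hs \<subseteq> carrier G - centralizer"
  shows "\<exists>V. open_subgroup V \<and> (\<forall>H. open_normal H \<and> H \<subseteq> V \<longrightarrow> (\<forall>h\<in>set hs.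
    card (fixed_characters H h) ^ 2 \<le> p powr (1 + 3 / 4 * \<rho> * idx H) * card (characters H)))"
  using assms
proof (induction hs)
  case Nil
  then show ?case using open_subgroup_carrier by auto
next
  case (Cons h hs)
  then obtain V where V: "open_subgroup V" "\<forall>H. open_normal H \<and> H \<subseteq> V \<longrightarrow> (\<forall>h\<in>set hs.
    card (fixed_characters H h) ^ 2 \<le> p powr (1 + 3 / 4 * \<rho> * idx H) * card (characters H))" by auto
  obtain V' where V': "open_subgroup V'" "\<forall>H. open_normal H \<and> H \<subseteq> V' \<longrightarrow>
    card (fixed_characters H h) ^ 2 \<le> p powr (1 + 3 / 4 * \<rho> * idx H) * card (characters H)"
    using card_fixed_characters_noncentral[of h] Cons.prems by auto
  show ?case using V V' open_subgroup_Int[OF V(1) V'(1)] by (intro exI[of _ "V \<inter> V'"]) auto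
qed

lemma exists_power_dominating: "\<exists>s. 5 / 2 * real (s + 1) ^ k < real p ^ s"
proof -
  have "(\<lambda>s::nat. 5 / 2 * real (s + 1) ^ k / 2 ^ s) \<longlonglongrightarrow> 0" by real_asymp
  then have "eventually (\<lambda>s::nat. 5 / 2 * real (s + 1) ^ k / 2 ^ s < 1) sequentially"
    by (rule order_tendstoD) simp
  then obtain s :: nat where "5 / 2 * real (s + 1) ^ k / 2 ^ s < 1"
    using eventually_sequentially by auto
  then have "5 / 2 * real (s + 1) ^ k < 2 ^ s" by (simp add: field_simps)
  also have "\<dots> \<le> real p ^ s" using prime_ge_2_nat[OF prime_p] by (intro power_mono) auto
  finally show ?thesis by blast
qed

text \<open>Applied to the Frattini subgroup of \<open>L\<close>, the hypothesis \<open>control\<close> makes every character of \<open>L\<close> trivial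
  on \<open>conj_kernel H L hs\<close>, so that the two bounds for the number of characters of \<open>L\<close> collide.\<close>

theorem noncentral_conjugates_not_controlling:
  assumes hs: "set hs \<subseteq> carrier G - centralizer" and N: "open_normal N"
    and control: "\<And>Z y. subgroup Z G \<Longrightarrow> y \<in> N \<Longrightarrow> (\<forall>h\<in>set hs. h \<otimes> y \<otimes> inv h \<in> Z) \<Longrightarrow> y \<in> Z"
  shows False
proof -
  let ?k = "length hs"
  obtain s where s: "5 / 2 * real (s + 1) ^ ?k < real p ^ s" using exists_power_dominating by blast
  obtain V where V: "open_subgroup V" "\<And>H h. open_normal H \<Longrightarrow> H \<subseteq> V \<Longrightarrow> h \<in> set hs \<Longrightarrow>
    card (fixed_characters H h) ^ 2 \<le> p powr (1 + 3 / 4 * \<rho> * idx H) * card (characters H)"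
    using exists_fixed_character_bound[OF hs] by blast
  \<comment> \<open>\<open>E\<close> is the factor needed for \<open>exists_long_kernel_chain\<close>.  The first bound in \<open>r\<close> lets \<open>s^2\<close> be absorbed by \<open>\<rho>\<close> times the
    index; the second one makes the number of characters exceed \<open>E M\<close>.\<close>
  define E where "E = (real ?k + 1) * real p ^ (2 * s + 2)"
  have E: "E > 0" using p_gt_1 by (simp add: E_def)
  define r where "r = max (real (s ^ 2) / \<rho>) (4 / \<rho> * (2 + log p (E ^ 2)))"
  let ?W = "V \<inter> (N \<inter> H0)"
  have "open_subgroup ?W"
    using open_subgroup_Int[OF V(1) open_normal_imp_open_subgroup[OF open_normal_Int[OF N H0]]] .
  then obtain H where H: "open_normal H" "H \<subseteq> ?W" "idx H \<ge> r" using exists_deep_open_normal by blast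
  note Ho = open_normal_imp_open_subgroup[OF H(1)]
  define m where "m = \<rho> * idx H"
  have m: "m \<ge> real (s ^ 2)" "m \<ge> 4 * (2 + log p (E ^ 2))" "m > 0"
    using H(3) \<rho>_pos idx_pos[OF Ho] unfolding r_def m_def by (auto simp: field_simps)
  let ?c = "real (card (characters H))"
  have c: "p powr m \<le> ?c" "?c \<le> p powr (3 / 2 * m)"
    using card_lower[OF Ho] card_upper[OF Ho] H(2) by (auto simp: m_def mult.assoc)
  define M where "M = sqrt (p powr (1 + 3 / 4 * m) * ?c)"
  have c1: "?c \<ge> 1" using card_characters_pos[OF Ho] by simp
  have pw1: "1 \<le> p powr (1 + 3 / 4 * m)" using p_gt_1 m by (intro ge_one_powr_ge_zero) auto
  have M1: "M \<ge> 1" unfolding M_def using mult_mono[OF pw1 c1] by simp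
  have M2: "real (card (fixed_characters H h)) \<le> M" if "h \<in> set hs" for h
    unfolding M_def using V(2)[OF H(1) _ that] H(2) by (intro real_le_rsqrt) (auto simp: m_def mult.assoc)
  have "E * M < ?c"
  proof -
    have "log p (E ^ 2) + (1 + 3 / 4 * m) < m" using m by simp
    then have "p powr (log p (E ^ 2) + (1 + 3 / 4 * m)) < p powr m" using p_gt_1 by (intro powr_less_mono)
    then have "E ^ 2 * p powr (1 + 3 / 4 * m) < p powr m" using E p_gt_1 by (simp add: powr_add)
    then have "E ^ 2 * p powr (1 + 3 / 4 * m) * ?c < ?c * ?c"
      using c c1 by (intro mult_strict_right_mono) auto
    moreover have "(E * M) ^ 2 = E ^ 2 * p powr (1 + 3 / 4 * m) * ?c"
      using c1 by (simp add: M_def power_mult_distrib)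
    ultimately have "(E * M) ^ 2 < ?c * ?c" by (simp only:)
    then have "(E * M) ^ 2 < ?c ^ 2" by (simp only: power2_eq_square)
    then show ?thesis by (rule power_less_imp_less_base) simp
  qed
  then have "(real ?k + 1) * real p ^ (2 * s + 2) * M < card (characters H)" by (simp add: E_def)
  moreover have hsc: "set hs \<subseteq> carrier G" using hs by blast
  ultimately obtain L xs where L: "kernel_chain H L xs" "length xs = s"
      "\<And>h. h \<in> set hs \<Longrightarrow> in_general_position H L h"
    using exists_long_kernel_chain[OF H(1) _ finite_characters[OF Ho] M1 M2, of hs s] by blast
  have Lo: "open_subgroup L" "L \<subseteq> H" using kernel_chain_open[OF L(1) Ho] by auto
  have C: "subgroup (common_kernel L) G" using subgroup_common_kernel[OF Lo(1)] .
  have conj_in: "\<forall>h\<in>set hs'. h \<otimes> y \<otimes> inv h \<in> common_kernel L" if "y \<in> conj_kernel H L hs'" for y hs'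
    using that by (induction hs') auto
  have "\<phi> y = 1" if \<phi>: "\<phi> \<in> characters L" and y: "y \<in> conj_kernel H L hs" for \<phi> y
  proof -
    have "y \<in> N" using conj_kernel_subset(2)[OF L(1)] y Lo H by blast
    then have "y \<in> common_kernel L" using control[OF C] conj_in[OF y] by blast
    then show ?thesis using \<phi> by (simp add: common_kernel_def)
  qed
  then have all: "{\<phi> \<in> characters L. \<forall>y\<in>conj_kernel H L hs. \<phi> y = 1} = characters L" by blast
  have "card (characters L) \<le> card (invariant_characters H L) ^ ((s + 1) ^ ?k)"
    using card_characters_trivial_on_conj_kernel[OF H(1) L(1) finite_characters hsc]
      in_general_position_product[OF H(1) L(1) _ L(3)] hsc unfolding all L(2) by blast
  also have "\<dots> \<le> (p ^ (s ^ 2) * card (characters H)) ^ ((s + 1) ^ ?k)"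
    using card_invariant_characters[OF L(1) Ho finite_characters] unfolding L(2) by (intro power_mono) auto
  finally have "real (card (characters L)) \<le> real ((p ^ (s ^ 2) * card (characters H)) ^ ((s + 1) ^ ?k))"
    by (rule of_nat_mono)
  also have "\<dots> = (real p ^ (s ^ 2) * ?c) ^ ((s + 1) ^ ?k)" by simp
  also have "\<dots> \<le> (p powr (5 / 2 * m)) ^ ((s + 1) ^ ?k)"
  proof (rule power_mono)
    have "real p ^ (s ^ 2) = p powr real (s ^ 2)" using p_gt_1 by (subst powr_realpow) auto
    also have "\<dots> \<le> p powr m" using m p_gt_1 by (intro powr_mono) auto
    finally have "real p ^ (s ^ 2) * ?c \<le> p powr m * p powr (3 / 2 * m)" using c by (intro mult_mono) auto
    also have "\<dots> = p powr (5 / 2 * m)" by (simp flip: powr_add)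
    finally show "real p ^ (s ^ 2) * ?c \<le> p powr (5 / 2 * m)" .
  qed simp
  also have "\<dots> = p powr (5 / 2 * m * real ((s + 1) ^ ?k))"
    using p_gt_1 by (simp add: powr_power mult.commute)
  also have "5 / 2 * m * real ((s + 1) ^ ?k) = m * (5 / 2 * real (s + 1) ^ ?k)" by simp
  finally have up: "real (card (characters L)) \<le> p powr (m * (5 / 2 * real (s + 1) ^ ?k))" .
  have "real (index_in (carrier G) H * p ^ s) \<le> idx L"
    using kernel_chain_index[OF L(1) Ho] unfolding L(2) by (rule of_nat_mono)
  then have "\<rho> * (idx H * real p ^ s) \<le> \<rho> * idx L" using \<rho>_pos by (intro mult_left_mono) auto
  then have "p powr (m * real p ^ s) \<le> p powr (\<rho> * idx L)"
    using p_gt_1 by (intro powr_mono) (auto simp: m_def mult.assoc)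
  also have "\<dots> \<le> card (characters L)" using card_lower[OF Lo(1)] .
  finally have "p powr (m * real p ^ s) \<le> p powr (m * (5 / 2 * real (s + 1) ^ ?k))" using up by linarith
  then have "m * real p ^ s \<le> m * (5 / 2 * real (s + 1) ^ ?k)" using p_gt_1 by (simp add: powr_le_cancel_iff)
  then show False using s m(3) by (simp add: mult_le_cancel_left)
qed

end

section \<open>Word identities on cosets\<close>

context group begin

text \<open>Letters are indices instead of group elements, so that one word can be evaluated at varying tuples.\<close>

definition letter_value :: "(nat \<Rightarrow> 'a) \<Rightarrow> nat \<times> bool \<Rightarrow> 'a" where
  "letter_value b l = letter_val G (b (fst l), snd l)"

definition word_value :: "(nat \<Rightarrow> 'a) \<Rightarrow> (nat \<times> bool) list \<Rightarrow> 'a" where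
  "word_value b w = word_val G (map (map_prod b id) w)"

lemma word_value_Nil [simp]: "word_value b [] = \<one>"
  by (simp add: word_value_def word_val_def)

lemma word_value_Cons [simp]: "word_value b (l # w) = letter_value b l \<otimes> word_value b w"
  by (simp add: word_value_def word_val_def letter_value_def map_prod_def split_beta)

lemma letter_value_closed [simp]: "(\<And>i. b i \<in> carrier G) \<Longrightarrow> letter_value b l \<in> carrier G"
  by (simp add: letter_value_def letter_val_def)

lemma word_value_closed [simp]: "(\<And>i. b i \<in> carrier G) \<Longrightarrow> word_value b w \<in> carrier G"
  by (induction w) auto

lemma word_value_append:
  "(\<And>i. b i \<in> carrier G) \<Longrightarrow> word_value b (v @ w) = word_value b v \<otimes> word_value b w"
  by (induction v) (auto simp: m_assoc)

text \<open>Replacing the variable \<open>x\<close> by \<open>y\<close> times \<open>x\<close> inserts into the word, at each occurrence of \<open>x\<close>, a conjugate of \<open>y\<close> or its inverse.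
  The conjugating element is the value of the prefix before the occurrence if the letter is positive, and of the prefix that includes it if the
  letter is an inverse.\<close>

lemma perturbed_word_in_subgroup:
  assumes a: "\<And>i. a i \<in> carrier G" and y: "y \<in> carrier G" and Z: "subgroup Z G"
    and b: "b = a(x := y \<otimes> a x)" and g: "g \<in> carrier G"
    and occ: "\<And>t. t < length w \<Longrightarrow> fst (w ! t) = x \<Longrightarrow>
      (g \<otimes> word_value a (take (if snd (w ! t) then t else Suc t) w)) \<otimes> y \<otimes>
        inv (g \<otimes> word_value a (take (if snd (w ! t) then t else Suc t) w)) \<in> Z"
  shows "g \<otimes> word_value b w \<otimes> inv (word_value a w) \<otimes> inv g \<in> Z"
  using g occ
proof (induction w arbitrary: g)
  case Nil
  then show ?case using Z by (simp add: subgroup.one_closed)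
next
  case (Cons l w)
  let ?c = "letter_value a l"
  have bc: "b i \<in> carrier G" for i using a y b by simp
  note g = Cons.prems(1)
  have "(g \<otimes> ?c) \<otimes> word_value b w \<otimes> inv (word_value a w) \<otimes> inv (g \<otimes> ?c) \<in> Z"
  proof (rule Cons.IH)
    show "g \<otimes> ?c \<in> carrier G" using g a by simp
    fix t assume t: "t < length w" "fst (w ! t) = x"
    have "take (if snd ((l # w) ! Suc t) then Suc t else Suc (Suc t)) (l # w)
        = l # take (if snd (w ! t) then t else Suc t) w" by simp
    then have "g \<otimes> word_value a (take (if snd ((l # w) ! Suc t) then Suc t else Suc (Suc t)) (l # w))
        = (g \<otimes> ?c) \<otimes> word_value a (take (if snd (w ! t) then t else Suc t) w)"
      using g a by (simp add: m_assoc)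
    then show "((g \<otimes> ?c) \<otimes> word_value a (take (if snd (w ! t) then t else Suc t) w)) \<otimes> y \<otimes>
        inv ((g \<otimes> ?c) \<otimes> word_value a (take (if snd (w ! t) then t else Suc t) w)) \<in> Z"
      using Cons.prems(2)[of "Suc t"] t by (simp only: length_Cons nth_Cons_Suc Suc_less_eq)
  qed
  then have rest: "g \<otimes> ?c \<otimes> word_value b w \<otimes> inv (word_value a w) \<otimes> inv ?c \<otimes> inv g \<in> Z"
    using g a bc by (simp add: word_simps)
  have head: "g \<otimes> letter_value b l \<otimes> inv ?c \<otimes> inv g \<in> Z"
  proof (cases "fst l = x")
    case False
    then have "letter_value b l = ?c" using b by (simp add: letter_value_def)
    then show ?thesis using g a Z by (simp add: m_assoc subgroup.one_closed)
  next
    case x: True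
    show ?thesis
    proof (cases "snd l")
      case True
      then have "letter_value b l = y \<otimes> ?c" using x b by (simp add: letter_value_def letter_val_def)
      moreover have "g \<otimes> y \<otimes> inv g \<in> Z" using Cons.prems(2)[of 0] x True g by simp
      ultimately show ?thesis using g a y by (simp add: m_assoc)
    next
      case False
      have c: "?c = inv (a x)" using x False by (simp add: letter_value_def letter_val_def)
      have lb: "letter_value b l = ?c \<otimes> inv y"
        using x b False a y by (simp add: letter_value_def letter_val_def inv_mult_group)
      have "(g \<otimes> ?c) \<otimes> y \<otimes> inv (g \<otimes> ?c) \<in> Z" using Cons.prems(2)[of 0] x False a by simp
      then have "inv ((g \<otimes> ?c) \<otimes> y \<otimes> inv (g \<otimes> ?c)) \<in> Z" by (rule subgroup.m_inv_closed[OF Z])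
      then show ?thesis unfolding lb using g a y by (simp add: word_simps)
    qed
  qed
  have "(g \<otimes> letter_value b l \<otimes> inv ?c \<otimes> inv g) \<otimes>
      (g \<otimes> ?c \<otimes> word_value b w \<otimes> inv (word_value a w) \<otimes> inv ?c \<otimes> inv g) \<in> Z"
    using head rest by (rule subgroup.m_closed[OF Z])
  then show ?case using g a bc by (simp add: word_simps)
qed

end

lemma reduced_word_sublist:
  assumes "reduced_word (u @ v @ w)"
  shows "reduced_word v"
  using assms by (simp add: reduced_word_def successively_append_iff)

context topological_group begin

definition in_coset_tuple :: "(nat \<Rightarrow> 'a) \<Rightarrow> 'a set \<Rightarrow> (nat \<Rightarrow> 'a) \<Rightarrow> bool" where
  "in_coset_tuple a N b \<longleftrightarrow> (\<forall>i. b i \<in> carrier G \<and> inv (a i) \<otimes> b i \<in> N)"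

lemma in_coset_tuple_refl:
  "(\<And>i. a i \<in> carrier G) \<Longrightarrow> open_normal N \<Longrightarrow> in_coset_tuple a N a"
  using open_subgroupD(4)[OF open_normal_imp_open_subgroup] by (simp add: in_coset_tuple_def)

lemma in_coset_tuple_trans:
  assumes a: "\<And>i. a i \<in> carrier G" and N: "open_normal N" "M \<subseteq> N"
    and b: "in_coset_tuple a N b" and c: "in_coset_tuple b M c"
  shows "in_coset_tuple a N c"
  unfolding in_coset_tuple_def
proof
  fix i
  note Ns = open_subgroupD[OF open_normal_imp_open_subgroup[OF N(1)]]
  have 1: "b i \<in> carrier G" "inv (a i) \<otimes> b i \<in> N" using b by (auto simp: in_coset_tuple_def)
  have 2: "c i \<in> carrier G" "inv (b i) \<otimes> c i \<in> N" using c N by (auto simp: in_coset_tuple_def)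
  have "(inv (a i) \<otimes> b i) \<otimes> (inv (b i) \<otimes> c i) \<in> N" using Ns(7) 1 2 by blast
  then show "c i \<in> carrier G \<and> inv (a i) \<otimes> c i \<in> N" using 1 2 a by (simp add: m_assoc)
qed

lemma word_value_cong:
  assumes a: "\<And>i. a i \<in> carrier G" and N: "open_normal N" and b: "in_coset_tuple a N b"
  shows "inv (word_value a w) \<otimes> word_value b w \<in> N"
proof (induction w)
  note Ns = open_subgroupD[OF open_normal_imp_open_subgroup[OF N]]
  have bc: "b i \<in> carrier G" and bN: "inv (a i) \<otimes> b i \<in> N" for i using b by (auto simp: in_coset_tuple_def)
  {
    case Nil
    then show ?case using Ns by simp
  next
    case (Cons l w)
    let ?c = "letter_value a l" and ?d = "letter_value b l" and ?u = "word_value a w" and ?v = "word_value b w"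
    have "inv ?c \<otimes> ?d \<in> N"
    proof (cases "snd l")
      case True
      then show ?thesis using bN by (simp add: letter_value_def letter_val_def)
    next
      case False
      let ?x = "a (fst l)" and ?y = "b (fst l)"
      have "?x \<otimes> inv (inv ?x \<otimes> ?y) \<otimes> inv ?x \<in> N"
        using open_normal_conj[OF N a Ns(6)[OF bN]] .
      then show ?thesis using False a[of "fst l"] bc[of "fst l"]
        by (simp add: letter_value_def letter_val_def word_simps)
    qed
    then have "inv ?u \<otimes> (inv ?c \<otimes> ?d) \<otimes> ?u \<in> N" using a by (intro open_normal_conj'[OF N]) auto
    then have "(inv ?u \<otimes> (inv ?c \<otimes> ?d) \<otimes> ?u) \<otimes> (inv ?u \<otimes> ?v) \<in> N" using Cons Ns(7) by blast
    then show ?case using a bc by (simp add: word_simps)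
  }
qed

end

context tight_pro_p_group begin

lemma subgroup_centralizer: "subgroup centralizer G"
proof (rule subgroupI)
  note Hs = open_subgroupD[OF open_normal_imp_open_subgroup[OF H0]]
  show "centralizer \<subseteq> carrier G" by (auto simp: centralizer_def)
  show "centralizer \<noteq> {}" using Hs by (auto simp: centralizer_def intro!: exI[of _ \<one>])
  fix a assume a: "a \<in> centralizer"
  have ac: "a \<in> carrier G" using a by (simp add: centralizer_def)
  have "inv a \<otimes> h = h \<otimes> inv a" if h: "h \<in> H0" for h
  proof -
    have "inv a \<otimes> (h \<otimes> a) \<otimes> inv a = inv a \<otimes> (a \<otimes> h) \<otimes> inv a" using a h by (simp add: centralizer_def)
    then show ?thesis using ac Hs(5)[OF h] by (simp add: m_assoc)
  qed
  then show "inv a \<in> centralizer" using ac by (simp add: centralizer_def)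
  fix b assume b: "b \<in> centralizer"
  have bc: "b \<in> carrier G" using b by (simp add: centralizer_def)
  have "(a \<otimes> b) \<otimes> h = h \<otimes> (a \<otimes> b)" if h: "h \<in> H0" for h
  proof -
    have "(a \<otimes> b) \<otimes> h = a \<otimes> (h \<otimes> b)" using a b h ac bc Hs(5)[OF h] by (simp add: centralizer_def m_assoc)
    also have "\<dots> = (h \<otimes> a) \<otimes> b" using a h ac bc Hs(5)[OF h] by (simp add: centralizer_def m_assoc[symmetric])
    finally show ?thesis using ac bc Hs(5)[OF h] by (simp add: m_assoc)
  qed
  then show "a \<otimes> b \<in> centralizer" using ac bc by (simp add: centralizer_def)
qed

lemma centralizer_conj:
  assumes z: "z \<in> centralizer" and g: "g \<in> carrier G"
  shows "g \<otimes> z \<otimes> inv g \<in> centralizer"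
proof -
  note Hs = open_subgroupD[OF open_normal_imp_open_subgroup[OF H0]]
  have zc: "z \<in> carrier G" using z by (simp add: centralizer_def)
  have "(g \<otimes> z \<otimes> inv g) \<otimes> h = h \<otimes> (g \<otimes> z \<otimes> inv g)" if h: "h \<in> H0" for h
  proof -
    let ?h = "inv g \<otimes> h \<otimes> g"
    have "z \<otimes> ?h = ?h \<otimes> z" using z open_normal_conj'[OF H0 g h] by (simp add: centralizer_def)
    then have "g \<otimes> (z \<otimes> ?h) \<otimes> inv g = g \<otimes> (?h \<otimes> z) \<otimes> inv g" by simp
    then show ?thesis using g zc Hs(5)[OF h] by (simp add: m_assoc)
  qed
  then show ?thesis using g zc by (simp add: centralizer_def)
qed

definition central_on_coset :: "(nat \<times> bool) list \<Rightarrow> (nat \<Rightarrow> 'a) \<Rightarrow> 'a set \<Rightarrow> bool" where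
  "central_on_coset w a N \<longleftrightarrow> (\<forall>i. a i \<in> carrier G) \<and> open_normal N \<and> N \<subseteq> H0
    \<and> (\<forall>b. in_coset_tuple a N b \<longrightarrow> word_value b w \<in> centralizer)"

text \<open>For one word at a time: its value at some tuple fails to commute with some \<open>h \<in> H0\<close>, and this remains true modulo
  a small open normal subgroup.\<close>

lemma exists_subcoset_noncentral:
  assumes a: "\<And>i. a i \<in> carrier G" and N: "open_normal N" "N \<subseteq> H0"
    and vs: "\<And>v a N. v \<in> set vs \<Longrightarrow> \<not> central_on_coset v a N"
  shows "\<exists>a' N'. in_coset_tuple a N a' \<and> open_normal N' \<and> N' \<subseteq> N \<and>
    (\<forall>v\<in>set vs. \<forall>b. in_coset_tuple a' N' b \<longrightarrow> word_value b v \<notin> centralizer)"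
  using vs
proof (induction vs)
  case Nil
  then show ?case using in_coset_tuple_refl[of a, OF a N(1)] N by auto
next
  case (Cons v vs)
  then obtain a' N' where a': "in_coset_tuple a N a'" "open_normal N'" "N' \<subseteq> N"
    "\<forall>v\<in>set vs. \<forall>b. in_coset_tuple a' N' b \<longrightarrow> word_value b v \<notin> centralizer" by auto
  have a'c: "a' i \<in> carrier G" for i using a' by (simp add: in_coset_tuple_def)
  have "\<not> central_on_coset v a' N'" using Cons.prems by simp
  then obtain c where c: "in_coset_tuple a' N' c" "word_value c v \<notin> centralizer"
    using a'c a' N by (auto simp: central_on_coset_def)
  have cc: "c i \<in> carrier G" for i using c by (simp add: in_coset_tuple_def)
  let ?g = "word_value c v"
  have gc: "?g \<in> carrier G" using cc by simp
  obtain h where h: "h \<in> H0" "?g \<otimes> h \<noteq> h \<otimes> ?g" using c gc by (auto simp: centralizer_def)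
  have hc: "h \<in> carrier G" using h open_subgroupD(5)[OF open_normal_imp_open_subgroup[OF H0]] by blast
  let ?t = "inv (h \<otimes> ?g) \<otimes> (?g \<otimes> h)"
  have "?t \<noteq> \<one>"
  proof
    assume "?t = \<one>"
    then have "(h \<otimes> ?g) \<otimes> ?t = h \<otimes> ?g" using gc hc by simp
    then show False using h gc hc by simp
  qed
  then obtain M where M: "open_normal M" "?t \<notin> M" using open_normal_avoids[of ?t] gc hc by auto
  note Ms = open_subgroupD[OF open_normal_imp_open_subgroup[OF M(1)]]
  let ?N = "N' \<inter> M"
  have "word_value b v \<notin> centralizer" if b: "in_coset_tuple c ?N b" for b
  proof
    assume z: "word_value b v \<in> centralizer"
    have "in_coset_tuple c M b" using b by (auto simp: in_coset_tuple_def)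
    from word_value_cong[of c, OF cc M(1) this, of v]
    have m: "inv ?g \<otimes> word_value b v \<in> M" .
    define m where "m = inv ?g \<otimes> word_value b v"
    have bc: "b i \<in> carrier G" for i using b by (simp add: in_coset_tuple_def)
    have mc: "m \<in> carrier G" and mM: "m \<in> M" using m gc bc by (auto simp: m_def)
    have gm: "word_value b v = ?g \<otimes> m" using gc bc by (simp add: m_def)
    have "?g \<otimes> m \<otimes> h = h \<otimes> (?g \<otimes> m)" using z h(1) unfolding gm by (simp add: centralizer_def)
    then have "inv (h \<otimes> ?g) \<otimes> (?g \<otimes> m \<otimes> h) = m" using gc hc mc by (simp add: word_simps)
    moreover have "inv (h \<otimes> ?g) \<otimes> (?g \<otimes> m \<otimes> h) = ?t \<otimes> (inv h \<otimes> m \<otimes> h)"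
      using gc hc mc by (simp add: word_simps)
    ultimately have "?t \<otimes> (inv h \<otimes> m \<otimes> h) = m" by simp
    then have "?t = m \<otimes> inv (inv h \<otimes> m \<otimes> h)"
      using gc hc mc by (subst inv_solve_right) auto
    moreover have "m \<otimes> inv (inv h \<otimes> m \<otimes> h) \<in> M"
      using Ms(7)[OF mM Ms(6)[OF open_normal_conj'[OF M(1) hc mM]]] .
    ultimately show False using M(2) by simp
  qed
  moreover have "word_value b u \<notin> centralizer" if "in_coset_tuple c ?N b" "u \<in> set vs" for b u
  proof -
    have "in_coset_tuple a' N' b"
      using in_coset_tuple_trans[of a', OF a'c a'(2) _ c(1), of ?N b] that by blast
    then show ?thesis using a'(4) that by blast
  qed
  moreover have "in_coset_tuple a N c"
    using in_coset_tuple_trans[of a, OF a N(1) a'(3) a'(1) c(1)] .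
  ultimately show ?case
    using open_normal_Int[OF a'(2) M(1)] a'(3) by (intro exI[of _ c] exI[of _ ?N]) auto
qed

text \<open>Let \<open>w\<close> be a shortest counterexample.  It is cyclically reduced because \<open>centralizer\<close> is normal, and on a smaller coset no
  proper nonempty subword of \<open>w\<close> takes a value in \<open>centralizer\<close>.  Let \<open>x\<close> be the variable of the first letter.  The
  prefixes that matter in \<open>perturbed_word_in_subgroup\<close> have different lengths as \<open>w\<close> is reduced, and quotients of their values are values of proper nonempty
  subwords as \<open>w\<close> is cyclically reduced; so these quotients are not in \<open>centralizer\<close>.  The value of \<open>w\<close> is constant on the coset,
  because \<open>centralizer\<close> meets \<open>H0\<close> trivially.  Hence a small \<open>y\<close> is a product of conjugates of
  itself and its inverse by these quotients, which is what \<open>noncentral_conjugates_not_controlling\<close> excludes.\<close>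

theorem not_central_on_coset:
  assumes "reduced_word w" "w \<noteq> []"
  shows "\<not> central_on_coset w a N"
  using assms
proof (induction "length w" arbitrary: w a N rule: less_induct)
  case less
  note IH = less.hyps
  show ?case
  proof
    assume cen: "central_on_coset w a N"
    have a: "\<And>i. a i \<in> carrier G" and N: "open_normal N" "N \<subseteq> H0"
      and wc: "\<And>b. in_coset_tuple a N b \<Longrightarrow> word_value b w \<in> centralizer"
      using cen by (auto simp: central_on_coset_def)
    obtain l v where w: "w = l # v" using less.prems by (cases w) auto
    define x where "x = fst l"
    \<comment> \<open>\<open>n0\<close> is the length of the prefix attached to the first letter.\<close>
    define n0 where "n0 = (if snd l then 0 else 1 :: nat)"
    have cyc: "\<not> (snd l \<and> last w = (x, False))"
    proof
      assume l: "snd l \<and> last w = (x, False)"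
      have "v \<noteq> []" using l w by auto
      then obtain u where v: "v = u @ [(x, False)]"
        using l w by (metis append_butlast_last_id last_ConsR)
      have l': "l = (x, True)" using l by (simp add: x_def prod_eq_iff)
      have w': "w = [(x, True)] @ u @ [(x, False)]" using w v l' by simp
      have u: "u \<noteq> []" using less.prems(1) w' by (auto simp: reduced_word_def)
      have "central_on_coset u a N"
        unfolding central_on_coset_def
      proof (intro conjI allI impI)
        fix b assume b: "in_coset_tuple a N b"
        then have bc: "b i \<in> carrier G" for i by (simp add: in_coset_tuple_def)
        have e: "word_value b w = b x \<otimes> word_value b u \<otimes> inv (b x)"
          unfolding w' using bc by (simp add: word_value_append letter_value_def letter_val_def m_assoc)
        have "inv (b x) \<otimes> word_value b w \<otimes> inv (inv (b x)) \<in> centralizer"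
          using wc[OF b] bc by (intro centralizer_conj) auto
        then show "word_value b u \<in> centralizer" unfolding e using bc by (simp add: m_assoc)
      qed (use a N in auto)
      moreover have "reduced_word u" using reduced_word_sublist less.prems(1) w' by metis
      ultimately show False using IH[of u a N] u w' by simp
    qed
    define vs where "vs = filter (\<lambda>u. u \<noteq> [] \<and> length u < length w)
      (map (\<lambda>(m, n). drop n (take m w)) (List.product [0..<Suc (length w)] [0..<Suc (length w)]))"
    have vs_iff: "u \<in> set vs \<longleftrightarrow> u \<noteq> [] \<and> length u < length w \<and>
        (\<exists>m n. m \<le> length w \<and> n \<le> length w \<and> u = drop n (take m w))" for u
    proof -
      have "set (List.product [0..<Suc (length w)] [0..<Suc (length w)]) = {..length w} \<times> {..length w}"
        by (simp only: set_product set_upt atLeast0LessThan lessThan_Suc_atMost)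
      then show ?thesis unfolding vs_def set_filter set_map by auto
    qed
    have vs: "\<not> central_on_coset u a N" if u: "u \<in> set vs" for u a N
    proof -
      obtain m n where u': "u = drop n (take m w)" using u vs_iff by blast
      have "(take n (take m w) @ drop n (take m w)) @ drop m w = w" by (simp only: append_take_drop_id)
      then have "reduced_word (take n (take m w) @ u @ drop m w)"
        using less.prems(1) unfolding u' by (simp only: append_assoc)
      then have "reduced_word u" by (rule reduced_word_sublist)
      then show ?thesis using IH[of u] u vs_iff by blast
    qed
    obtain a' N' where a': "in_coset_tuple a N a'" "open_normal N'" "N' \<subseteq> N"
      "\<And>u b. u \<in> set vs \<Longrightarrow> in_coset_tuple a' N' b \<Longrightarrow> word_value b u \<notin> centralizer"
      using exists_subcoset_noncentral[of a, OF a N, of vs] vs by blast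
    have a'c: "\<And>i. a' i \<in> carrier G" using a' by (simp add: in_coset_tuple_def)
    have sub: "word_value a' (drop n (take m w)) \<notin> centralizer"
      if "n < m" "m \<le> length w" "m - n < length w" for m n
    proof (rule a'(4)[OF _ in_coset_tuple_refl[of a', OF a'c a'(2)]])
      show "drop n (take m w) \<in> set vs" unfolding vs_iff
        using that by (intro conjI exI[of _ m] exI[of _ n]) auto
    qed
    define prefix where "prefix = (\<lambda>t. if snd (v ! t) then t else Suc t)"
    define quot where "quot = (\<lambda>t. inv (word_value a' (take n0 w)) \<otimes> word_value a' (take (Suc (prefix t)) w))"
    define hs where "hs = map quot (filter (\<lambda>t. fst (v ! t) = x) [0..<length v])"
    have nc: "set hs \<subseteq> carrier G - centralizer"
    proof
      fix h assume "h \<in> set hs"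
      then obtain t where t: "t < length v" "fst (v ! t) = x" "h = quot t" by (auto simp: hs_def)
      have le: "Suc (prefix t) \<le> length w" using t w by (auto simp: prefix_def)
      have lt: "n0 < Suc (prefix t)"
      proof (cases "n0 = 0 \<or> prefix t > 0")
        case False
        then have f: "\<not> snd l" "t = 0" "snd (v ! 0)" by (auto simp: n0_def prefix_def split: if_splits)
        then have "v \<noteq> []" using t by auto
        then have "\<not> (fst l = fst (v ! 0) \<and> snd l \<noteq> snd (v ! 0))"
          using less.prems(1) w by (cases v) (auto simp: reduced_word_def)
        then show ?thesis using f t x_def by auto
      qed (auto simp: n0_def)
      have len: "Suc (prefix t) - n0 < length w"
      proof (rule ccontr)
        assume "\<not> ?thesis"
        then have "n0 = 0" "Suc (prefix t) = length w" using le lt w by (auto simp: n0_def split: if_splits)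
        then have s: "snd l" "Suc t = length v" "\<not> snd (v ! t)"
          using w t by (auto simp: n0_def prefix_def split: if_splits)
        then have ne: "v \<noteq> []" by auto
        have "last w = v ! t" using w ne s(2)[symmetric] by (simp add: last_conv_nth)
        moreover have "v ! t = (x, False)" using s(3) t(2) by (simp add: prod_eq_iff)
        ultimately show False using cyc s(1) by simp
      qed
      have "take n0 (take (Suc (prefix t)) w) = take n0 w" using lt by (simp only: take_take) (simp add: min_def)
      then have "take n0 w @ drop n0 (take (Suc (prefix t)) w) = take (Suc (prefix t)) w"
        using append_take_drop_id[of n0 "take (Suc (prefix t)) w"] by simp
      then have "word_value a' (take (Suc (prefix t)) w)
          = word_value a' (take n0 w) \<otimes> word_value a' (drop n0 (take (Suc (prefix t)) w))"
        using word_value_append[of a', OF a'c, of "take n0 w" "drop n0 (take (Suc (prefix t)) w)"] by simp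
      then have "h = word_value a' (drop n0 (take (Suc (prefix t)) w))"
        using t a'c by (simp add: quot_def)
      then show "h \<in> carrier G - centralizer" using sub[OF lt le len] a'c by simp
    qed
    show False
    proof (rule noncentral_conjugates_not_controlling[OF nc a'(2)])
      fix Z y assume Z: "subgroup Z G" and y: "y \<in> N'" and hZ: "\<forall>h\<in>set hs. h \<otimes> y \<otimes> inv h \<in> Z"
      have yc: "y \<in> carrier G" using y open_subgroupD(5)[OF open_normal_imp_open_subgroup[OF a'(2)]] by blast
      define b where "b = a'(x := y \<otimes> a' x)"
      have bc: "b i \<in> carrier G" for i using yc a'c by (simp add: b_def)
      have "in_coset_tuple a' N' b"
        using open_normal_conj'[OF a'(2) a'c y] open_subgroupD(4)[OF open_normal_imp_open_subgroup[OF a'(2)]] a'c yc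
        by (auto simp: in_coset_tuple_def b_def m_assoc)
      then have bN: "in_coset_tuple a N b"
        using in_coset_tuple_trans[of a, OF a N(1) a'(3) a'(1)] by blast
      \<comment> \<open>The two values are congruent modulo \<open>H0\<close> and both lie in the centralizer.\<close>
      have ba: "word_value b w = word_value a' w"
      proof -
        let ?z = "inv (word_value a' w) \<otimes> word_value b w"
        have "?z \<in> N'" using word_value_cong[of a', OF a'c a'(2) \<open>in_coset_tuple a' N' b\<close>] .
        then have "?z \<in> H0" using a' N by blast
        moreover have "?z \<in> centralizer"
          using wc[OF bN] wc[OF a'(1)] subgroup.m_closed[OF subgroup_centralizer]
            subgroup.m_inv_closed[OF subgroup_centralizer] by blast
        ultimately have "?z = \<one>" using centralizer_Int_H0 by blast
        then have "word_value a' w \<otimes> ?z = word_value a' w" using a'c by simp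
        then show ?thesis using a'c bc by simp
      qed
      let ?c = "letter_value a' l" and ?g0 = "word_value a' (take n0 w)"
      have cc: "?c \<in> carrier G" "?g0 \<in> carrier G" using a'c by auto
      have rest: "(inv ?g0 \<otimes> ?c) \<otimes> word_value b v \<otimes> inv (word_value a' v) \<otimes> inv (inv ?g0 \<otimes> ?c) \<in> Z"
      proof (rule perturbed_word_in_subgroup[of a', OF a'c yc Z b_def])
        show "inv ?g0 \<otimes> ?c \<in> carrier G" using cc by simp
        fix t assume t: "t < length v" "fst (v ! t) = x"
        have "(inv ?g0 \<otimes> ?c) \<otimes> word_value a' (take (prefix t) v) = quot t"
          using cc a'c by (simp add: quot_def w m_assoc)
        moreover have "quot t \<in> set hs" using t by (auto simp: hs_def)
        ultimately show "((inv ?g0 \<otimes> ?c) \<otimes> word_value a' (take (if snd (v ! t) then t else Suc t) v)) \<otimes> y \<otimes>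
            inv ((inv ?g0 \<otimes> ?c) \<otimes> word_value a' (take (if snd (v ! t) then t else Suc t) v)) \<in> Z"
          using hZ unfolding prefix_def by simp
      qed
      let ?k = "word_value b v \<otimes> inv (word_value a' v)"
      have kc: "?k \<in> carrier G" using bc a'c by simp
      have "letter_value b l \<otimes> word_value b v = ?c \<otimes> word_value a' v" using ba w by simp
      then have "letter_value b l \<otimes> word_value b v \<otimes> inv (word_value a' v) = ?c \<otimes> word_value a' v \<otimes> inv (word_value a' v)"
        by simp
      then have k: "letter_value b l \<otimes> ?k = ?c" using bc a'c by (simp add: m_assoc)
      have restk: "(inv ?g0 \<otimes> ?c) \<otimes> ?k \<otimes> inv (inv ?g0 \<otimes> ?c) \<in> Z"
        using rest cc bc a'c by (simp add: m_assoc)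
      show "y \<in> Z"
      proof (cases "snd l")
        case True
        have c: "?c = a' x" "letter_value b l = y \<otimes> ?c" "?g0 = \<one>"
          using True by (auto simp: letter_value_def letter_val_def x_def[symmetric] b_def n0_def)
        have "y \<otimes> (?c \<otimes> ?k \<otimes> inv ?c) = (y \<otimes> ?c \<otimes> ?k) \<otimes> inv ?c"
          using cc(1) kc yc by (simp add: m_assoc del: word_value_Cons)
        also have "\<dots> = \<one>" unfolding k[unfolded c(2)] using cc(1) by simp
        finally have "y = inv (?c \<otimes> ?k \<otimes> inv ?c)" using cc kc yc by (intro inv_equality[symmetric]) auto
        then show ?thesis using subgroup.m_inv_closed[OF Z restk] cc kc c(3) by simp
      next
        case False
        have c: "?c = inv (a' x)" "letter_value b l = ?c \<otimes> inv y" "?g0 = ?c"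
          using False yc a'c
          by (auto simp: letter_value_def letter_val_def x_def[symmetric] b_def n0_def w inv_mult_group)
        have "?c \<otimes> (inv y \<otimes> ?k) = ?c \<otimes> inv y \<otimes> ?k" using cc(1) kc yc by (intro m_assoc[symmetric]) auto
        also have "\<dots> = ?c" using k unfolding c(2) .
        finally have "inv ?c \<otimes> (?c \<otimes> (inv y \<otimes> ?k)) = inv ?c \<otimes> ?c" by simp
        then have "inv y \<otimes> ?k = \<one>" using cc(1) kc yc by simp
        then have "y \<otimes> (inv y \<otimes> ?k) = y" using yc by simp
        then have "?k = y" using kc yc by simp
        then show ?thesis using restk cc yc c(3) by simp
      qed
    qed
  qed
qed

end

section \<open>Dense free subgroups\<close>

context tight_pro_p_group begin

text \<open>A nested sequence of cosets is chosen such that the \<open>n\<close>-th word does not vanish on the coset with index \<open>n + 1\<close>; in each coordinate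
  the cosets are closed and have a common point by compactness.\<close>

lemma exists_free_tuple_in_coset:
  assumes a0: "\<And>i. a0 i \<in> carrier G" and N0: "open_normal N0" "N0 \<subseteq> H0"
  shows "\<exists>b. in_coset_tuple a0 N0 b \<and> (\<forall>w. reduced_word w \<and> w \<noteq> [] \<longrightarrow> word_value b w \<noteq> \<one>)"
proof -
  define P where "P = (\<lambda>(n::nat) (s :: (nat \<Rightarrow> 'a) \<times> 'a set). (\<forall>i. fst s i \<in> carrier G)
    \<and> open_normal (snd s) \<and> snd s \<subseteq> H0 \<and> in_coset_tuple a0 N0 (fst s) \<and> snd s \<subseteq> N0)"
  define Q where "Q = (\<lambda>n (s :: (nat \<Rightarrow> 'a) \<times> 'a set) (s' :: (nat \<Rightarrow> 'a) \<times> 'a set).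
    in_coset_tuple (fst s) (snd s) (fst s') \<and> snd s' \<subseteq> snd s \<and>
    (reduced_word (from_nat n :: (nat \<times> bool) list) \<and> from_nat n \<noteq> ([] :: (nat \<times> bool) list) \<longrightarrow>
      (\<forall>b. in_coset_tuple (fst s') (snd s') b \<longrightarrow> word_value b (from_nat n) \<noteq> \<one>)))"
  have "\<exists>f. \<forall>n. P n (f n) \<and> Q n (f n) (f (Suc n))"
  proof (rule dependent_nat_choice)
    show "\<exists>s. P 0 s"
      using a0 N0 in_coset_tuple_refl[of a0, OF a0 N0(1)] by (intro exI[of _ "(a0, N0)"]) (simp add: P_def)
    fix s n assume s: "P n s"
    obtain a N where sa: "s = (a, N)" by fastforce
    have a: "\<And>i. a i \<in> carrier G" and N: "open_normal N" "N \<subseteq> H0" "N \<subseteq> N0"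
      and aN: "in_coset_tuple a0 N0 a" using s by (auto simp: P_def sa)
    let ?w = "from_nat n :: (nat \<times> bool) list"
    show "\<exists>s'. P (Suc n) s' \<and> Q n s s'"
    proof (cases "reduced_word ?w \<and> ?w \<noteq> []")
      case False
      then show ?thesis using s in_coset_tuple_refl[of a, OF a N(1)]
        by (intro exI[of _ s]) (auto simp: P_def Q_def sa)
    next
      case True
      then have "\<not> central_on_coset ?w a N" using not_central_on_coset by blast
      then obtain c where c: "in_coset_tuple a N c" "word_value c ?w \<notin> centralizer"
        using a N by (auto simp: central_on_coset_def)
      have cc: "\<And>i. c i \<in> carrier G" using c by (simp add: in_coset_tuple_def)
      let ?g = "word_value c ?w"
      have gc: "?g \<in> carrier G" using cc by simp
      have "?g \<noteq> \<one>" using c(2) subgroup.one_closed[OF subgroup_centralizer] by auto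
      then obtain M where M: "open_normal M" "?g \<notin> M" using open_normal_avoids[OF gc] by blast
      have NM: "open_normal (N \<inter> M)" using open_normal_Int[OF N(1) M(1)] .
      have "word_value b ?w \<noteq> \<one>" if b: "in_coset_tuple c (N \<inter> M) b" for b
      proof
        assume "word_value b ?w = \<one>"
        moreover have "inv ?g \<otimes> word_value b ?w \<in> N \<inter> M" using word_value_cong[of c, OF cc NM b] .
        ultimately have "inv ?g \<in> M" using gc by simp
        then have "inv (inv ?g) \<in> M" using open_subgroupD(6)[OF open_normal_imp_open_subgroup[OF M(1)]] by blast
        then show False using M(2) gc by simp
      qed
      moreover have "in_coset_tuple a0 N0 c" using in_coset_tuple_trans[of a0, OF a0 N0(1) N(3) aN c(1)] .
      ultimately show ?thesis using NM N c(1) cc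
        by (intro exI[of _ "(c, N \<inter> M)"]) (auto simp: P_def Q_def sa)
    qed
  qed
  then obtain f where f: "\<And>n. P n (f n)" "\<And>n. Q n (f n) (f (Suc n))" by blast
  define a where "a = (\<lambda>n. fst (f n))"
  define N where "N = (\<lambda>n. snd (f n))"
  have ac: "\<And>n i. a n i \<in> carrier G" and No: "\<And>n. open_normal (N n)"
    and a0n: "\<And>n. in_coset_tuple a0 N0 (a n)" and NN0: "\<And>n. N n \<subseteq> N0"
    using f(1) by (auto simp: P_def a_def N_def)
  have step: "\<And>n. in_coset_tuple (a n) (N n) (a (Suc n))" "\<And>n. N (Suc n) \<subseteq> N n"
    and avoid: "\<And>n b. reduced_word (from_nat n :: (nat \<times> bool) list) \<Longrightarrow> from_nat n \<noteq> ([] :: (nat \<times> bool) list)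
      \<Longrightarrow> in_coset_tuple (a (Suc n)) (N (Suc n)) b \<Longrightarrow> word_value b (from_nat n) \<noteq> \<one>"
    using f(2) by (auto simp: Q_def a_def N_def)
  define C where "C = (\<lambda>i n. {y \<in> carrier G. inv (a n i) \<otimes> y \<in> N n})"
  have ex: "\<exists>y. \<forall>n. y \<in> C i n" for i
  proof -
    have "closedin T (C i n)" for n
      unfolding C_def using closedin_left_coset[OF open_normal_imp_open_subgroup[OF No] ac] .
    moreover have "C i n \<noteq> {}" for n
    proof -
      have "a n i \<in> C i n"
        using ac open_subgroupD(4)[OF open_normal_imp_open_subgroup[OF No]] by (simp add: C_def)
      then show ?thesis by blast
    qed
    moreover have "decseq (C i)"
    proof (rule decseq_SucI)
      fix n show "C i (Suc n) \<subseteq> C i n"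
      proof
        fix y assume y: "y \<in> C i (Suc n)"
        then have yc: "y \<in> carrier G" and "inv (a (Suc n) i) \<otimes> y \<in> N n"
          using step(2)[of n] by (auto simp: C_def)
        moreover have "inv (a n i) \<otimes> a (Suc n) i \<in> N n" using step(1)[of n] by (simp add: in_coset_tuple_def)
        ultimately have "(inv (a n i) \<otimes> a (Suc n) i) \<otimes> (inv (a (Suc n) i) \<otimes> y) \<in> N n"
          using open_subgroupD(7)[OF open_normal_imp_open_subgroup[OF No]] by blast
        then show "y \<in> C i n" using yc ac by (simp add: C_def m_assoc)
      qed
    qed
    ultimately have "(\<Inter>n. C i n) \<noteq> {}" by (intro compact_space_imp_nest[OF compact])
    then show ?thesis by blast
  qed
  then obtain b where b: "\<And>i n. b i \<in> C i n" by metis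
  have bn: "in_coset_tuple (a n) (N n) b" for n using b by (auto simp: in_coset_tuple_def C_def)
  have "word_value b w \<noteq> \<one>" if "reduced_word w" "w \<noteq> []" for w
    using avoid[of "to_nat w", OF _ _ bn] that by simp
  moreover have "in_coset_tuple a0 N0 b"
    using in_coset_tuple_trans[of a0, OF a0 N0(1) NN0 a0n bn] .
  ultimately show ?thesis by blast
qed

end

context pro_p_group begin

text \<open>If \<open>N\<close> is a small open normal subgroup, then \<open>F <#> N\<close> is an open subgroup containing \<open>F\<close>.\<close>

lemma subset_closure_if_generates:
  assumes F: "subgroup F G" and V: "\<And>V. open_subgroup V \<Longrightarrow> F \<subseteq> V \<Longrightarrow> K \<subseteq> V" and K: "K \<subseteq> carrier G"
  shows "K \<subseteq> T closure_of F"
proof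
  fix k assume k: "k \<in> K"
  have kc: "k \<in> carrier G" using k K by blast
  have "\<exists>y\<in>F. y \<in> U" if U: "openin T U" "k \<in> U" for U
  proof -
    have "openin T {y \<in> carrier G. k \<otimes> y \<in> U}" using openin_left_translate[OF U(1) kc] .
    moreover have "\<one> \<in> {y \<in> carrier G. k \<otimes> y \<in> U}" using U kc by simp
    ultimately obtain N where N: "open_normal N" "N \<subseteq> {y \<in> carrier G. k \<otimes> y \<in> U}"
      using open_normal_basis by blast
    note No = open_normal_imp_open_subgroup[OF N(1)]
    have FN: "open_subgroup (F <#> N)"
      using open_normal_conj[OF N(1) subgroup.mem_carrier[OF F]]
      by (intro extend_character(1)[OF No F character_trivial[OF No]]) auto
    have "F \<subseteq> F <#> N"
    proof
      fix y assume y: "y \<in> F"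
      then have "y \<otimes> \<one> \<in> F <#> N" using open_subgroupD(4)[OF No] by (auto simp: set_mult_def simp del: r_one)
      then show "y \<in> F <#> N" using subgroup.mem_carrier[OF F y] by simp
    qed
    then have "k \<in> F <#> N" using V[OF FN] k by blast
    then obtain y n where y: "y \<in> F" "n \<in> N" "k = y \<otimes> n" by (auto simp: set_mult_def)
    have "k \<otimes> inv n \<in> U" using open_subgroupD(6)[OF No y(2)] N by blast
    then have "y \<in> U" using y subgroup.mem_carrier[OF F y(1)] open_subgroupD(5)[OF No y(2)] by (simp add: m_assoc)
    then show ?thesis using y by blast
  qed
  then show "k \<in> T closure_of F" using kc by (auto simp: in_closure_of topspace_eq)
qed

lemma topologically_generates_if_generates:
  assumes K: "open_subgroup K" and X: "generates X K"
  shows "topologically_generates (G\<lparr>carrier := K\<rparr>) (subtopology T K) X"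
proof -
  note Ks = open_subgroupD[OF K]
  have XK: "X \<subseteq> K" using X by (simp add: generates_def)
  have gen: "generate (G\<lparr>carrier := K\<rparr>) X = generate G X"
    using generate_consistent[OF XK Ks(1)] by simp
  have F: "subgroup (generate G X) G" using XK Ks(3) by (intro generate_is_subgroup) auto
  have FK: "generate G X \<subseteq> K" using XK Ks(1) by (rule generate_subgroup_incl)
  have "X \<subseteq> generate G X" by (auto intro: generate.incl)
  then have "K \<subseteq> V" if "open_subgroup V" "generate G X \<subseteq> V" for V
    using X that by (auto simp: generates_def)
  then have "K \<subseteq> T closure_of generate G X" using subset_closure_if_generates[OF F _ Ks(3)] by blast
  then have "subtopology T K closure_of generate G X = K"
    using FK by (simp add: closure_of_subtopology Int_absorb1 Int_absorb2)
  then show ?thesis using XK gen by (simp add: topologically_generates_def)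
qed

lemma generates_carrier_if_topologically_generates:
  assumes "topologically_generates G T X"
  shows "generates X (carrier G)"
  unfolding generates_def
proof (intro conjI allI impI)
  show "X \<subseteq> carrier G" using assms by (simp add: topologically_generates_def)
  fix V assume V: "open_subgroup V \<and> X \<subseteq> V"
  then have "generate G X \<subseteq> V" using generate_subgroup_incl open_subgroupD(1) by blast
  then have "T closure_of generate G X \<subseteq> V" using V closedin_open_subgroup closure_of_minimal by blast
  then show "carrier G \<subseteq> V" using assms by (simp add: topologically_generates_def)
qed

text \<open>By \<open>burnside_basis\<close> the rank is at most the logarithm of the number of characters.\<close>

lemma positive_rank_gradient_imp_growth:
  assumes fin: "\<And>K. open_subgroup K \<Longrightarrow> finite (characters K)" and rg: "rank_gradient G T > 0"
  shows "\<exists>c>0::real. \<forall>K. open_subgroup K \<longrightarrow> c * index_in (carrier G) K \<le> log p (card (characters K))"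
proof -
  obtain c where c: "0 < ereal c" "ereal c < rank_gradient G T" using ereal_dense2[OF rg] by blast
  have "c * index_in (carrier G) K \<le> log p (card (characters K))" if K: "open_subgroup K" for K
  proof -
    let ?r = "top_rank (G\<lparr>carrier := K\<rparr>) (subtopology T K)"
    let ?i = "real (index_in (carrier G) K)"
    obtain X where X: "finite X" "generates X K" "p ^ card X \<le> card (characters K)"
      using burnside_basis[OF K fin[OF K]] by blast
    have i: "?i > 0" using index_in_pos[OF K open_subgroup_carrier open_subgroupD(3)[OF K]] by simp
    have "?r \<le> enat (card X)"
      unfolding top_rank_def using topologically_generates_if_generates[OF K X(2)] X(1)
      by (intro INF_lower) auto
    then have "ereal_of_enat ?r \<le> ereal_of_enat (enat (card X))" by (simp only: ereal_of_enat_le_iff)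
    then have r: "ereal_of_enat ?r \<le> ereal (card X)" by simp
    have "rank_gradient G T \<le> (ereal_of_enat ?r - 1) / ereal (real (card (rcosets K)))"
      unfolding rank_gradient_def using K by (intro INF_lower) (simp add: open_subgroup_def)
    then have "ereal c \<le> (ereal_of_enat ?r - 1) / ereal ?i"
      using c(2) by (simp add: index_in_carrier)
    also have "\<dots> \<le> (ereal (card X) - 1) / ereal ?i"
      using r i by (intro ereal_divide_right_mono ereal_minus_mono) auto
    also have "\<dots> = ereal ((real (card X) - 1) / ?i)" using i by (simp add: one_ereal_def)
    finally have "c \<le> (real (card X) - 1) / ?i" by simp
    then have "c * ?i \<le> real (card X) - 1" using i by (simp add: field_simps)
    moreover have "real (card X) \<le> log p (card (characters K))"
    proof -
      have "real (p ^ card X) \<le> real (card (characters K))" using X(3) by (rule of_nat_mono)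
      then have "log p (real p ^ card X) \<le> log p (card (characters K))"
        using prime_gt_1_nat[OF prime_p] by (intro log_mono) auto
      then show ?thesis using prime_gt_1_nat[OF prime_p] by (simp add: log_nat_power)
    qed
    ultimately show ?thesis by linarith
  qed
  then show ?thesis using c(1) by (intro exI[of _ c]) auto
qed

lemma open_normal_common_kernel:
  assumes "finite (characters (carrier G))"
  shows "open_normal (common_kernel (carrier G))"
proof -
  have "open_subgroup {y \<in> carrier G. \<forall>\<phi>\<in>F. \<phi> y = 1}" if "finite F" "F \<subseteq> characters (carrier G)" for F
    using that
  proof (induction F rule: finite_induct)
    case empty
    then show ?case using open_subgroup_carrier by simp
  next
    case (insert \<phi> F)
    have "{y \<in> carrier G. \<forall>\<psi>\<in>insert \<phi> F. \<psi> y = 1}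
        = {y \<in> carrier G. \<phi> y = 1} \<inter> {y \<in> carrier G. \<forall>\<psi>\<in>F. \<psi> y = 1}" by auto
    then show ?case
      using insert open_subgroup_Int open_subgroup_kernel[OF _ open_subgroup_carrier] by auto
  qed
  then have o: "open_subgroup (common_kernel (carrier G))"
    unfolding common_kernel_def using assms by blast
  moreover have "common_kernel (carrier G) \<lhd> G"
    unfolding normal_inv_iff
    using open_subgroupD(1)[OF o] common_kernel_conj[OF open_subgroup_carrier] by auto
  ultimately show ?thesis by (simp add: open_normal_def open_subgroup_def)
qed

text \<open>Changing generators by elements of the Frattini subgroup leaves the values of all characters unchanged.\<close>

lemma generates_perturb:
  assumes X: "generates X (carrier G)" and Y: "Y \<subseteq> carrier G"
    and XY: "\<And>x. x \<in> X \<Longrightarrow> \<exists>y\<in>Y. inv x \<otimes> y \<in> common_kernel (carrier G)"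
  shows "generates Y (carrier G)"
  unfolding generates_def
proof (intro conjI allI impI Y)
  fix V assume V: "open_subgroup V \<and> Y \<subseteq> V"
  show "carrier G \<subseteq> V"
  proof (rule ccontr)
    assume "\<not> carrier G \<subseteq> V"
    then obtain \<phi> where \<phi>: "\<phi> \<in> characters (carrier G)" "\<forall>u\<in>V. \<phi> u = 1" "\<exists>k\<in>carrier G. \<phi> k \<noteq> 1"
      using exists_nontrivial_character[OF _ open_subgroup_carrier] V open_subgroupD(3) by blast
    have "\<phi> x = 1" if x: "x \<in> X" for x
    proof -
      have xc: "x \<in> carrier G" using x X by (auto simp: generates_def)
      obtain y where y: "y \<in> Y" "inv x \<otimes> y \<in> common_kernel (carrier G)" using XY x by blast
      have yc: "y \<in> carrier G" using y Y by blast
      have "\<phi> (x \<otimes> (inv x \<otimes> y)) = \<phi> x * \<phi> (inv x \<otimes> y)"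
        using xc yc by (intro charactersD(1)[OF \<phi>(1)]) auto
      moreover have "\<phi> (inv x \<otimes> y) = 1" using y \<phi>(1) by (simp add: common_kernel_def)
      moreover have "\<phi> y = 1" using \<phi>(2) y V by blast
      ultimately show ?thesis using xc yc by simp
    qed
    then have "X \<subseteq> {y \<in> carrier G. \<phi> y = 1}" using X by (auto simp: generates_def)
    then have "carrier G \<subseteq> {y \<in> carrier G. \<phi> y = 1}"
      using X open_subgroup_kernel[OF \<phi>(1) open_subgroup_carrier] unfolding generates_def by blast
    then show False using \<phi>(3) by blast
  qed
qed

end

context group begin

lemma word_val_subgroup:
  assumes "subgroup F G" "fst ` set w \<subseteq> F"
  shows "word_val (G\<lparr>carrier := F\<rparr>) w = word_val G w"
  using assms(2)
proof (induction w)
  case (Cons l w)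
  have "letter_val (G\<lparr>carrier := F\<rparr>) l = letter_val G l"
    using Cons.prems m_inv_consistent[OF assms(1)] by (simp add: letter_val_def)
  then show ?case using Cons by (simp add: word_val_def)
qed (simp add: word_val_def)

lemma free_group_generated_by_free_tuple:
  assumes b: "\<And>i. b i \<in> carrier G"
    and free: "\<And>w. reduced_word w \<Longrightarrow> w \<noteq> [] \<Longrightarrow> word_value b w \<noteq> \<one>"
  shows "free_group (G\<lparr>carrier := generate G (range b)\<rparr>)"
    and "\<not> comm_group (G\<lparr>carrier := generate G (range b)\<rparr>)"
proof -
  let ?S = "range b" and ?F = "generate G (range b)"
  have Sc: "?S \<subseteq> carrier G" using b by blast
  have F: "subgroup ?F G" using generate_is_subgroup[OF Sc] .
  have SF: "?S \<subseteq> ?F" by (auto intro: generate.incl)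
  have "word_val G w \<noteq> \<one>" if w: "fst ` set w \<subseteq> ?S" "reduced_word w" "w \<noteq> []" for w
  proof -
    define v where "v = map (map_prod (inv_into UNIV b) id) w"
    have "map (map_prod b id) v = map id w"
      unfolding v_def map_map
    proof (rule map_cong[OF refl])
      fix l assume "l \<in> set w"
      then have "fst l \<in> range b" using w(1) by blast
      then show "(map_prod b id \<circ> map_prod (inv_into UNIV b) id) l = id l"
        by (simp add: prod_eq_iff f_inv_into_f)
    qed
    then have wv: "w = map (map_prod b id) v" by simp
    have "reduced_word v"
      using w(2) unfolding reduced_word_def wv
      by (auto simp: successively_map elim!: successively_mono)
    then have "word_value b v \<noteq> \<one>" using free w(3) wv by auto
    then show ?thesis using wv by (simp add: word_value_def)
  qed
  then have "free_basis (G\<lparr>carrier := ?F\<rparr>) ?S"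
    using SF generate_consistent[OF SF F] word_val_subgroup[OF F] by (fastforce simp: free_basis_def)
  then show "free_group (G\<lparr>carrier := ?F\<rparr>)"
    using subgroup_imp_group[OF F] by (auto simp: free_group_def)
  show "\<not> comm_group (G\<lparr>carrier := ?F\<rparr>)"
  proof
    assume "comm_group (G\<lparr>carrier := ?F\<rparr>)"
    then interpret C: comm_group "G\<lparr>carrier := ?F\<rparr>" .
    have "b 0 \<otimes> b 1 = b 1 \<otimes> b 0" using C.m_comm[of "b 0" "b 1"] SF by auto
    then have "b 0 \<otimes> b 1 \<otimes> inv (b 0) \<otimes> inv (b 1) = \<one>" using b[of 0] b[of 1] by (simp add: m_assoc)
    then have "word_value b [(0, True), (1, True), (0, False), (1, False)] = \<one>"
      using b by (simp add: letter_value_def letter_val_def m_assoc)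
    moreover have "reduced_word [(0::nat, True), (1, True), (0, False), (1, False)]"
      by (simp add: reduced_word_def)
    ultimately show False using free by blast
  qed
qed

end

context pro_p_group begin

text \<open>The free tuple is an infinite sequence whose first entries agree with given generators of \<open>G\<close> modulo the Frattini subgroup;
  so the free group that is obtained has infinite rank.\<close>

theorem exists_dense_free_subgroup:
  assumes "topologically_finitely_generated G T" and "rank_gradient G T > 0"
  shows "\<exists>F. subgroup F G \<and> free_group (G\<lparr>carrier := F\<rparr>) \<and> \<not> comm_group (G\<lparr>carrier := F\<rparr>)
    \<and> T closure_of F = carrier G"
proof -
  obtain X where X: "finite X" "generates X (carrier G)"
    using assms(1) generates_carrier_if_topologically_generates
    by (auto simp: topologically_finitely_generated_def)
  have fin: "finite (characters K)" if "open_subgroup K" for K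
    using schreier_bound(1)[OF that open_subgroup_carrier open_subgroupD(3)[OF that] X(2,1)] .
  have "\<exists>c>0::real. \<forall>K. open_subgroup K \<longrightarrow> c * index_in (carrier G) K \<le> log p (card (characters K))"
    by (rule positive_rank_gradient_imp_growth[OF _ assms(2)]) (rule fin)
  then obtain c :: real where c: "c > 0"
    "\<forall>K. open_subgroup K \<longrightarrow> c * index_in (carrier G) K \<le> log p (card (characters K))" by (elim exE conjE)
  have "\<exists>\<rho> H0. tight_pro_p_group G T p \<rho> H0"
    by (rule exists_tight[OF _ c(1)]) (use fin c(2) in auto)
  then obtain \<rho> H0 where "tight_pro_p_group G T p \<rho> H0" by (elim exE)
  then interpret tight_pro_p_group G T p \<rho> H0 .
  obtain xs where xs: "set xs = X" using finite_list[OF X(1)] by blast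
  have Xc: "X \<subseteq> carrier G" using X by (simp add: generates_def)
  define a where "a = (\<lambda>i. if i < length xs then xs ! i else \<one>)"
  have a: "a i \<in> carrier G" for i using xs Xc nth_mem[of i xs] by (auto simp: a_def)
  let ?N = "common_kernel (carrier G) \<inter> H0"
  have N: "open_normal ?N" using open_normal_Int[OF open_normal_common_kernel[OF fin[OF open_subgroup_carrier]] H0] .
  obtain b where b: "in_coset_tuple a ?N b" "\<And>w. reduced_word w \<Longrightarrow> w \<noteq> [] \<Longrightarrow> word_value b w \<noteq> \<one>"
    using exists_free_tuple_in_coset[of a, OF a N] by blast
  have bc: "b i \<in> carrier G" for i using b(1) by (simp add: in_coset_tuple_def)
  let ?F = "generate G (range b)"
  have bs: "range b \<subseteq> carrier G" using bc by blast
  have gen: "generates (range b) (carrier G)"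
  proof (rule generates_perturb[OF X(2) bs])
    fix x assume "x \<in> X"
    then obtain i where "i < length xs" "x = xs ! i" using xs by (metis in_set_conv_nth)
    moreover have "inv (a i) \<otimes> b i \<in> common_kernel (carrier G)" using b(1) by (simp add: in_coset_tuple_def)
    ultimately have "inv x \<otimes> b i \<in> common_kernel (carrier G)" by (simp add: a_def)
    then show "\<exists>y\<in>range b. inv x \<otimes> y \<in> common_kernel (carrier G)" by blast
  qed
  have F: "subgroup ?F G" using generate_is_subgroup[OF bs] .
  have "range b \<subseteq> ?F" by (auto intro: generate.incl)
  then have "carrier G \<subseteq> V" if "open_subgroup V" "?F \<subseteq> V" for V
    using gen that unfolding generates_def by blast
  then have "carrier G \<subseteq> T closure_of ?F" using subset_closure_if_generates[OF F] by blast
  then have "T closure_of ?F = carrier G" using closure_of_subset_topspace[of T ?F] topspace_eq by blast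
  then show ?thesis using F free_group_generated_by_free_tuple[of b, OF bc b(2)] by blast
qed

end

theorem theorem4:
  fixes G :: "('a, 'b) monoid_scheme" and T :: "'a topology" and p :: nat
  assumes "prime p"
    and "pro_p_group G T p"
    and "topologically_finitely_generated G T"
    and "rank_gradient G T > 0"
  shows "\<exists>F. subgroup F G
           \<and> free_group (G\<lparr>carrier := F\<rparr>)
           \<and> \<not> comm_group (G\<lparr>carrier := F\<rparr>)
           \<and> T closure_of F = carrier G"
  using pro_p_group.exists_dense_free_subgroup[OF assms(2-4)] .

end
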